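(* Let $\lambda,\mu>0$ and $T>0$. For every $(x,y)\in\mathbb{N}^2$, the system of equations, for $t\in[0,T]$, $$\overline{R}_{1}(t)=x-\int_0^t \overline{R}_{1}(s-)\,\mathcal{N}_{\mu}(ds)-\int_0^t \mathbf{1}_{\{\overline{R}_{1}(s-)>0\}}\,\mathcal{N}_{\lambda}(ds)+\iint_{[0,t]\times\mathbb{R}_+}\mathbf{1}_{\{0\le h\le\overline{R}_{2}(s-)\}}\,\overline{\mathcal{N}}_{\mu}(ds,dh),$$ $$\overline{R}_{2}(t)=y-\int_0^t\overline{R}_{2}(s-)\,\mathcal{N}_{\mu}(ds)-\iint_{[0,t]\times\mathbb{R}_+}\mathbf{1}_{\{0\le h\le \overline{R}_{2}(s-)\}}\,\overline{\mathcal{N}}_{\mu}(ds,dh)+\int_0^t\mathbf{1}_{\{\overline{R}_{1}(s-)>0\}}\,\mathcal{N}_{\lambda}(ds)+\iint_{[0,t]\times\mathbb{R}_+}\mathbf{1}_{\{0\le h\le \mathbb{P}(\overline{R}_{1}(s)>0)\}}\,\overline{\mathcal{N}}_{\lambda}(ds,dh)$$ has a unique solution $(\overline R_1(t),\overline R_2(t))$ in $\mathcal{D}_T$.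
   Context: $\mathbb{N}=\{0,1,2,\dots\}$. $\mathcal{D}_T=\mathcal{D}([0,T],\mathbb{N}^2)$ is the set of càdlàg functions from $[0,T]$ to $\mathbb{N}^2$, with the Skorohod topology. $f(t-)$ denotes the left limit of $f$ at $t$. $\mathcal{N}_\mu$ and $\mathcal{N}_\lambda$ are Poisson point processes on $\mathbb{R}_+$ with rates $\mu$ and $\lambda$; $\overline{\mathcal{N}}_{\mu}$ and $\overline{\mathcal{N}}_{\lambda}$ are Poisson point processes on $\mathbb{R}_+^2$ with intensities $\mu\,dt\,dh$ and $\lambda\,dt\,dh$. The four Poisson processes are independent. The equations are of McKean-Vlasov type: the quantity $\mathbb{P}(\overline{R}_{1}(s)>0)$ is computed under the law of the solution itself. In particular, the statement means that there is a unique probability distribution $\pi$ on $\mathcal{D}_T$ which is the distribution of a process $(\overline R_1(t),\overline R_2(t))$ satisfying these equations. *)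

theory Defs
  imports "HOL-Probability.Probability"
begin

section \<open>The Skorohod space of paths on [0,T] with values in pairs of natural numbers\<close>

text \<open>Paths are functions on the reals that are \<^const>\<open>undefined\<close> outside of [0,T], so that equality
  of paths is equality on [0,T]. The type of values carries its usual (discrete) topology.\<close>

definition cadlag_paths :: "real \<Rightarrow> (real \<Rightarrow> nat \<times> nat) set" where
  "cadlag_paths T = {f \<in> extensional {0..T}.
     (\<forall>t\<in>{0..<T}. (f \<longlongrightarrow> f t) (at_right t)) \<and>
     (\<forall>t\<in>{0<..T}. \<exists>l. (f \<longlongrightarrow> l) (at_left t))}"

text \<open>The convention f(0-) = f(0) is immaterial below: almost surely, no Poisson process has a point
  with time coordinate 0.\<close>

definition left_limit :: "(real \<Rightarrow> nat \<times> nat) \<Rightarrow> real \<Rightarrow> nat \<times> nat" where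
  "left_limit f t = (if t = 0 then f 0 else Lim (at_left t) f)"

definition time_changes :: "real \<Rightarrow> (real \<Rightarrow> real) set" where
  "time_changes T = {\<tau>. continuous_on {0..T} \<tau> \<and> strict_mono_on {0..T} \<tau> \<and> \<tau> ` {0..T} = {0..T}}"

definition skorohod_dist :: "real \<Rightarrow> (real \<Rightarrow> nat \<times> nat) \<Rightarrow> (real \<Rightarrow> nat \<times> nat) \<Rightarrow> real" where
  "skorohod_dist T f g = Inf {e. \<exists>\<tau>\<in>time_changes T. \<forall>t\<in>{0..T}.
     \<bar>\<tau> t - t\<bar> \<le> e \<and> dist (f t) (g (\<tau> t)) \<le> e}"

definition skorohod_topology :: "real \<Rightarrow> (real \<Rightarrow> nat \<times> nat) topology" where
  "skorohod_topology T = topology (\<lambda>U. U \<subseteq> cadlag_paths T \<and>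
     (\<forall>f\<in>U. \<exists>e>0. \<forall>g\<in>cadlag_paths T. skorohod_dist T f g < e \<longrightarrow> g \<in> U))"

lemma openin_skorohod_topology:
  "openin (skorohod_topology T) U \<longleftrightarrow> U \<subseteq> cadlag_paths T \<and>
     (\<forall>f\<in>U. \<exists>e>0. \<forall>g\<in>cadlag_paths T. skorohod_dist T f g < e \<longrightarrow> g \<in> U)"
proof -
  let ?op = "\<lambda>U. U \<subseteq> cadlag_paths T \<and>
     (\<forall>f\<in>U. \<exists>e>0. \<forall>g\<in>cadlag_paths T. skorohod_dist T f g < e \<longrightarrow> g \<in> U)"
  have inter: "?op (S \<inter> U)" if S: "?op S" and U: "?op U" for S U
  proof (intro conjI ballI)
    show "S \<inter> U \<subseteq> cadlag_paths T" using conjunct1[OF S] by (rule le_infI1)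
    fix f assume f: "f \<in> S \<inter> U"
    obtain d where d: "d > 0" "\<forall>g\<in>cadlag_paths T. skorohod_dist T f g < d \<longrightarrow> g \<in> S"
      using bspec[OF conjunct2[OF S] IntD1[OF f]] by (elim exE conjE)
    obtain e where e: "e > 0" "\<forall>g\<in>cadlag_paths T. skorohod_dist T f g < e \<longrightarrow> g \<in> U"
      using bspec[OF conjunct2[OF U] IntD2[OF f]] by (elim exE conjE)
    show "\<exists>e>0. \<forall>g\<in>cadlag_paths T. skorohod_dist T f g < e \<longrightarrow> g \<in> S \<inter> U"
      by (rule exI[of _ "min d e"]) (simp add: d e)
  qed
  have union: "?op (\<Union>K)" if K: "\<forall>U\<in>K. ?op U" for K
  proof (intro conjI ballI)
    show "\<Union>K \<subseteq> cadlag_paths T" using K by (intro Sup_least) simp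
    fix f assume "f \<in> \<Union>K"
    then obtain U where U: "U \<in> K" "f \<in> U" by (rule UnionE)
    obtain e where e: "e > 0" "\<forall>g\<in>cadlag_paths T. skorohod_dist T f g < e \<longrightarrow> g \<in> U"
      using bspec[OF conjunct2[OF bspec[OF K U(1)]] U(2)] by (elim exE conjE)
    show "\<exists>e>0. \<forall>g\<in>cadlag_paths T. skorohod_dist T f g < e \<longrightarrow> g \<in> \<Union>K"
      using e U(1) by (intro exI[of _ e] conjI ballI impI UnionI[of U]) simp_all
  qed
  have "istopology ?op"
    unfolding istopology_def
  proof (rule conjI)
    show "\<forall>S U. ?op S \<longrightarrow> ?op U \<longrightarrow> ?op (S \<inter> U)"
      by (rule allI, rule allI, rule impI, rule impI, rule inter)
    show "\<forall>K. (\<forall>U\<in>K. ?op U) \<longrightarrow> ?op (\<Union>K)"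
      by (rule allI, rule impI, rule union)
  qed
  then show ?thesis
    by (simp add: skorohod_topology_def topology_inverse')
qed

definition skorohod_borel :: "real \<Rightarrow> (real \<Rightarrow> nat \<times> nat) measure" where
  "skorohod_borel T = sigma (cadlag_paths T) {U. openin (skorohod_topology T) U}"


section \<open>Poisson point processes\<close>

text \<open>A point process is a random measure taking natural values on bounded sets.
  Any intensity measure is allowed; the second and third clauses determine the law of the process
  as soon as the intensity is sigma-finite.\<close>

definition poisson_point_process ::
  "'a measure \<Rightarrow> 's::metric_space measure \<Rightarrow> ('a \<Rightarrow> 's measure) \<Rightarrow> bool" where
  "poisson_point_process M \<nu> N \<longleftrightarrow>
     prob_space M \<and>
     (\<forall>\<omega>\<in>space M. sets (N \<omega>) = sets \<nu> \<and>
        (\<forall>A\<in>sets \<nu>. bounded A \<longrightarrow> emeasure (N \<omega>) A \<in> \<nat>)) \<and>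
     (\<forall>A\<in>sets \<nu>. (\<lambda>\<omega>. emeasure (N \<omega>) A) \<in> borel_measurable M) \<and>
     (\<forall>A\<in>sets \<nu>. emeasure \<nu> A < \<infinity> \<longrightarrow>
        (\<forall>k. measure M {\<omega>\<in>space M. emeasure (N \<omega>) A = of_nat k}
               = exp (- measure \<nu> A) * measure \<nu> A ^ k / fact k)) \<and>
     (\<forall>A::nat \<Rightarrow> 's set. range A \<subseteq> sets \<nu> \<and> disjoint_family A \<longrightarrow>
        prob_space.indep_vars M (\<lambda>_. borel) (\<lambda>n \<omega>. emeasure (N \<omega>) (A n)) UNIV)"

definition events_generated_by ::
  "'a measure \<Rightarrow> 's measure \<Rightarrow> ('a \<Rightarrow> 's measure) \<Rightarrow> 'a set set" where
  "events_generated_by M \<nu> N = sigma_sets (space M)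
     {(\<lambda>\<omega>. emeasure (N \<omega>) A) -` B \<inter> space M | A B. A \<in> sets \<nu> \<and> B \<in> sets borel}"

definition halfline_intensity :: "real \<Rightarrow> real measure" where
  "halfline_intensity r = scale_measure (ennreal r) (restrict_space lborel {0..})"

definition quadrant_intensity :: "real \<Rightarrow> (real \<times> real) measure" where
  "quadrant_intensity r = scale_measure (ennreal r) (restrict_space lborel ({0..} \<times> {0..}))"

definition driving_noise ::
  "'a measure \<Rightarrow> real \<Rightarrow> real \<Rightarrow> ('a \<Rightarrow> real measure) \<Rightarrow> ('a \<Rightarrow> real measure) \<Rightarrow>
   ('a \<Rightarrow> (real \<times> real) measure) \<Rightarrow> ('a \<Rightarrow> (real \<times> real) measure) \<Rightarrow> bool" where
  "driving_noise M \<mu> lam N\<mu> Nlam N2\<mu> N2lam \<longleftrightarrow>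
     poisson_point_process M (halfline_intensity \<mu>) N\<mu> \<and>
     poisson_point_process M (halfline_intensity lam) Nlam \<and>
     poisson_point_process M (quadrant_intensity \<mu>) N2\<mu> \<and>
     poisson_point_process M (quadrant_intensity lam) N2lam \<and>
     prob_space.indep_sets M
       (\<lambda>i. [events_generated_by M (halfline_intensity \<mu>) N\<mu>,
             events_generated_by M (halfline_intensity lam) Nlam,
             events_generated_by M (quadrant_intensity \<mu>) N2\<mu>,
             events_generated_by M (quadrant_intensity lam) N2lam] ! i) {..<4::nat}"


section \<open>The McKean--Vlasov equations\<close>

text \<open>The integrals are pathwise integrals against the random point measures. The paths are
  bounded on [0,T], so almost surely all integrals are finite sums over points of the processes.\<close>

definition mckean_vlasov_solution ::
  "'a measure \<Rightarrow> ('a \<Rightarrow> real measure) \<Rightarrow> ('a \<Rightarrow> real measure) \<Rightarrow>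
   ('a \<Rightarrow> (real \<times> real) measure) \<Rightarrow> ('a \<Rightarrow> (real \<times> real) measure) \<Rightarrow>
   real \<Rightarrow> nat \<Rightarrow> nat \<Rightarrow> ('a \<Rightarrow> real \<Rightarrow> nat \<times> nat) \<Rightarrow> bool" where
  "mckean_vlasov_solution M N\<mu> Nlam N2\<mu> N2lam T x y R \<longleftrightarrow>
     R \<in> measurable M (skorohod_borel T) \<and>
     (AE \<omega> in M. \<forall>t\<in>{0..T}.
        real (fst (R \<omega> t)) =
            real x
          - (LINT s:{0..t}|N\<mu> \<omega>. real (fst (left_limit (R \<omega>) s)))
          - (LINT s:{0..t}|Nlam \<omega>. of_bool (fst (left_limit (R \<omega>) s) > 0))
          + (LINT p:{0..t} \<times> {0..}|N2\<mu> \<omega>.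
               of_bool (0 \<le> snd p \<and> snd p \<le> real (snd (left_limit (R \<omega>) (fst p))))) \<and>
        real (snd (R \<omega> t)) =
            real y
          - (LINT s:{0..t}|N\<mu> \<omega>. real (snd (left_limit (R \<omega>) s)))
          - (LINT p:{0..t} \<times> {0..}|N2\<mu> \<omega>.
               of_bool (0 \<le> snd p \<and> snd p \<le> real (snd (left_limit (R \<omega>) (fst p)))))
          + (LINT s:{0..t}|Nlam \<omega>. of_bool (fst (left_limit (R \<omega>) s) > 0))
          + (LINT p:{0..t} \<times> {0..}|N2lam \<omega>.
               of_bool (0 \<le> snd p \<and>
                 snd p \<le> measure M {\<omega>'\<in>space M. fst (R \<omega>' (fst p)) > 0})))"

definition solution_laws ::
  "'a measure \<Rightarrow> ('a \<Rightarrow> real measure) \<Rightarrow> ('a \<Rightarrow> real measure) \<Rightarrow>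
   ('a \<Rightarrow> (real \<times> real) measure) \<Rightarrow> ('a \<Rightarrow> (real \<times> real) measure) \<Rightarrow>
   real \<Rightarrow> nat \<Rightarrow> nat \<Rightarrow> (real \<Rightarrow> nat \<times> nat) measure set" where
  "solution_laws M N\<mu> Nlam N2\<mu> N2lam T x y =
     {distr M (skorohod_borel T) R | R. mckean_vlasov_solution M N\<mu> Nlam N2\<mu> N2lam T x y R}"

end

theory Submission
  imports Defs
begin

text \<open>
  Replace the unknown probabilities of a positive first component by a given Borel function p of time
  with values in [0,1], a profile. The equations are then driven by the noise path by path. Almost surely
  only finitely many points matter on [0,T], and no two of them are simultaneous: the second component is bounded
  by its initial value plus the number of points of the two processes with rate lam that can act, so that
  points of the third process above this level are irrelevant, and a partition of [0,T] into n cells has two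
  relevant points in a common cell with a probability of order 1 / n. On a grid with at most one
  relevant point per cell the solution is computed cell by cell; it exists and is unique
  (\<open>grid_path_solves\<close>, \<open>solution_eq_grid_path\<close>), and it is an explicit function,
  called flow below, of the numbers of points in the cells.

  A solution of the McKean-Vlasov equations is therefore the flow of a profile p that is reproduced by the
  map from p to the probabilities that the flow has a positive first component. Drive two profiles p and q by the
  same noise: the flows agree up to time t unless the fourth process has a point between the graphs of p
  and q before t, and the probability of this is at most lam times the integral of the distance of p and q
  over [0,t]. So the map contracts by the factor 1/2 in the supremum distance with weight exp (2 lam s)
  (\<open>occupation_contraction\<close>). It has exactly one fixed point, which gives existence and uniqueness of the
  solution on any space that carries the noise.

  For the laws, the flow depends on the noise only through the numbers of points in bounded regions, and
  the joint law of these numbers is determined by the Poisson property and independence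
  (\<open>noise_pattern_law_unique\<close>). Hence the fixed point and the finite-dimensional distributions of the solution
  are the same for all driving noises. The link to the Skorohod space is that its Borel sets are generated by the
  evaluations (\<open>sets_skorohod_borel_cylinders\<close>): this turns the flow into a random element of that space, makes
  the probabilities in the equations meaningful, and identifies laws by their finite-dimensional distributions.
\<close>

section \<open>Cadlag paths with discrete values\<close>

lemma dist_nat_pair_less_1: 
  fixes a b :: "nat \<times> nat"
  assumes "dist a b < 1"
  shows "a = b"
proof -
  obtain a1 a2 b1 b2 where ab: "a = (a1, a2)" "b = (b1, b2)" by (cases a, cases b) auto
  have h: "dist (real a1, real a2) (real b1, real b2) < 1" using assms by (simp add: ab)
  have "\<bar>real a1 - real b1\<bar> < 1" "\<bar>real a2 - real b2\<bar> < 1"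
    using dist_fst_le[of "(real a1, real a2)" "(real b1, real b2)"]
      dist_snd_le[of "(real a1, real a2)" "(real b1, real b2)"] h by (auto simp: dist_real_def)
  then have "a1 = b1" "a2 = b2" by linarith+
  then show ?thesis by (simp add: ab)
qed

lemma tendsto_nat_pair_eventually_eq:
  fixes f :: "'a \<Rightarrow> nat \<times> nat" and l :: "nat \<times> nat"
  assumes "(f \<longlongrightarrow> l) F"
  shows "eventually (\<lambda>s. f s = l) F"
proof -
  have "open ({fst l} \<times> {snd l})" using open_Times[OF Topological_Spaces.open_discrete Topological_Spaces.open_discrete] .
  then have "open {l}" by simp
  then show ?thesis using topological_tendstoD[OF assms, of "{l}"] by simp
qed

lemma cadlag_right_const:
  assumes "f \<in> cadlag_paths T" "0 \<le> t" "t < T"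
  obtains e where "e > 0" "t + e \<le> T" "\<And>s. t \<le> s \<Longrightarrow> s < t + e \<Longrightarrow> f s = f t"
proof -
  have "(f \<longlongrightarrow> f t) (at_right t)" using assms by (auto simp: cadlag_paths_def)
  from tendsto_nat_pair_eventually_eq[OF this] obtain b where b: "b > t" "\<And>y. y > t \<Longrightarrow> y < b \<Longrightarrow> f y = f t"
    by (auto simp: eventually_at_right_field)
  show ?thesis
    by (rule that[of "min b T - t"]) (use b assms in \<open>auto simp: less_eq_real_def\<close>)
qed

lemma cadlag_left_const:
  assumes "f \<in> cadlag_paths T" "0 < t" "t \<le> T"
  obtains e l where "e > 0" "e \<le> t" "\<And>s. t - e < s \<Longrightarrow> s < t \<Longrightarrow> f s = l"
proof -
  have "t \<in> {0<..T}" using assms by auto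
  then obtain l where "(f \<longlongrightarrow> l) (at_left t)" using assms(1) unfolding cadlag_paths_def by blast
  from tendsto_nat_pair_eventually_eq[OF this] obtain b where b: "b < t" "\<And>y. y > b \<Longrightarrow> y < t \<Longrightarrow> f y = l"
    by (auto simp: eventually_at_left_field)
  show ?thesis
    by (rule that[of "t - max b 0" l]) (use b assms in auto)
qed

lemma left_limit_eqI:
  assumes "0 \<le> a" "a < t" "\<And>s. a < s \<Longrightarrow> s < t \<Longrightarrow> f s = l"
  shows "left_limit f t = l"
proof -
  have "eventually (\<lambda>s. l = f s) (at_left t)"
    using assms by (auto simp: eventually_at_left_field intro!: exI[of _ a])
  then have "(f \<longlongrightarrow> l) (at_left t)"
    by (rule Lim_transform_eventually[rotated]) simp
  then show ?thesis using assms by (auto simp: left_limit_def intro!: tendsto_Lim)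
qed

lemma cadlag_left_limit:
  assumes "f \<in> cadlag_paths T" "0 < t" "t \<le> T"
  obtains e where "e > 0" "e \<le> t" "\<And>s. t - e < s \<Longrightarrow> s < t \<Longrightarrow> f s = left_limit f t"
proof -
  obtain e l where e: "e > 0" "e \<le> t" "\<And>s. t - e < s \<Longrightarrow> s < t \<Longrightarrow> f s = l"
    using cadlag_left_const[OF assms] by metis
  have "left_limit f t = l" using e by (intro left_limit_eqI[of "t - e"]) auto
  then show ?thesis using e that by metis
qed

lemma cadlag_pathsI:
  assumes "f \<in> extensional {0..T}"
    and "\<And>t. 0 \<le> t \<Longrightarrow> t < T \<Longrightarrow> \<exists>b>t. \<forall>s. t < s \<and> s < b \<longrightarrow> f s = f t"
    and "\<And>t. 0 < t \<Longrightarrow> t \<le> T \<Longrightarrow> \<exists>a<t. \<exists>l. \<forall>s. a < s \<and> s < t \<longrightarrow> f s = l"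
  shows "f \<in> cadlag_paths T"
  unfolding cadlag_paths_def
proof (intro CollectI conjI ballI assms(1))
  fix t assume t: "t \<in> {0..<T}"
  then obtain b where "b > t" "\<forall>s. t < s \<and> s < b \<longrightarrow> f s = f t" using assms(2) by auto
  then have "eventually (\<lambda>s. f t = f s) (at_right t)"
    by (auto simp: eventually_at_right_field intro!: exI[of _ b])
  then show "(f \<longlongrightarrow> f t) (at_right t)"
    by (rule Lim_transform_eventually[rotated]) simp
next
  fix t assume t: "t \<in> {0<..T}"
  then obtain a l where "a < t" "\<forall>s. a < s \<and> s < t \<longrightarrow> f s = l" using assms(3)[of t] by auto
  then have "eventually (\<lambda>s. l = f s) (at_left t)"
    by (auto simp: eventually_at_left_field intro!: exI[of _ a])
  then have "(f \<longlongrightarrow> l) (at_left t)"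
    by (rule Lim_transform_eventually[rotated]) simp
  then show "\<exists>l. (f \<longlongrightarrow> l) (at_left t)" by blast
qed

definition at_most_one_jump :: "(real \<Rightarrow> 'b) \<Rightarrow> real \<Rightarrow> real \<Rightarrow> bool" where
  "at_most_one_jump f a b \<longleftrightarrow> (\<forall>r\<in>{a..b}. \<forall>s\<in>{r..b}. f r = f a \<or> f s = f b)"

text \<open>Every time is the centre of an interval in which the path jumps at most at the centre. The interval
  [0,T] is compact, and any Lebesgue number of this cover serves as d.\<close>

lemma cadlag_uniform_one_jump:
  assumes f: "f \<in> cadlag_paths T"
  obtains d where "d > 0" "\<And>a b. 0 \<le> a \<Longrightarrow> a \<le> b \<Longrightarrow> b \<le> T \<Longrightarrow> b - a < d \<Longrightarrow> at_most_one_jump f a b"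
proof -
  define good where "good t e \<longleftrightarrow> e > 0 \<and> (\<exists>l. \<forall>s\<in>{0..T}. (t - e < s \<and> s < t \<longrightarrow> f s = l) \<and>
      (t \<le> s \<and> s < t + e \<longrightarrow> f s = f t))" for t e
  have ex: "\<exists>e. good t e" if t: "t \<in> {0..T}" for t
  proof -
    have "\<exists>e1>0. \<exists>l. \<forall>s\<in>{0..T}. t - e1 < s \<and> s < t \<longrightarrow> f s = l"
    proof (cases "t = 0")
      case True
      then show ?thesis by (intro exI[of _ 1]) auto
    next
      case False
      with t obtain e l where "e > 0" "\<And>s. t - e < s \<Longrightarrow> s < t \<Longrightarrow> f s = l"
        using cadlag_left_const[OF f, of t] by (metis atLeastAtMost_iff less_eq_real_def)
      then show ?thesis by blast
    qed
    then obtain e1 l where e1: "e1 > 0" "\<forall>s\<in>{0..T}. t - e1 < s \<and> s < t \<longrightarrow> f s = l" by blast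
    have "\<exists>e2>0. \<forall>s\<in>{0..T}. t \<le> s \<and> s < t + e2 \<longrightarrow> f s = f t"
    proof (cases "t = T")
      case True
      then show ?thesis by (intro exI[of _ 1]) auto
    next
      case False
      with t obtain e where "e > 0" "\<And>s. t \<le> s \<Longrightarrow> s < t + e \<Longrightarrow> f s = f t"
        using cadlag_right_const[OF f, of t] by auto
      then show ?thesis by blast
    qed
    then obtain e2 where e2: "e2 > 0" "\<forall>s\<in>{0..T}. t \<le> s \<and> s < t + e2 \<longrightarrow> f s = f t" by blast
    show ?thesis unfolding good_def
      by (intro exI[of _ "min e1 e2"] conjI exI[of _ l]) (use e1 e2 in auto)
  qed
  then obtain E where E: "\<And>t. t \<in> {0..T} \<Longrightarrow> good t (E t)" by metis
  have cov: "{0..T} \<subseteq> \<Union> ((\<lambda>t. ball t (E t)) ` {0..T})"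
  proof
    fix t assume t: "t \<in> {0..T}"
    have "0 < E t" using E[OF t] by (simp add: good_def)
    then have "t \<in> ball t (E t)" by simp
    with t show "t \<in> \<Union> ((\<lambda>t. ball t (E t)) ` {0..T})" by blast
  qed
  show ?thesis
  proof (cases "T \<ge> 0")
    case False
    then show ?thesis by (intro that[of 1]) auto
  next
    case T: True
    obtain d where d: "0 < d" "\<And>X. X \<subseteq> {0..T} \<Longrightarrow> diameter X < d \<Longrightarrow>
      \<exists>B \<in> (\<lambda>t. ball t (E t)) ` {0..T}. X \<subseteq> B"
    proof (rule Lebesgue_number_lemma[of "{0..T}" "(\<lambda>t. ball t (E t)) ` {0..T}"])
      show "(\<lambda>t. ball t (E t)) ` {0..T} \<noteq> {}" using T by auto
    qed (use cov that in auto)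
  show ?thesis
  proof (rule that[of d])
    show "0 < d" by (rule d)
    fix a b assume ab: "0 \<le> a" "a \<le> b" "b \<le> T" "b - a < d"
    have "diameter {a..b} = b - a" using ab by (simp add: diameter_closed_interval)
    then obtain t where t: "t \<in> {0..T}" "{a..b} \<subseteq> ball t (E t)"
      using d(2)[of "{a..b}"] ab T by auto
    from E[OF t(1)] have "\<exists>l. \<forall>s\<in>{0..T}. (t - E t < s \<and> s < t \<longrightarrow> f s = l) \<and>
      (t \<le> s \<and> s < t + E t \<longrightarrow> f s = f t)" unfolding good_def by blast
    then obtain l where l: "\<forall>s\<in>{0..T}. (t - E t < s \<and> s < t \<longrightarrow> f s = l) \<and>
      (t \<le> s \<and> s < t + E t \<longrightarrow> f s = f t)" ..
    have l': "f s = (if s < t then l else f t)" if "s \<in> {a..b}" for s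
    proof -
      have "\<bar>t - s\<bar> < E t" using that t(2) by (auto simp: dist_real_def)
      then show ?thesis using bspec[OF l, of s] that ab by auto
    qed
    show "at_most_one_jump f a b"
      unfolding at_most_one_jump_def
    proof (intro ballI)
      fix r s assume rs: "r \<in> {a..b}" "s \<in> {r..b}"
      show "f r = f a \<or> f s = f b"
        using l'[of r] l'[of s] l'[of a] l'[of b] rs by (cases "r < t") auto
    qed
  qed
  qed
qed

text \<open>The infimum of the times at which the path has left its initial value; right-continuity excludes that
  the path still has the initial value there.\<close>

lemma one_jump_time:
  assumes f: "f \<in> cadlag_paths T" and ab: "0 \<le> a" "a \<le> b" "b \<le> T" and one: "at_most_one_jump f a b"
    and ne: "f a \<noteq> f b"
  obtains \<sigma> where "a < \<sigma>" "\<sigma> \<le> b" "\<And>s. a \<le> s \<Longrightarrow> s < \<sigma> \<Longrightarrow> f s = f a" "\<And>s. \<sigma> \<le> s \<Longrightarrow> s \<le> b \<Longrightarrow> f s = f b"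
proof -
  define S where "S = {s\<in>{a..b}. f s \<noteq> f a}"
  have bS: "b \<in> S" using ne ab by (auto simp: S_def)
  define \<sigma> where "\<sigma> = Inf S"
  have bdd: "bdd_below S" by (auto simp: S_def intro!: bdd_belowI[of _ a])
  have le: "\<sigma> \<le> b" unfolding \<sigma>_def by (rule cInf_lower[OF bS bdd])
  have ge: "a \<le> \<sigma>" unfolding \<sigma>_def by (rule cInf_greatest) (use bS in \<open>auto simp: S_def\<close>)
  have before: "f s = f a" if "a \<le> s" "s < \<sigma>" for s
    using cInf_lower[OF _ bdd, of s] that le unfolding \<sigma>_def[symmetric] by (auto simp: S_def)
  have at: "f \<sigma> \<noteq> f a"
  proof
    assume eq: "f \<sigma> = f a"
    then have "\<sigma> < b" using le ne by (auto simp: less_le)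
    then obtain e where e: "e > 0" "\<And>s. \<sigma> \<le> s \<Longrightarrow> s < \<sigma> + e \<Longrightarrow> f s = f \<sigma>"
      using cadlag_right_const[OF f, of \<sigma>] ge ab by auto
    have "\<sigma> + e \<le> Inf S"
    proof (rule cInf_greatest)
      show "S \<noteq> {}" using bS by auto
      fix s assume s: "s \<in> S"
      show "\<sigma> + e \<le> s"
      proof (rule ccontr)
        assume "\<not> \<sigma> + e \<le> s"
        moreover have "\<sigma> \<le> s" unfolding \<sigma>_def by (rule cInf_lower[OF s bdd])
        ultimately show False using e(2)[of s] s eq by (auto simp: S_def)
      qed
    qed
    then show False using e(1) by (simp add: \<sigma>_def)
  qed
  show ?thesis
  proof (rule that[of \<sigma>])
    show "a < \<sigma>" using at ge by (auto simp: less_le)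
    show "\<sigma> \<le> b" by fact
    show "f s = f a" if "a \<le> s" "s < \<sigma>" for s using before that .
    show "f s = f b" if "\<sigma> \<le> s" "s \<le> b" for s
    proof -
      have "f \<sigma> = f a \<or> f s = f b"
        using one[unfolded at_most_one_jump_def, THEN bspec[of _ _ \<sigma>], THEN bspec[of _ _ s]] ge le that by simp
      with at show ?thesis by blast
    qed
  qed
qed

section \<open>Time changes\<close>

text \<open>Time changes with prescribed values at the end points, so that they can be pasted along a grid.\<close>

definition time_change_between :: "real \<Rightarrow> real \<Rightarrow> real \<Rightarrow> real \<Rightarrow> (real \<Rightarrow> real) \<Rightarrow> bool" where
  "time_change_between a b c d \<tau> \<longleftrightarrow>
     continuous_on {a..b} \<tau> \<and> strict_mono_on {a..b} \<tau> \<and> \<tau> a = c \<and> \<tau> b = d"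

lemma time_change_between_id: "time_change_between a b a b (\<lambda>t. t)"
  by (auto simp: time_change_between_def strict_mono_on_def)

lemma time_change_between_affine:
  assumes "a < b" "c < d"
  shows "time_change_between a b c d (\<lambda>t. c + (t - a) * ((d - c) / (b - a)))"
  unfolding time_change_between_def
proof (intro conjI)
  have "(d - c) / (b - a) > 0" using assms by auto
  then have "(r - a) * ((d - c) / (b - a)) < (s - a) * ((d - c) / (b - a))" if "r < s" for r s
    using that by (intro mult_strict_right_mono) auto
  then show "strict_mono_on {a..b} (\<lambda>t. c + (t - a) * ((d - c) / (b - a)))"
    by (simp add: strict_mono_on_def del: times_divide_eq_right)
qed (use assms in \<open>auto intro!: continuous_intros\<close>)

lemma time_change_between_bounds:
  assumes "time_change_between a b c d \<tau>" "t \<in> {a..b}"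
  shows "c \<le> \<tau> t" "\<tau> t \<le> d"
  using assms unfolding time_change_between_def
  by (auto dest!: strict_mono_on_imp_mono_on simp: mono_on_def)

lemma time_change_between_paste:
  assumes 1: "time_change_between a b c d \<tau>1" and 2: "time_change_between b e d f \<tau>2" and "a \<le> b" "b \<le> e"
  shows "time_change_between a e c f (\<lambda>t. if t \<le> b then \<tau>1 t else \<tau>2 t)"
  unfolding time_change_between_def
proof (intro conjI)
  have eq: "{a..e} = {a..b} \<union> {b..e}" using assms by auto
  show "continuous_on {a..e} (\<lambda>t. if t \<le> b then \<tau>1 t else \<tau>2 t)"
    unfolding eq by (rule continuous_on_cases) (use 1 2 in \<open>auto simp: time_change_between_def\<close>)
  show "strict_mono_on {a..e} (\<lambda>t. if t \<le> b then \<tau>1 t else \<tau>2 t)"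
  proof (rule strict_mono_onI)
    fix r s assume rs: "r \<in> {a..e}" "s \<in> {a..e}" "r < s"
    have m: "strict_mono_on {a..b} \<tau>1" "strict_mono_on {b..e} \<tau>2" "\<tau>1 b = d" "\<tau>2 b = d"
      using 1 2 by (auto simp: time_change_between_def)
    consider "s \<le> b" | "b < r" | "r \<le> b" "b < s" by linarith
    then show "(if r \<le> b then \<tau>1 r else \<tau>2 r) < (if s \<le> b then \<tau>1 s else \<tau>2 s)"
    proof cases
      case 1 then show ?thesis using m(1) rs by (auto simp: strict_mono_on_def)
    next
      case 2 then show ?thesis using m(2) rs by (auto simp: strict_mono_on_def)
    next
      case 3
      have "\<tau>1 r \<le> d" using time_change_between_bounds(2)[OF 1, of r] rs 3 by auto
      moreover have "d < \<tau>2 s" using m(2,4) rs 3 by (auto simp: strict_mono_on_def)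
      ultimately show ?thesis using 3 by auto
    qed
  qed
  have "\<tau>1 a = c" "\<tau>1 b = d" "\<tau>2 b = d" "\<tau>2 e = f"
    using 1 2 by (auto simp: time_change_between_def)
  then show "(if a \<le> b then \<tau>1 a else \<tau>2 a) = c" "(if e \<le> b then \<tau>1 e else \<tau>2 e) = f"
    using assms(3,4) by (auto intro: antisym)
qed

lemma time_change_between_time_changes:
  assumes "time_change_between 0 T 0 T \<tau>" "0 \<le> T"
  shows "\<tau> \<in> time_changes T"
proof -
  have "{0..T} \<subseteq> \<tau> ` {0..T}"
  proof
    fix u assume "u \<in> {0..T}"
    then have "\<exists>x. 0 \<le> x \<and> x \<le> T \<and> \<tau> x = u"
      using assms by (intro IVT') (auto simp: time_change_between_def)
    then show "u \<in> \<tau> ` {0..T}" by auto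
  qed
  moreover have "\<tau> ` {0..T} \<subseteq> {0..T}" using time_change_between_bounds[OF assms(1)] by auto
  ultimately show ?thesis using assms by (auto simp: time_changes_def time_change_between_def)
qed

lemma time_changes_right_end:
  assumes "\<tau> \<in> time_changes T" "0 \<le> T"
  shows "\<tau> T = T"
proof -
  have im: "\<tau> ` {0..T} = {0..T}" and sm: "strict_mono_on {0..T} \<tau>"
    using assms by (auto simp: time_changes_def)
  have "T \<in> \<tau> ` {0..T}" using im assms by auto
  then obtain u where u: "u \<in> {0..T}" "\<tau> u = T" by auto
  have "\<tau> T \<le> T" using im assms by auto
  moreover have "u = T \<or> \<tau> u < \<tau> T" using sm u by (auto simp: strict_mono_on_def less_le)
  ultimately show ?thesis using u by auto
qed

lemma skorohod_dist_le:
  fixes f g :: "real \<Rightarrow> nat \<times> nat"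
  assumes "0 \<le> T" "\<tau> \<in> time_changes T"
    "\<And>t. t \<in> {0..T} \<Longrightarrow> \<bar>\<tau> t - t\<bar> \<le> e" "\<And>t. t \<in> {0..T} \<Longrightarrow> dist (f t) (g (\<tau> t)) \<le> e"
  shows "skorohod_dist T f g \<le> e"
  unfolding skorohod_dist_def
proof (rule cInf_lower)
  show "e \<in> {e. \<exists>\<tau>\<in>time_changes T. \<forall>t\<in>{0..T}. \<bar>\<tau> t - t\<bar> \<le> e \<and> dist (f t) (g (\<tau> t)) \<le> e}"
    by (intro CollectI bexI[of _ \<tau>] ballI conjI assms)
  show "bdd_below {e. \<exists>\<tau>\<in>time_changes T. \<forall>t\<in>{0..T}. \<bar>\<tau> t - t\<bar> \<le> e \<and> dist (f t) (g (\<tau> t)) \<le> e}"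
  proof (rule bdd_belowI[of _ 0], elim CollectE bexE)
    fix e and \<tau> :: "real \<Rightarrow> real"
    assume "\<forall>t\<in>{0..T}. \<bar>\<tau> t - t\<bar> \<le> e \<and> dist (f t) (g (\<tau> t)) \<le> e"
    from bspec[OF this, of 0] have "\<bar>\<tau> 0 - 0\<bar> \<le> e" using assms(1) by simp
    then show "0 \<le> e" by linarith
  qed
qed

section \<open>Uniform grids\<close>

definition grid_point :: "real \<Rightarrow> nat \<Rightarrow> nat \<Rightarrow> real" where
  "grid_point T n k = T * (real k / real n)"

lemma grid_point_0 [simp]: "grid_point T n 0 = 0"
  by (simp add: grid_point_def)

lemma grid_point_n [simp]: "n > 0 \<Longrightarrow> grid_point T n n = T"
  by (simp add: grid_point_def)

lemma grid_point_mono: "0 \<le> T \<Longrightarrow> k \<le> j \<Longrightarrow> grid_point T n k \<le> grid_point T n j"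
  by (auto simp: grid_point_def intro!: mult_left_mono divide_right_mono)

lemma grid_point_bounds: "0 \<le> T \<Longrightarrow> k \<le> n \<Longrightarrow> 0 \<le> grid_point T n k \<and> grid_point T n k \<le> T"
  using mult_left_le[of "real k / real n" T] by (auto simp: grid_point_def divide_le_eq_1)

lemma grid_point_Suc: "grid_point T n (Suc k) = grid_point T n k + T / real n"
  by (simp add: grid_point_def add_divide_distrib distrib_left)

lemma grid_point_less_Suc: "0 < T \<Longrightarrow> 0 < n \<Longrightarrow> grid_point T n k < grid_point T n (Suc k)"
  by (simp add: grid_point_Suc)

lemma grid_cell_exists:
  assumes "0 < n" "0 < t" "t \<le> T"
  obtains k where "k < n" "grid_point T n k < t" "t \<le> grid_point T n (Suc k)"
proof -
  define k where "k = (LEAST k. t \<le> grid_point T n k)"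
  have n: "t \<le> grid_point T n n" using assms by simp
  have k: "t \<le> grid_point T n k" unfolding k_def by (rule LeastI[of _ n]) (rule n)
  have kn: "k \<le> n" unfolding k_def by (rule Least_le) (rule n)
  have "k \<noteq> 0" using k assms by (auto intro: ccontr)
  then obtain j where j: "k = Suc j" by (cases k) auto
  have "\<not> t \<le> grid_point T n j" using not_less_Least[of j "\<lambda>k. t \<le> grid_point T n k"] j by (simp add: k_def)
  then show ?thesis using that[of j] k kn j by auto
qed

lemma grid_fine:
  assumes "0 < d"
  obtains n where "0 < n" "T / real n < d"
proof -
  obtain n where n: "T / d < real n" using reals_Archimedean2 by blast
  then have "T / d < real (Suc n)" by simp
  then have "T < real (Suc n) * d" using assms by (simp add: pos_divide_less_eq)
  then have "T / real (Suc n) < d" by (simp add: pos_divide_less_eq mult.commute)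
  then show ?thesis using that[of "Suc n"] by blast
qed

lemma at_most_one_jumpD:
  "at_most_one_jump f a b \<Longrightarrow> a \<le> r \<Longrightarrow> r \<le> s \<Longrightarrow> s \<le> b \<Longrightarrow> f r = f a \<or> f s = f b"
  unfolding at_most_one_jump_def by (metis atLeastAtMost_iff order_trans)

lemma cadlag_finite_range:
  assumes f: "f \<in> cadlag_paths T" and T: "0 < T"
  shows "finite (f ` {0..T})"
proof -
  obtain d where d: "d > 0" "\<And>a b. 0 \<le> a \<Longrightarrow> a \<le> b \<Longrightarrow> b \<le> T \<Longrightarrow> b - a < d \<Longrightarrow> at_most_one_jump f a b"
    using cadlag_uniform_one_jump[OF f] by blast
  obtain n where n: "0 < n" "T / real n < d" using grid_fine[OF d(1)] by blast
  have "f ` {0..T} \<subseteq> (\<lambda>k. f (grid_point T n k)) ` {..n}"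
  proof
    fix v assume "v \<in> f ` {0..T}"
    then obtain t where t: "0 \<le> t" "t \<le> T" "v = f t" by auto
    show "v \<in> (\<lambda>k. f (grid_point T n k)) ` {..n}"
    proof (cases "t = 0")
      case True
      then show ?thesis using t by (intro image_eqI[of _ _ 0]) auto
    next
      case False
      then obtain k where k: "k < n" "grid_point T n k < t" "t \<le> grid_point T n (Suc k)"
        using grid_cell_exists[of n t T] n t by auto
      have "at_most_one_jump f (grid_point T n k) (grid_point T n (Suc k))"
        using grid_point_bounds[of T k n] grid_point_bounds[of T "Suc k" n] grid_point_less_Suc[of T n k] T n k
        by (intro d(2)) (auto simp: grid_point_Suc)
      then have "f t = f (grid_point T n k) \<or> f t = f (grid_point T n (Suc k))"
        using at_most_one_jumpD[of f _ _ t t] k by simp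
      then show ?thesis using k t by (metis Suc_leI atMost_iff image_eqI less_imp_le)
    qed
  qed
  then show ?thesis by (rule finite_subset) simp
qed

text \<open>Values are pairs of natural numbers, and distinct ones are at distance at least 1. Hence below distance
  1 a time change carries one path exactly to the other. Boundedness of cadlag paths makes the set in the
  definition of the distance nonempty, without which its infimum would say nothing.\<close>

lemma skorohod_dist_lessE:
  fixes f g :: "real \<Rightarrow> nat \<times> nat"
  assumes f: "f \<in> cadlag_paths T" and g: "g \<in> cadlag_paths T" and T: "0 < T"
    and less: "skorohod_dist T f g < e"
  obtains \<tau> where "\<tau> \<in> time_changes T" "\<And>t. t \<in> {0..T} \<Longrightarrow> \<bar>\<tau> t - t\<bar> < e"
    "\<And>t. t \<in> {0..T} \<Longrightarrow> e \<le> 1 \<Longrightarrow> f t = g (\<tau> t)"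
proof -
  let ?S = "{e. \<exists>\<tau>\<in>time_changes T. \<forall>t\<in>{0..T}. \<bar>\<tau> t - t\<bar> \<le> e \<and> dist (f t) (g (\<tau> t)) \<le> e}"
  let ?D = "(\<lambda>(u::nat\<times>nat, v::nat\<times>nat). dist u v) ` (f ` {0..T} \<times> g ` {0..T})"
  have "finite ?D" using cadlag_finite_range[OF f T] cadlag_finite_range[OF g T] by blast
  then obtain C where C: "\<And>c. c \<in> ?D \<Longrightarrow> c \<le> C" using Max_ge by blast
  have "dist (f t) (g t) \<le> C" if "t \<in> {0..T}" for t
    by (rule C, rule image_eqI[of _ _ "(f t, g t)"]) (use that in simp_all)
  moreover have "(\<lambda>t. t) \<in> time_changes T"
    using time_change_between_time_changes[OF time_change_between_id] T by simp
  ultimately have "max C 0 \<in> ?S"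
    by (intro CollectI bexI[of _ "\<lambda>t. t"]) (simp_all add: le_max_iff_disj)
  then have "?S \<noteq> {}" by blast
  then obtain e' where e': "e' \<in> ?S" "e' < e"
    using cInf_lessD[of ?S e] less unfolding skorohod_dist_def by blast
  then obtain \<tau> where \<tau>: "\<tau> \<in> time_changes T" "\<forall>t\<in>{0..T}. \<bar>\<tau> t - t\<bar> \<le> e' \<and> dist (f t) (g (\<tau> t)) \<le> e'"
    by blast
  show ?thesis
  proof (rule that[OF \<tau>(1)])
    fix t assume t: "t \<in> {0..T}"
    show "\<bar>\<tau> t - t\<bar> < e" using bspec[OF \<tau>(2) t] e'(2) by linarith
    assume "e \<le> 1"
    then have "dist (f t) (g (\<tau> t)) < 1" using bspec[OF \<tau>(2) t] e'(2) by linarith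
    then show "f t = g (\<tau> t)" by (rule dist_nat_pair_less_1)
  qed
qed

section \<open>The Borel sets of the Skorohod space are generated by the evaluations\<close>

definition path_cylinders :: "real \<Rightarrow> (real \<Rightarrow> nat \<times> nat) set set" where
  "path_cylinders T = {{f \<in> cadlag_paths T. f t = v} | t v. t \<in> {0..T}}"

lemma openin_skorohodI:
  assumes "U \<subseteq> cadlag_paths T" "\<And>f. f \<in> U \<Longrightarrow> \<exists>e>0. \<forall>g\<in>cadlag_paths T. skorohod_dist T f g < e \<longrightarrow> g \<in> U"
  shows "openin (skorohod_topology T) U"
  using assms unfolding openin_skorohod_topology by blast

lemma sets_skorohod_borel:
  "sets (skorohod_borel T) = sigma_sets (cadlag_paths T) {U. openin (skorohod_topology T) U}"
  unfolding skorohod_borel_def by (rule sets_measure_of) (auto simp: openin_skorohod_topology)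

lemma space_skorohod_borel: "space (skorohod_borel T) = cadlag_paths T"
  unfolding skorohod_borel_def by (rule space_measure_of) (auto simp: openin_skorohod_topology)

text \<open>At t = T the cylinder is open, because time changes fix T. For t < T, right-continuity makes the value
  at t equal to v if and only if the path is constantly v on some interval (t, t + 1/m); paths with
  another value at some time s of this interval form an open set, as a small time change keeps s inside
  the interval.\<close>

lemma cylinder_in_skorohod_borel:
  assumes T: "0 < T" and t: "t \<in> {0..T}"
  shows "{f \<in> cadlag_paths T. f t = v} \<in> sets (skorohod_borel T)"
proof (cases "t = T")
  case True
  have "openin (skorohod_topology T) {f \<in> cadlag_paths T. f t = v}"
  proof (rule openin_skorohodI)
    fix f assume f: "f \<in> {f \<in> cadlag_paths T. f t = v}"
    show "\<exists>e>0. \<forall>g\<in>cadlag_paths T. skorohod_dist T f g < e \<longrightarrow> g \<in> {f \<in> cadlag_paths T. f t = v}"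
    proof (intro exI[of _ 1] conjI ballI impI)
      fix g assume g: "g \<in> cadlag_paths T" "skorohod_dist T f g < 1"
      obtain \<tau> where \<tau>: "\<tau> \<in> time_changes T" "\<And>t. t \<in> {0..T} \<Longrightarrow> (1::real) \<le> 1 \<Longrightarrow> f t = g (\<tau> t)"
        using skorohod_dist_lessE[of f T g 1] g T f by (metis (mono_tags, lifting) mem_Collect_eq)
      have "f T = g T" using \<tau>(2)[of T] time_changes_right_end[OF \<tau>(1)] T by simp
      then show "g \<in> {f \<in> cadlag_paths T. f t = v}" using f g True by auto
    qed simp
  qed blast
  then show ?thesis unfolding sets_skorohod_borel by (intro sigma_sets.Basic) auto
next
  case False
  with t have t: "0 \<le> t" "t < T" by auto
  define u where "u m = min T (t + 1 / real (Suc m))" for m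
  define C where "C m = {f \<in> cadlag_paths T. \<exists>s. t < s \<and> s < u m \<and> f s \<noteq> v}" for m
  have op: "openin (skorohod_topology T) (C m)" for m
  proof (rule openin_skorohodI)
    fix f assume f: "f \<in> C m"
    then obtain s where s: "t < s" "s < u m" "f s \<noteq> v" and fc: "f \<in> cadlag_paths T" by (auto simp: C_def)
    have sT: "s \<in> {0..T}" using s t by (auto simp: u_def)
    let ?e = "min 1 (min (s - t) (u m - s))"
    show "\<exists>e>0. \<forall>g\<in>cadlag_paths T. skorohod_dist T f g < e \<longrightarrow> g \<in> C m"
    proof (intro exI[of _ ?e] conjI ballI impI)
      show "?e > 0" using s by auto
      fix g assume g: "g \<in> cadlag_paths T" "skorohod_dist T f g < ?e"
      obtain \<tau> where \<tau>: "\<And>t. t \<in> {0..T} \<Longrightarrow> \<bar>\<tau> t - t\<bar> < ?e" "\<And>t. t \<in> {0..T} \<Longrightarrow> ?e \<le> 1 \<Longrightarrow> f t = g (\<tau> t)"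
        using skorohod_dist_lessE[OF fc g(1) T g(2)] by metis
      have "t < \<tau> s" "\<tau> s < u m" using \<tau>(1)[OF sT] by linarith+
      moreover have "g (\<tau> s) \<noteq> v" using \<tau>(2)[OF sT] s(3) by simp
      ultimately show "g \<in> C m" using g(1) by (auto simp: C_def)
    qed
  qed (auto simp: C_def)
  have C: "C m \<in> sets (skorohod_borel T)" for m
    unfolding sets_skorohod_borel by (intro sigma_sets.Basic) (use op in auto)
  have "{f \<in> cadlag_paths T. f t = v} = (\<Union>m. space (skorohod_borel T) - C m)"
  proof (intro set_eqI iffI)
    fix f assume "f \<in> {f \<in> cadlag_paths T. f t = v}"
    then have f: "f \<in> cadlag_paths T" "f t = v" by auto
    obtain e where e: "e > 0" "\<And>s. t \<le> s \<Longrightarrow> s < t + e \<Longrightarrow> f s = f t"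
      using cadlag_right_const[OF f(1) t] by metis
    obtain m where m: "1 / real (Suc m) < e" using nat_approx_posE[OF e(1)] by auto
    have "f s = v" if "t < s" "s < u m" for s
      using e(2)[of s] f(2) m that by (simp add: u_def)
    then have "f \<notin> C m" by (auto simp: C_def)
    then show "f \<in> (\<Union>m. space (skorohod_borel T) - C m)" using f(1) by (auto simp: space_skorohod_borel)
  next
    fix f assume "f \<in> (\<Union>m. space (skorohod_borel T) - C m)"
    then obtain m where f: "f \<in> cadlag_paths T" "f \<notin> C m" by (auto simp: space_skorohod_borel)
    obtain e where e: "e > 0" "\<And>s. t \<le> s \<Longrightarrow> s < t + e \<Longrightarrow> f s = f t"
      using cadlag_right_const[OF f(1) t] by metis
    have "t < min (t + e) (u m)" using e(1) t by (auto simp: u_def)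
    then obtain s where s: "t < s" "s < min (t + e) (u m)" using dense by blast
    then have "f s = v" using f unfolding C_def by auto
    moreover have "f s = f t" using e(2)[of s] s by auto
    ultimately show "f \<in> {f \<in> cadlag_paths T. f t = v}" using f(1) by auto
  qed
  also have "\<dots> \<in> sets (skorohod_borel T)" using C by auto
  finally show ?thesis .
qed

text \<open>The hypothesis on left limits decides whether the jump of a path is inside (a,b) or exactly at b. Both
  paths agree on this, so that the jump times can be matched by a time change that fixes a and b.\<close>

lemma cell_time_change:
  assumes f: "f \<in> cadlag_paths T" and g: "g \<in> cadlag_paths T" and ab: "0 \<le> a" "a < b" "b \<le> T"
    and one: "at_most_one_jump f a b" "at_most_one_jump g a b"
    and eq: "f a = g a" "f b = g b" "left_limit f b = left_limit g b"
  obtains \<tau> where "time_change_between a b a b \<tau>" "\<And>t. t \<in> {a..b} \<Longrightarrow> f t = g (\<tau> t)"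
proof (cases "f a = f b")
  case True
  have "h t = h a" if "at_most_one_jump h a b" "h a = h b" "t \<in> {a..b}" for t and h :: "real \<Rightarrow> nat \<times> nat"
    using at_most_one_jumpD[OF that(1), of t t] that by auto
  from this[OF one(1) True] this[OF one(2)] True eq have "f t = g t" if "t \<in> {a..b}" for t
    using that by metis
  then show ?thesis using that[OF time_change_between_id] by blast
next
  case False
  have ab': "a \<le> b" using ab by simp
  have False': "g a \<noteq> g b" using False eq by simp
  define v w where "v = f a" and "w = f b"
  have vw: "f a = v" "g a = v" "f b = w" "g b = w" "v \<noteq> w" using eq False by (auto simp: v_def w_def)
  obtain \<sigma> where \<sigma>: "a < \<sigma>" "\<sigma> \<le> b" "\<And>s. a \<le> s \<Longrightarrow> s < \<sigma> \<Longrightarrow> f s = v" "\<And>s. \<sigma> \<le> s \<Longrightarrow> s \<le> b \<Longrightarrow> f s = w"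
    using one_jump_time[OF f ab(1) ab' ab(3) one(1) False] unfolding vw by blast
  obtain \<rho> where \<rho>: "a < \<rho>" "\<rho> \<le> b" "\<And>s. a \<le> s \<Longrightarrow> s < \<rho> \<Longrightarrow> g s = v" "\<And>s. \<rho> \<le> s \<Longrightarrow> s \<le> b \<Longrightarrow> g s = w"
    using one_jump_time[OF g ab(1) ab' ab(3) one(2) False'] unfolding vw by blast
  have lf: "left_limit f b = (if \<sigma> = b then v else w)"
  proof (cases "\<sigma> = b")
    case True
    then show ?thesis using \<sigma> ab by (simp, intro left_limit_eqI[of a]) simp_all
  next
    case False
    then show ?thesis using \<sigma> ab by (simp, intro left_limit_eqI[of \<sigma>]) simp_all
  qed
  have lg: "left_limit g b = (if \<rho> = b then v else w)"
  proof (cases "\<rho> = b")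
    case True
    then show ?thesis using \<rho> ab by (simp, intro left_limit_eqI[of a]) simp_all
  next
    case False
    then show ?thesis using \<rho> ab by (simp, intro left_limit_eqI[of \<rho>]) simp_all
  qed
  have same: "\<sigma> = b \<longleftrightarrow> \<rho> = b" using lf lg eq vw by (auto split: if_splits)
  show ?thesis
  proof (cases "\<sigma> = b")
    case True
    with same have "\<rho> = b" by simp
    have "f t = g t" if "t \<in> {a..b}" for t
      using that \<sigma>(3)[of t] \<rho>(3)[of t] True \<open>\<rho> = b\<close> vw by (cases "t = b") auto
    then show ?thesis using that[OF time_change_between_id] by blast
  next
    case False
    with same \<sigma> \<rho> have lt: "\<sigma> < b" "\<rho> < b" by auto
    let ?t1 = "\<lambda>t. a + (t - a) * ((\<rho> - a) / (\<sigma> - a))"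
    let ?t2 = "\<lambda>t. \<rho> + (t - \<sigma>) * ((b - \<rho>) / (b - \<sigma>))"
    have t1: "time_change_between a \<sigma> a \<rho> ?t1" by (rule time_change_between_affine) fact+
    have t2: "time_change_between \<sigma> b \<rho> b ?t2" by (rule time_change_between_affine) fact+
    let ?t = "\<lambda>t. if t \<le> \<sigma> then ?t1 t else ?t2 t"
    show ?thesis
    proof (rule that[of ?t])
      show "time_change_between a b a b ?t"
        by (rule time_change_between_paste[OF t1 t2]) (use \<sigma> lt in auto)
      fix t assume t: "t \<in> {a..b}"
      consider "t < \<sigma>" | "t = \<sigma>" | "t > \<sigma>" by linarith
      then show "f t = g (?t t)"
      proof cases
        case 1
        have "strict_mono_on {a..\<sigma>} ?t1" using t1 by (simp add: time_change_between_def)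
        then have "?t1 t < ?t1 \<sigma>" by (rule strict_mono_onD) (use t 1 \<sigma> in auto)
        moreover have "?t1 \<sigma> = \<rho>" using t1 by (simp add: time_change_between_def)
        moreover have "a \<le> ?t1 t" using time_change_between_bounds(1)[OF t1, of t] t 1 by simp
        ultimately show ?thesis using 1 t \<sigma>(3)[of t] \<rho>(3)[of "?t1 t"] vw by simp
      next
        case 2
        have "?t1 \<sigma> = \<rho>" using t1 by (simp add: time_change_between_def)
        then show ?thesis using 2 \<sigma>(4)[of \<sigma>] \<rho>(4)[of \<rho>] \<sigma>(2) \<rho>(2) vw by simp
      next
        case 3
        have "\<rho> \<le> ?t2 t" "?t2 t \<le> b"
          using time_change_between_bounds[OF t2, of t] t 3 by simp_all
        then show ?thesis using 3 t \<sigma>(4)[of t] \<rho>(4)[of "?t2 t"] vw by simp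
      qed
    qed
  qed
qed

definition grid_data :: "real \<Rightarrow> nat \<Rightarrow> (real \<Rightarrow> nat \<times> nat) \<Rightarrow> ((nat \<times> nat) \<times> (nat \<times> nat)) list" where
  "grid_data T n f = map (\<lambda>k. (f (grid_point T n k), left_limit f (grid_point T n k))) [0..<Suc n]"

text \<open>Countably many classes of diameter at most T / n in the Skorohod distance, which serve instead of balls
  around a countable dense set.\<close>

definition grid_class :: "real \<Rightarrow> nat \<Rightarrow> ((nat \<times> nat) \<times> (nat \<times> nat)) list \<Rightarrow> (real \<Rightarrow> nat \<times> nat) set" where
  "grid_class T n d = {f \<in> cadlag_paths T. grid_data T n f = d \<and>
     (\<forall>k<n. at_most_one_jump f (grid_point T n k) (grid_point T n (Suc k)))}"

lemma grid_class_dist: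
  assumes T: "0 < T" and n: "0 < n" and f: "f \<in> grid_class T n d" and g: "g \<in> grid_class T n d"
  shows "skorohod_dist T f g \<le> T / real n"
proof -
  have fg: "f \<in> cadlag_paths T" "g \<in> cadlag_paths T" using f g by (auto simp: grid_class_def)
  have "grid_data T n f = grid_data T n g" using f g by (simp add: grid_class_def)
  then have eq: "f (grid_point T n k) = g (grid_point T n k)"
    "left_limit f (grid_point T n k) = left_limit g (grid_point T n k)" if "k \<le> n" for k
    using that by (auto simp: grid_data_def simp del: upt_Suc)
  have "\<exists>\<tau>. time_change_between 0 (grid_point T n k) 0 (grid_point T n k) \<tau> \<and>
    (\<forall>t\<in>{0..grid_point T n k}. \<bar>\<tau> t - t\<bar> \<le> T / real n \<and> f t = g (\<tau> t))" if "k \<le> n" for k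
    using that
  proof (induction k)
    case 0
    then show ?case using eq[of 0] T by (intro exI[of _ "\<lambda>t. t"]) (auto simp: time_change_between_id)
  next
    case (Suc k)
    let ?a = "grid_point T n k" and ?b = "grid_point T n (Suc k)"
    obtain \<tau>1 where \<tau>1: "time_change_between 0 ?a 0 ?a \<tau>1"
      "\<And>t. t\<in>{0..?a} \<Longrightarrow> \<bar>\<tau>1 t - t\<bar> \<le> T / real n \<and> f t = g (\<tau>1 t)"
      using Suc by auto
    have ab: "0 \<le> ?a" "?a < ?b" "?b \<le> T"
      using grid_point_bounds[of T k n] grid_point_bounds[of T "Suc k" n] grid_point_less_Suc[of T n k] T n Suc
      by auto
    obtain \<tau>2 where \<tau>2: "time_change_between ?a ?b ?a ?b \<tau>2" "\<And>t. t \<in> {?a..?b} \<Longrightarrow> f t = g (\<tau>2 t)"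
      using cell_time_change[OF fg ab] eq[of k] eq[of "Suc k"] f g Suc.prems
      unfolding grid_class_def by auto
    let ?\<tau> = "\<lambda>t. if t \<le> ?a then \<tau>1 t else \<tau>2 t"
    show ?case
    proof (intro exI[of _ ?\<tau>] conjI ballI)
      show "time_change_between 0 ?b 0 ?b ?\<tau>"
        by (rule time_change_between_paste[OF \<tau>1(1) \<tau>2(1)]) (use ab in auto)
      fix t assume t: "t \<in> {0..?b}"
      show "f t = g (?\<tau> t)" using \<tau>1(2)[of t] \<tau>2(2)[of t] t by auto
      show "\<bar>?\<tau> t - t\<bar> \<le> T / real n"
      proof (cases "t \<le> ?a")
        case True
        then show ?thesis using \<tau>1(2)[of t] t by auto
      next
        case False
        then have "\<tau>2 t \<in> {?a..?b}" using time_change_between_bounds[OF \<tau>2(1), of t] t by auto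
        then show ?thesis using False t by (auto simp: grid_point_Suc)
      qed
    qed
  qed
  from this[of n] obtain \<tau> where \<tau>: "time_change_between 0 T 0 T \<tau>"
    "\<And>t. t\<in>{0..T} \<Longrightarrow> \<bar>\<tau> t - t\<bar> \<le> T / real n \<and> f t = g (\<tau> t)" using n by auto
  show ?thesis
    by (rule skorohod_dist_le[OF _ time_change_between_time_changes[OF \<tau>(1)]])
      (use T \<tau>(2) in \<open>auto simp: case_prod_unfold\<close>)
qed

lemma grid_class_exists:
  assumes T: "0 < T" and f: "f \<in> cadlag_paths T" and e: "0 < e"
  obtains n where "0 < n" "T / real n < e" "f \<in> grid_class T n (grid_data T n f)"
proof -
  obtain d where d: "d > 0" "\<And>a b. 0 \<le> a \<Longrightarrow> a \<le> b \<Longrightarrow> b \<le> T \<Longrightarrow> b - a < d \<Longrightarrow> at_most_one_jump f a b"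
    using cadlag_uniform_one_jump[OF f] by blast
  obtain n where n: "0 < n" "T / real n < min d e" using grid_fine[of "min d e"] d(1) e by auto
  show ?thesis
  proof (rule that[of n])
    show "f \<in> grid_class T n (grid_data T n f)"
      unfolding grid_class_def
    proof (intro CollectI conjI allI impI f refl)
      fix k assume k: "k < n"
      show "at_most_one_jump f (grid_point T n k) (grid_point T n (Suc k))"
        using grid_point_bounds[of T k n] grid_point_bounds[of T "Suc k" n] grid_point_less_Suc[of T n k] T n k
        by (intro d(2)) (auto simp: grid_point_Suc)
    qed
  qed (use n in auto)
qed

definition cylinder_algebra :: "real \<Rightarrow> (real \<Rightarrow> nat \<times> nat) measure" where
  "cylinder_algebra T = sigma (cadlag_paths T) (path_cylinders T)"

lemma path_cylinders_Pow: "path_cylinders T \<subseteq> Pow (cadlag_paths T)"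
  by (auto simp: path_cylinders_def)

lemma space_cylinder_algebra: "space (cylinder_algebra T) = cadlag_paths T"
  unfolding cylinder_algebra_def by (rule space_measure_of[OF path_cylinders_Pow])

lemma evaluation_measurable_cylinder_algebra:
  assumes "t \<in> {0..T}"
  shows "{f \<in> space (cylinder_algebra T). f t = v} \<in> sets (cylinder_algebra T)"
proof -
  have "{f \<in> cadlag_paths T. f t = v} \<in> path_cylinders T"
    unfolding path_cylinders_def using assms by blast
  then show ?thesis unfolding space_cylinder_algebra
    by (simp add: cylinder_algebra_def sets_measure_of[OF path_cylinders_Pow] sigma_sets.Basic)
qed

definition dense_times :: "real \<Rightarrow> real set" where
  "dense_times T = (\<lambda>q. T * real_of_rat q) ` {q. 0 \<le> q \<and> q \<le> 1}"

lemma countable_dense_times: "countable (dense_times T)"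
  unfolding dense_times_def by (intro countable_image countableI_type)

lemma dense_times_subset: "0 \<le> T \<Longrightarrow> dense_times T \<subseteq> {0..T}"
proof
  fix t assume T: "0 \<le> T" and "t \<in> dense_times T"
  then obtain q where q: "t = T * real_of_rat q" "0 \<le> q" "q \<le> 1" by (auto simp: dense_times_def)
  then have "0 \<le> real_of_rat q" "real_of_rat q \<le> 1" by simp_all
  then show "t \<in> {0..T}" using q(1) T mult_left_le[of "real_of_rat q" T] by simp
qed

lemma dense_times_dense:
  assumes "0 < T" "0 \<le> r" "r < s" "s \<le> T"
  obtains q where "q \<in> dense_times T" "r < q" "q < s"
proof -
  have "r / T < s / T" using assms by (simp add: divide_strict_right_mono)
  then obtain q where q: "r / T < real_of_rat q" "real_of_rat q < s / T" using of_rat_dense by blast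
  have "0 \<le> r / T" "s / T \<le> 1" using assms by auto
  then have "0 < real_of_rat q" "real_of_rat q < 1" using q by linarith+
  then have "T * real_of_rat q \<in> dense_times T" by (auto simp: dense_times_def)
  moreover have "r < T * real_of_rat q" "T * real_of_rat q < s"
    using q assms by (simp_all add: field_simps)
  ultimately show ?thesis using that by blast
qed

lemma grid_point_dense_times: "k \<le> n \<Longrightarrow> grid_point T n k \<in> dense_times T"
  unfolding dense_times_def grid_point_def
  by (rule image_eqI[of _ _ "of_nat k / of_nat n"]) (simp_all add: of_rat_divide divide_le_eq_1, linarith)

text \<open>By right-continuity every value of a path is taken again immediately afterwards at points of a countable
  dense set, so that conditions on a path that quantify over an interval reduce to countably many
  evaluations.\<close>

lemma right_approximation:
  assumes T: "0 < T" and f: "f \<in> cadlag_paths T" and "0 \<le> r" "r < u" "u \<le> T"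
  obtains q where "q \<in> dense_times T" "r < q" "q < u" "f q = f r"
proof -
  obtain e where e: "e > 0" "\<And>s. r \<le> s \<Longrightarrow> s < r + e \<Longrightarrow> f s = f r"
    using cadlag_right_const[OF f, of r] assms by (metis le_less_trans less_le_trans)
  have "r < min u (r + e)" "min u (r + e) \<le> T" using assms e(1) by auto
  then obtain q where "q \<in> dense_times T" "r < q" "q < min u (r + e)"
    using dense_times_dense[OF T assms(3), of "min u (r + e)"] by blast
  then show ?thesis using that e(2)[of q] by auto
qed

lemma at_most_one_jump_dense:
  assumes T: "0 < T" and f: "f \<in> cadlag_paths T" and ab: "0 \<le> a" "a \<le> b" "b \<le> T"
    and D: "b \<in> dense_times T"
  shows "at_most_one_jump f a b \<longleftrightarrow>
    (\<forall>r\<in>dense_times T \<inter> {a..b}. \<forall>s\<in>dense_times T \<inter> {r..b}. f r = f a \<or> f s = f b)"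
proof
  assume d: "\<forall>r\<in>dense_times T \<inter> {a..b}. \<forall>s\<in>dense_times T \<inter> {r..b}. f r = f a \<or> f s = f b"
  have d': "f q = f a \<or> f p = f b"
    if "q \<in> dense_times T" "p \<in> dense_times T" "a \<le> q" "q \<le> p" "p \<le> b" for q p
    using bspec[OF bspec[OF d, of q], of p] that by simp
  show "at_most_one_jump f a b" unfolding at_most_one_jump_def
  proof (intro ballI)
    fix r s assume r: "r \<in> {a..b}" and s: "s \<in> {r..b}"
    have ex: "\<exists>q\<in>dense_times T. u \<le> q \<and> q \<le> b \<and> (q = u \<or> q < v) \<and> f q = f u"
      if "a \<le> u" "u \<le> b" "u < v" for u v
    proof (cases "u = b")
      case True
      then show ?thesis using D by blast
    next
      case False
      with that ab have "0 \<le> u" "u < min b v" "min b v \<le> T" by auto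
      then obtain q where "q \<in> dense_times T" "u < q" "q < min b v" "f q = f u"
        using right_approximation[OF T f, of u "min b v"] by blast
      then show ?thesis by (intro bexI[of _ q]) simp_all
    qed
    show "f r = f a \<or> f s = f b"
    proof (cases "r = s")
      case True
      obtain q where "q \<in> dense_times T" "r \<le> q" "q \<le> b" "f q = f r"
        using ex[of r "r + 1"] r by auto
      then show ?thesis using d'[of q q] r True by simp
    next
      case False
      then have rs: "r < s" using s by auto
      obtain q where q: "q \<in> dense_times T" "r \<le> q" "q \<le> b" "f q = f r" "q = r \<or> q < s"
        using ex[of r s] r rs by auto
      obtain p where p: "p \<in> dense_times T" "s \<le> p" "p \<le> b" "f p = f s"
        using ex[of s "s + 1"] s r by auto
      have "q \<le> p" using q(5) p(2) rs by auto
      then have "f q = f a \<or> f p = f b"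
        using q(1-3) p(1-3) r by (intro d') simp_all
      then show ?thesis unfolding q(4) p(4) .
    qed
  qed
next
  assume one: "at_most_one_jump f a b"
  show "\<forall>r\<in>dense_times T \<inter> {a..b}. \<forall>s\<in>dense_times T \<inter> {r..b}. f r = f a \<or> f s = f b"
    by (intro ballI at_most_one_jumpD[OF one]) simp_all
qed

lemma left_limit_dense:
  assumes T: "0 < T" and f: "f \<in> cadlag_paths T" and b: "0 < b" "b \<le> T"
  shows "left_limit f b = v \<longleftrightarrow>
    (\<exists>m. \<forall>q\<in>dense_times T \<inter> {max 0 (b - 1 / real (Suc m))<..<b}. f q = v)"
proof -
  obtain e where e: "e > 0" "e \<le> b" "\<And>s. b - e < s \<Longrightarrow> s < b \<Longrightarrow> f s = left_limit f b"
    using cadlag_left_limit[OF f b] by blast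
  show ?thesis
  proof
    assume v: "left_limit f b = v"
    obtain m where m: "1 / real (Suc m) < e" using nat_approx_posE[OF e(1)] by auto
    show "\<exists>m. \<forall>q\<in>dense_times T \<inter> {max 0 (b - 1 / real (Suc m))<..<b}. f q = v"
      using e(3) v m by (intro exI[of _ m]) auto
  next
    assume "\<exists>m. \<forall>q\<in>dense_times T \<inter> {max 0 (b - 1 / real (Suc m))<..<b}. f q = v"
    then obtain m where m: "\<And>q. q \<in> dense_times T \<Longrightarrow> max 0 (b - 1 / real (Suc m)) < q \<Longrightarrow> q < b \<Longrightarrow> f q = v"
      by (metis IntI greaterThanLessThan_iff)
    have "max (b - e) (max 0 (b - 1 / real (Suc m))) < b" using e b by auto
    then obtain q where "q \<in> dense_times T" "max (b - e) (max 0 (b - 1 / real (Suc m))) < q" "q < b"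
      using dense_times_dense[OF T _ _ b(2), of "max (b - e) (max 0 (b - 1 / real (Suc m)))"] e by (metis max.cobounded1 max.coboundedI2)
    then show "left_limit f b = v" using m[of q] e(3)[of q] by auto
  qed
qed

lemma grid_class_measurable:
  assumes T: "0 < T" and n: "0 < n"
  shows "grid_class T n d \<in> sets (cylinder_algebra T)"
proof -
  let ?M = "cylinder_algebra T" and ?D = "dense_times T"
  have ev: "{f \<in> space ?M. f t = v} \<in> sets ?M" if "t \<in> {0..T}" for t v
    by (rule evaluation_measurable_cylinder_algebra[OF that])
  have ev_count: "(\<lambda>f. f t) \<in> measurable ?M (count_space UNIV)" if "t \<in> {0..T}" for t
  proof -
    have "(\<lambda>f. f t) -` {v} \<inter> space ?M = {f \<in> space ?M. f t = v}" for v by auto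
    then show ?thesis using ev[OF that] by (subst measurable_count_space_eq_countable) auto
  qed
  have gp: "grid_point T n k \<in> {0..T}" if "k \<le> n" for k
    using grid_point_bounds[of T k n] T that by auto
  have ll: "{f \<in> space ?M. left_limit f (grid_point T n k) = v} \<in> sets ?M" if k: "k \<le> n" for k v
  proof (cases "k = 0")
    case True
    then show ?thesis using ev[of 0 v] T by (simp add: left_limit_def)
  next
    case False
    then have "0 < grid_point T n k" using T n by (auto simp: grid_point_def)
    then have "{f \<in> space ?M. left_limit f (grid_point T n k) = v} =
      {f \<in> space ?M. \<exists>m. \<forall>q\<in>?D \<inter> {max 0 (grid_point T n k - 1 / real (Suc m))<..<grid_point T n k}. f q = v}"
      using gp[OF k] unfolding space_cylinder_algebra
      by (intro Collect_cong conj_cong refl left_limit_dense[OF T]) auto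
    also have "\<dots> \<in> sets ?M"
      by (intro sets.sets_Collect_countable_Ex sets.sets_Collect_countable_All' ev)
        (use dense_times_subset[of T] T in \<open>auto intro: countable_Int1 countable_dense_times\<close>)
    finally show ?thesis .
  qed
  have data: "{f \<in> space ?M. (f (grid_point T n k), left_limit f (grid_point T n k)) = w} \<in> sets ?M"
    if "k \<le> n" for k w
  proof -
    have "{f \<in> space ?M. (f (grid_point T n k), left_limit f (grid_point T n k)) = w} =
      {f \<in> space ?M. f (grid_point T n k) = fst w} \<inter> {f \<in> space ?M. left_limit f (grid_point T n k) = snd w}"
      by (auto simp: prod_eq_iff)
    then show ?thesis using ev[OF gp[OF that]] ll[OF that] by auto
  qed
  have oj: "{f \<in> space ?M. at_most_one_jump f (grid_point T n k) (grid_point T n (Suc k))} \<in> sets ?M" if k: "k < n" for k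
  proof -
    let ?a = "grid_point T n k" and ?b = "grid_point T n (Suc k)"
    have "{f \<in> space ?M. at_most_one_jump f ?a ?b} =
      {f \<in> space ?M. \<forall>r\<in>?D \<inter> {?a..?b}. \<forall>s\<in>?D \<inter> {r..?b}. f r = f ?a \<or> f s = f ?b}"
    proof (rule Collect_cong, rule conj_cong[OF refl])
      fix f assume "f \<in> space ?M"
      then show "at_most_one_jump f ?a ?b \<longleftrightarrow>
        (\<forall>r\<in>?D \<inter> {?a..?b}. \<forall>s\<in>?D \<inter> {r..?b}. f r = f ?a \<or> f s = f ?b)"
        using gp[of k] gp[of "Suc k"] k grid_point_less_Suc[OF T n, of k]
        by (intro at_most_one_jump_dense[OF T]) (auto simp: space_cylinder_algebra intro!: grid_point_dense_times)
    qed
    also have "\<dots> \<in> sets ?M"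
    proof (intro sets.sets_Collect_countable_All' sets.sets_Collect_disj)
      have eq: "{f \<in> space ?M. f r = f s} \<in> sets ?M" if "r \<in> {0..T}" "s \<in> {0..T}" for r s
      proof -
        have "{f \<in> space ?M. f r = f s} = (\<Union>v. {f \<in> space ?M. f r = v} \<inter> {f \<in> space ?M. f s = v})" by auto
        also have "\<dots> \<in> sets ?M" using ev[OF that(1)] ev[OF that(2)] by (intro sets.countable_UN) auto
        finally show ?thesis .
      qed
      show "{f \<in> space ?M. f r = f ?a} \<in> sets ?M" if "r \<in> ?D \<inter> {?a..?b}" for r
        using that dense_times_subset[of T] T gp[of k] k by (intro eq) auto
      show "{f \<in> space ?M. f s = f ?b} \<in> sets ?M" if "r \<in> ?D \<inter> {?a..?b}" "s \<in> ?D \<inter> {r..?b}" for r s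
        using that dense_times_subset[of T] T gp[of "Suc k"] k by (intro eq) auto
    qed (auto intro: countable_Int1 countable_dense_times)
    finally show ?thesis .
  qed
  have dd: "{f \<in> space ?M. grid_data T n f = d} \<in> sets ?M"
  proof (cases "length d = Suc n")
    case True
    have "{f \<in> space ?M. grid_data T n f = d} =
      {f \<in> space ?M. \<forall>k\<in>{..n}. (f (grid_point T n k), left_limit f (grid_point T n k)) = d ! k}"
      using True unfolding grid_data_def by (auto simp: list_eq_iff_nth_eq less_Suc_eq_le simp del: upt_Suc)
    also have "\<dots> \<in> sets ?M" by (intro sets.sets_Collect_countable_All' data) auto
    finally show ?thesis .
  next
    case False
    then have "{f \<in> space ?M. grid_data T n f = d} = {}" by (auto simp: grid_data_def simp del: upt_Suc)
    then show ?thesis by (simp only: sets.empty_sets)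
  qed
  have "grid_class T n d = {f \<in> space ?M. grid_data T n f = d} \<inter>
     {f \<in> space ?M. \<forall>k\<in>{..<n}. at_most_one_jump f (grid_point T n k) (grid_point T n (Suc k))}"
    unfolding grid_class_def space_cylinder_algebra by blast
  also have "\<dots> \<in> sets ?M"
    by (intro sets.Int dd sets.sets_Collect_countable_All' oj) auto
  finally show ?thesis .
qed

text \<open>Every open set is the union of the grid classes that it contains, and these are countably many.\<close>

theorem sets_skorohod_borel_cylinders:
  assumes T: "0 < T"
  shows "sets (skorohod_borel T) = sigma_sets (cadlag_paths T) (path_cylinders T)"
proof (rule antisym)
  have cyl: "sets (cylinder_algebra T) = sigma_sets (cadlag_paths T) (path_cylinders T)"
    unfolding cylinder_algebra_def by (rule sets_measure_of[OF path_cylinders_Pow])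
  have "U \<in> sets (cylinder_algebra T)" if U: "openin (skorohod_topology T) U" for U
  proof -
    have "U = (\<Union>n\<in>{0<..}. \<Union>d\<in>{d. grid_class T n d \<subseteq> U}. grid_class T n d)"
    proof (intro equalityI subsetI)
      fix f assume f: "f \<in> U"
      then have fc: "f \<in> cadlag_paths T" using U by (auto simp: openin_skorohod_topology)
      obtain e where e: "e > 0" "\<And>g. g \<in> cadlag_paths T \<Longrightarrow> skorohod_dist T f g < e \<Longrightarrow> g \<in> U"
        using U f unfolding openin_skorohod_topology by blast
      obtain n where n: "0 < n" "T / real n < e" "f \<in> grid_class T n (grid_data T n f)"
        using grid_class_exists[OF T fc e(1)] by blast
      have "grid_class T n (grid_data T n f) \<subseteq> U"
      proof
        fix g assume g: "g \<in> grid_class T n (grid_data T n f)"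
        show "g \<in> U" using grid_class_dist[OF T n(1) n(3) g] n(2) g by (intro e(2)) (auto simp: grid_class_def)
      qed
      then show "f \<in> (\<Union>n\<in>{0<..}. \<Union>d\<in>{d. grid_class T n d \<subseteq> U}. grid_class T n d)"
        using n by blast
    qed blast
    also have "\<dots> \<in> sets (cylinder_algebra T)"
      by (intro sets.countable_UN'' countableI_type) (auto intro!: grid_class_measurable T)
    finally show ?thesis .
  qed
  then have "{U. openin (skorohod_topology T) U} \<subseteq> sets (cylinder_algebra T)" by blast
  from sets.sigma_sets_subset[OF this]
  show "sets (skorohod_borel T) \<subseteq> sigma_sets (cadlag_paths T) (path_cylinders T)"
    unfolding sets_skorohod_borel cyl space_cylinder_algebra .
  have "path_cylinders T \<subseteq> sets (skorohod_borel T)"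
    using cylinder_in_skorohod_borel[OF T] by (auto simp: path_cylinders_def)
  then show "sigma_sets (cadlag_paths T) (path_cylinders T) \<subseteq> sets (skorohod_borel T)"
    unfolding space_skorohod_borel[symmetric] by (rule sets.sigma_sets_subset)
qed

lemma evaluation_measurable:
  assumes "0 < T" "t \<in> {0..T}"
  shows "(\<lambda>f. f t) \<in> measurable (skorohod_borel T) (count_space UNIV)"
proof -
  have "(\<lambda>f. f t) -` {v} \<inter> space (skorohod_borel T) = {f \<in> cadlag_paths T. f t = v}" for v
    by (auto simp: space_skorohod_borel)
  then show ?thesis
    using cylinder_in_skorohod_borel[OF assms] by (subst measurable_count_space_eq_countable) auto
qed

lemma measurable_skorohod_borelI:
  assumes T: "0 < T" and R: "\<And>\<omega>. \<omega> \<in> space M \<Longrightarrow> R \<omega> \<in> cadlag_paths T"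
    and ev: "\<And>t. t \<in> {0..T} \<Longrightarrow> (\<lambda>\<omega>. R \<omega> t) \<in> measurable M (count_space UNIV)"
  shows "R \<in> measurable M (skorohod_borel T)"
proof (rule measurable_sigma_sets[OF sets_skorohod_borel_cylinders[OF T] path_cylinders_Pow])
  show "R \<in> space M \<rightarrow> cadlag_paths T" using R by auto
  fix A assume "A \<in> path_cylinders T"
  then obtain t v where t: "t \<in> {0..T}" and A: "A = {f \<in> cadlag_paths T. f t = v}"
    by (auto simp: path_cylinders_def)
  have "R -` A \<inter> space M = (\<lambda>\<omega>. R \<omega> t) -` {v} \<inter> space M" using R by (auto simp: A)
  also have "\<dots> \<in> sets M" using ev[OF t] by (rule measurable_sets) simp
  finally show "R -` A \<inter> space M \<in> sets M" .
qed

text \<open>The finite-dimensional cylinders generate the Borel sets and are stable under intersections.\<close>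

lemma skorohod_law_eqI:
  assumes T: "0 < T" and P: "prob_space P" "sets P = sets (skorohod_borel T)"
    and Q: "prob_space Q" "sets Q = sets (skorohod_borel T)"
    and fdd: "\<And>J A. finite J \<Longrightarrow> J \<subseteq> {0..T} \<Longrightarrow>
      measure P {f \<in> cadlag_paths T. \<forall>t\<in>J. f t \<in> A t} = measure Q {f \<in> cadlag_paths T. \<forall>t\<in>J. f t \<in> A t}"
  shows "P = Q"
proof -
  interpret P: prob_space P by fact
  interpret Q: prob_space Q by fact
  define E where "E = {{f \<in> cadlag_paths T. \<forall>t\<in>J. f t \<in> A t} | J A. finite J \<and> J \<subseteq> {0..T}}"
  have meas: "{f \<in> cadlag_paths T. \<forall>t\<in>J. f t \<in> A t} \<in> sets (skorohod_borel T)"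
    if "finite J" "J \<subseteq> {0..T}" for J and A :: "real \<Rightarrow> (nat \<times> nat) set"
    using that unfolding space_skorohod_borel[symmetric]
  proof (intro sets.sets_Collect_finite_All)
    fix t assume "t \<in> J"
    then have "(\<lambda>f. f t) \<in> measurable (skorohod_borel T) (count_space UNIV)"
      using that by (intro evaluation_measurable[OF T]) auto
    from measurable_sets[OF this, of "A t"]
    show "{f \<in> space (skorohod_borel T). f t \<in> A t} \<in> sets (skorohod_borel T)"
      by (simp add: vimage_def Int_def conj_commute)
  qed auto
  have gen: "sigma_sets (cadlag_paths T) E = sets (skorohod_borel T)"
  proof (rule antisym)
    show "sigma_sets (cadlag_paths T) E \<subseteq> sets (skorohod_borel T)"
      unfolding space_skorohod_borel[symmetric]
      by (rule sets.sigma_sets_subset) (auto simp: E_def space_skorohod_borel intro!: meas)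
    show "sets (skorohod_borel T) \<subseteq> sigma_sets (cadlag_paths T) E"
      unfolding sets_skorohod_borel_cylinders[OF T]
    proof (rule sigma_sets_mono, rule subsetI)
      fix B assume "B \<in> path_cylinders T"
      then obtain t v where "t \<in> {0..T}" and B: "B = {f \<in> cadlag_paths T. f t = v}"
        by (auto simp: path_cylinders_def)
      then have "B \<in> E" unfolding E_def by (intro CollectI exI[of _ "{t}"] exI[of _ "\<lambda>_. {v}"]) auto
      then show "B \<in> sigma_sets (cadlag_paths T) E" by (rule sigma_sets.Basic)
    qed
  qed
  show ?thesis
  proof (rule measure_eqI_generator_eq[of E "cadlag_paths T" P Q "\<lambda>_. cadlag_paths T"])
    show "Int_stable E"
    proof (rule Int_stableI)
      fix X Y assume "X \<in> E" "Y \<in> E"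
      then obtain J A K B where X: "finite J" "J \<subseteq> {0..T}" "X = {f \<in> cadlag_paths T. \<forall>t\<in>J. f t \<in> A t}"
        and Y: "finite K" "K \<subseteq> {0..T}" "Y = {f \<in> cadlag_paths T. \<forall>t\<in>K. f t \<in> B t}"
        unfolding E_def by blast
      have "X \<inter> Y = {f \<in> cadlag_paths T. \<forall>t\<in>J \<union> K. f t \<in> (if t \<in> J then A t else UNIV) \<inter> (if t \<in> K then B t else UNIV)}"
        unfolding X Y by auto
      then show "X \<inter> Y \<in> E" unfolding E_def using X Y
        by (intro CollectI exI[of _ "J \<union> K"] exI[of _ "\<lambda>t. (if t \<in> J then A t else UNIV) \<inter> (if t \<in> K then B t else UNIV)"]) auto
    qed
    show "E \<subseteq> Pow (cadlag_paths T)" by (auto simp: E_def)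
    show "emeasure P X = emeasure Q X" if XE: "X \<in> E" for X
    proof -
      obtain J A where "finite J" "J \<subseteq> {0..T}" "X = {f \<in> cadlag_paths T. \<forall>t\<in>J. f t \<in> A t}"
        using XE[unfolded E_def] by (elim CollectE exE conjE) (rule that)
      then have "measure P X = measure Q X" by (simp only: fdd)
      then show ?thesis by (simp add: P.emeasure_eq_measure Q.emeasure_eq_measure)
    qed
    show "sets P = sigma_sets (cadlag_paths T) E" "sets Q = sigma_sets (cadlag_paths T) E"
      using gen P Q by auto
    show "range (\<lambda>_. cadlag_paths T) \<subseteq> E"
      unfolding E_def by (auto intro!: exI[of _ "{}"])
    show "(\<Union>i::nat. cadlag_paths T) = cadlag_paths T" by simp
    show "emeasure P (cadlag_paths T) \<noteq> \<infinity>" by simp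
  qed
qed

section \<open>Numbers of points of Poisson processes\<close>

text \<open>Meaningful when the measure of A is a natural number, as for realisations of point processes on bounded
  sets; rounding makes it total.\<close>

definition num_points :: "'s measure \<Rightarrow> 's set \<Rightarrow> nat" where
  "num_points m A = nat \<lfloor>measure m A\<rfloor>"

lemma emeasure_eq_num_points:
  assumes "emeasure m A \<in> \<nat>"
  shows "emeasure m A = of_nat (num_points m A)" "measure m A = real (num_points m A)"
proof -
  obtain k where k: "emeasure m A = of_nat k" using assms by (auto simp: Nats_def)
  then have "measure m A = real k" by (simp add: measure_def)
  then have "num_points m A = k" by (simp add: num_points_def)
  then show "emeasure m A = of_nat (num_points m A)" "measure m A = real (num_points m A)"
    using k \<open>measure m A = real k\<close> by auto
qed

lemma num_points_vimage:
  "{\<omega> \<in> X. num_points (N \<omega>) A \<in> B} = (\<lambda>\<omega>. emeasure (N \<omega>) A) -` ((\<lambda>e. nat \<lfloor>enn2real e\<rfloor>) -` B) \<inter> X"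
  by (auto simp: num_points_def measure_def)

lemma measurable_nat_floor_enn2real:
  "(\<lambda>e. nat \<lfloor>enn2real e\<rfloor>) \<in> measurable borel (count_space UNIV)"
proof -
  have "(\<lambda>e. \<lfloor>enn2real e\<rfloor>) \<in> measurable borel (count_space UNIV)"
    by (rule measurable_compose[OF _ measurable_real_floor]) measurable
  from measurable_compose[OF this, of nat "count_space UNIV"] show ?thesis by simp
qed

lemma vimage_nat_floor_borel: "(\<lambda>e. nat \<lfloor>enn2real e\<rfloor>) -` B \<in> sets borel"
  using measurable_sets[OF measurable_nat_floor_enn2real, of B] by simp

locale poisson_process =
  fixes M :: "'a measure" and \<nu> :: "'s::metric_space measure" and N :: "'a \<Rightarrow> 's measure"
  assumes poisson: "poisson_point_process M \<nu> N"

sublocale poisson_process \<subseteq> prob_space M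
  using poisson by (simp add: poisson_point_process_def)

context poisson_process
begin

lemma sets_N: "\<omega> \<in> space M \<Longrightarrow> sets (N \<omega>) = sets \<nu>"
  using poisson by (simp add: poisson_point_process_def)

lemma emeasure_N_Nats: "\<omega> \<in> space M \<Longrightarrow> A \<in> sets \<nu> \<Longrightarrow> bounded A \<Longrightarrow> emeasure (N \<omega>) A \<in> \<nat>"
  using poisson by (simp add: poisson_point_process_def)

lemma emeasure_N_measurable: "A \<in> sets \<nu> \<Longrightarrow> (\<lambda>\<omega>. emeasure (N \<omega>) A) \<in> borel_measurable M"
  using poisson by (simp add: poisson_point_process_def)

lemma count_measurable:
  assumes "A \<in> sets \<nu>"
  shows "(\<lambda>\<omega>. num_points (N \<omega>) A) \<in> measurable M (count_space UNIV)"
  using measurable_compose[OF emeasure_N_measurable[OF assms] measurable_nat_floor_enn2real]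
  by (simp add: num_points_def measure_def)

lemma count_sets:
  assumes "A \<in> sets \<nu>"
  shows "{\<omega> \<in> space M. num_points (N \<omega>) A \<in> B} \<in> sets M"
  using measurable_sets[OF count_measurable[OF assms], of B] by (simp add: vimage_def Int_def conj_commute)

lemma prob_count:
  assumes "A \<in> sets \<nu>" "bounded A" "emeasure \<nu> A < \<infinity>"
  shows "prob {\<omega> \<in> space M. num_points (N \<omega>) A = k} = exp (- measure \<nu> A) * measure \<nu> A ^ k / fact k"
proof -
  have "num_points (N \<omega>) A = k \<longleftrightarrow> emeasure (N \<omega>) A = of_nat k" if "\<omega> \<in> space M" for \<omega>
    using emeasure_eq_num_points(1)[OF emeasure_N_Nats[OF that assms(1,2)]] by simp
  then have "{\<omega> \<in> space M. num_points (N \<omega>) A = k} = {\<omega> \<in> space M. emeasure (N \<omega>) A = of_nat k}" by auto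
  moreover have "prob {\<omega> \<in> space M. emeasure (N \<omega>) A = of_nat k} = exp (- measure \<nu> A) * measure \<nu> A ^ k / fact k"
    using poisson assms unfolding poisson_point_process_def by blast
  ultimately show ?thesis by simp
qed

lemma prob_count_pos:
  assumes "A \<in> sets \<nu>" "bounded A" "emeasure \<nu> A < \<infinity>"
  shows "prob {\<omega> \<in> space M. 1 \<le> num_points (N \<omega>) A} \<le> measure \<nu> A"
proof -
  have "{\<omega> \<in> space M. 1 \<le> num_points (N \<omega>) A} = space M - {\<omega> \<in> space M. num_points (N \<omega>) A \<in> {0}}"
    by (auto simp: not_less_eq_eq)
  then have "prob {\<omega> \<in> space M. 1 \<le> num_points (N \<omega>) A} = 1 - prob {\<omega> \<in> space M. num_points (N \<omega>) A \<in> {0}}"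
    using prob_compl[OF count_sets[OF assms(1), of "{0}"]] by simp
  also have "\<dots> = 1 - exp (- measure \<nu> A)" using prob_count[OF assms, of 0] by simp
  also have "\<dots> \<le> measure \<nu> A" using exp_ge_add_one_self[of "- measure \<nu> A"] by linarith
  finally show ?thesis .
qed

lemma prob_count_ge_2:
  assumes "A \<in> sets \<nu>" "bounded A" "emeasure \<nu> A < \<infinity>"
  shows "prob {\<omega> \<in> space M. 2 \<le> num_points (N \<omega>) A} \<le> (measure \<nu> A)\<^sup>2"
proof -
  let ?r = "measure \<nu> A"
  let ?E = "\<lambda>k. {\<omega> \<in> space M. num_points (N \<omega>) A \<in> {k}}"
  have "{\<omega> \<in> space M. 2 \<le> num_points (N \<omega>) A} = space M - (?E 0 \<union> ?E 1)" by auto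
  then have "prob {\<omega> \<in> space M. 2 \<le> num_points (N \<omega>) A} = 1 - prob (?E 0 \<union> ?E 1)"
    using prob_compl[OF sets.Un[OF count_sets[OF assms(1), of "{0}"] count_sets[OF assms(1), of "{1}"]]]
    by (simp only:)
  also have "prob (?E 0 \<union> ?E 1) = prob (?E 0) + prob (?E 1)"
    by (rule finite_measure_Union[OF count_sets[OF assms(1)] count_sets[OF assms(1)]]) auto
  also have "1 - \<dots> = 1 - exp (- ?r) * (1 + ?r)"
    using prob_count[OF assms, of 0] prob_count[OF assms, of 1] by (simp add: distrib_left)
  also have "\<dots> \<le> 1 - (1 - ?r) * (1 + ?r)"
    using exp_ge_add_one_self[of "- ?r"] by (intro diff_left_mono mult_right_mono) auto
  also have "\<dots> = ?r\<^sup>2" by (simp add: power2_eq_square algebra_simps)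
  finally show ?thesis .
qed

lemma count_null:
  assumes "A \<in> sets \<nu>" "bounded A" "emeasure \<nu> A = 0"
  shows "AE \<omega> in M. num_points (N \<omega>) A = 0"
proof -
  have "prob {\<omega> \<in> space M. num_points (N \<omega>) A = 0} = 1"
    using prob_count[of A 0] assms by (simp add: measure_def)
  then have "prob {\<omega> \<in> space M. num_points (N \<omega>) A \<in> {0}} = 1" by simp
  then have "AE \<omega> in M. \<omega> \<in> {\<omega> \<in> space M. num_points (N \<omega>) A \<in> {0}}"
    by (rule AE_prob_1)
  then show ?thesis by (rule eventually_mono) auto
qed

lemma indep_counts:
  assumes "\<And>n. A n \<in> sets \<nu>" "disjoint_family A"
  shows "indep_vars (\<lambda>_. count_space UNIV) (\<lambda>n \<omega>. num_points (N \<omega>) (A n)) (UNIV :: nat set)"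
proof -
  have "indep_vars (\<lambda>_. borel) (\<lambda>n \<omega>. emeasure (N \<omega>) (A n)) UNIV"
    using poisson assms unfolding poisson_point_process_def by blast
  from indep_vars_compose2[OF this measurable_nat_floor_enn2real]
  show ?thesis by (simp add: num_points_def measure_def)
qed

lemma sigma_algebra_events: "sigma_algebra (space M) (events_generated_by M \<nu> N)"
  unfolding events_generated_by_def by (rule sigma_algebra_sigma_sets) auto

lemma counts_in_events_generated_by:
  assumes "finite \<A>" "\<A> \<subseteq> sets \<nu>"
  shows "{\<omega> \<in> space M. \<forall>A\<in>\<A>. num_points (N \<omega>) A \<in> B A} \<in> events_generated_by M \<nu> N"
proof -
  interpret E: sigma_algebra "space M" "events_generated_by M \<nu> N" by (rule sigma_algebra_events)
  show ?thesis
  proof (rule E.sets_Collect_finite_All[OF _ assms(1)])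
    fix A assume "A \<in> \<A>"
    then have "A \<in> sets \<nu>" using assms by auto
    then show "{\<omega> \<in> space M. num_points (N \<omega>) A \<in> B A} \<in> events_generated_by M \<nu> N"
      unfolding num_points_vimage events_generated_by_def
      using vimage_nat_floor_borel[of "B A"] by (intro sigma_sets.Basic) blast
  qed
qed

lemma counts_indep_law:
  fixes E :: "nat \<Rightarrow> 's set"
  assumes E: "\<And>k. E k \<in> sets \<nu>" "disjoint_family E"
    and I: "finite I" "I \<noteq> {}"
  shows "distr M (\<Pi>\<^sub>M k\<in>I. count_space UNIV) (\<lambda>\<omega>. \<lambda>k\<in>I. num_points (N \<omega>) (E k)) =
    (\<Pi>\<^sub>M k\<in>I. distr M (count_space UNIV) (\<lambda>\<omega>. num_points (N \<omega>) (E k)))"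
proof -
  have "indep_vars (\<lambda>_. count_space UNIV) (\<lambda>n \<omega>. num_points (N \<omega>) (E n)) I"
    by (rule indep_vars_subset[OF indep_counts[OF E]]) simp
  then show ?thesis
    by (subst indep_vars_iff_distr_eq_PiM[symmetric]) (use I E in \<open>auto intro: count_measurable\<close>)
qed

end

text \<open>Independence of a Poisson process concerns disjoint sets only. For a finite family of arbitrary sets it
  is applied to the atoms of the algebra that the family generates, indexed by the subsets of the family.\<close>

lemma finite_family_atoms:
  fixes \<A> :: "'s::metric_space set set"
  assumes "finite \<A>" and \<A>: "\<And>A. A \<in> \<A> \<Longrightarrow> A \<in> sets \<nu> \<and> bounded A"
  obtains E :: "nat \<Rightarrow> 's set" and n :: nat and K :: "'s set \<Rightarrow> nat set"
  where "0 < n" "\<And>k. E k \<in> sets \<nu>" "\<And>k. bounded (E k)" "disjoint_family E"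
    "\<And>A. A \<in> \<A> \<Longrightarrow> K A \<subseteq> {..<n}" "\<And>A. A \<in> \<A> \<Longrightarrow> A = (\<Union>k\<in>K A. E k)"
proof -
  define n where "n = card (Pow \<A>)"
  have "finite (Pow \<A>)" using assms by simp
  then obtain e where e: "bij_betw e {..<n} (Pow \<A>)"
    using ex_bij_betw_nat_finite unfolding n_def atLeast0LessThan by blast
  define E where "E k = (if k < n then {x \<in> \<Union>\<A>. \<forall>A\<in>\<A>. x \<in> A \<longleftrightarrow> A \<in> e k} else {})" for k
  define K where "K A = {k. k < n \<and> A \<in> e k}" for A
  have U: "\<Union>\<A> \<in> sets \<nu>" using assms by (intro sets.finite_Union) auto
  have Usub: "\<Union>\<A> \<subseteq> space \<nu>" using U by (rule sets.sets_into_space)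
  show ?thesis
  proof (rule that[of n E K])
    show "0 < n" using assms by (simp add: n_def card_Pow)
    show "E k \<in> sets \<nu>" for k
    proof -
      have "{x \<in> space \<nu>. \<forall>A\<in>\<A>. x \<in> A \<longleftrightarrow> A \<in> e k} \<in> sets \<nu>"
      proof (rule sets.sets_Collect_finite_All[OF _ assms(1)])
        fix A assume A: "A \<in> \<A>"
        have "{x \<in> space \<nu>. x \<in> A \<longleftrightarrow> A \<in> e k} = (if A \<in> e k then A else space \<nu> - A)"
          using \<A>[OF A] sets.sets_into_space by auto
        then show "{x \<in> space \<nu>. x \<in> A \<longleftrightarrow> A \<in> e k} \<in> sets \<nu>" using \<A>[OF A] by auto
      qed
      then have "\<Union>\<A> \<inter> {x \<in> space \<nu>. \<forall>A\<in>\<A>. x \<in> A \<longleftrightarrow> A \<in> e k} \<in> sets \<nu>" using U by blast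
      also have "\<Union>\<A> \<inter> {x \<in> space \<nu>. \<forall>A\<in>\<A>. x \<in> A \<longleftrightarrow> A \<in> e k} = {x \<in> \<Union>\<A>. \<forall>A\<in>\<A>. x \<in> A \<longleftrightarrow> A \<in> e k}"
        using Usub by blast
      finally show ?thesis by (simp add: E_def)
    qed
    have "bounded (\<Union>\<A>)" using assms by (intro bounded_Union) auto
    then show "bounded (E k)" for k by (rule bounded_subset) (auto simp: E_def)
    show "disjoint_family E"
      unfolding disjoint_family_on_def
    proof (intro ballI impI)
      fix i j :: nat assume "i \<noteq> j"
      show "E i \<inter> E j = {}"
      proof (rule ccontr)
        assume "E i \<inter> E j \<noteq> {}"
        then obtain x where x: "x \<in> E i" "x \<in> E j" by blast
        then have ij: "i < n" "j < n" by (auto simp: E_def split: if_splits)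
        then have "\<forall>A\<in>\<A>. A \<in> e i \<longleftrightarrow> A \<in> e j" using x by (auto simp: E_def)
        moreover have "e i \<subseteq> \<A>" "e j \<subseteq> \<A>" using e ij by (auto simp: bij_betw_def)
        ultimately have "e i = e j" by blast
        then show False using e ij \<open>i \<noteq> j\<close> by (auto simp: bij_betw_def inj_on_def)
      qed
    qed
    show "K A \<subseteq> {..<n}" for A by (auto simp: K_def)
    show "A = (\<Union>k\<in>K A. E k)" if A: "A \<in> \<A>" for A
    proof (intro equalityI subsetI)
      fix x assume x: "x \<in> A"
      have "{B \<in> \<A>. x \<in> B} \<in> e ` {..<n}" using e by (auto simp: bij_betw_def)
      then obtain k where k: "k < n" "e k = {B \<in> \<A>. x \<in> B}" by auto
      then have "k \<in> K A" "x \<in> E k" using x A by (auto simp: K_def E_def)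
      then show "x \<in> (\<Union>k\<in>K A. E k)" by blast
    next
      fix x assume "x \<in> (\<Union>k\<in>K A. E k)"
      then show "x \<in> A" using A by (auto simp: K_def E_def)
    qed
  qed
qed

lemma count_additive:
  assumes "finite I" "disjoint_family_on E I" "\<And>k. k \<in> I \<Longrightarrow> E k \<in> sets m"
    "\<And>k. k \<in> I \<Longrightarrow> emeasure m (E k) \<in> \<nat>"
  shows "num_points m (\<Union>k\<in>I. E k) = (\<Sum>k\<in>I. num_points m (E k))"
proof -
  have "emeasure m (\<Union>k\<in>I. E k) = (\<Sum>k\<in>I. emeasure m (E k))"
    by (rule sum_emeasure[symmetric]) (use assms in auto)
  also have "\<dots> = (\<Sum>k\<in>I. of_nat (num_points m (E k)))"
    using emeasure_eq_num_points(1) assms by (intro sum.cong) auto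
  finally have *: "emeasure m (\<Union>k\<in>I. E k) = of_nat (\<Sum>k\<in>I. num_points m (E k))" by simp
  then have N: "emeasure m (\<Union>k\<in>I. E k) \<in> \<nat>" by (simp only: of_nat_in_Nats)
  show "num_points m (\<Union>k\<in>I. E k) = (\<Sum>k\<in>I. num_points m (E k))"
    using emeasure_eq_num_points(1)[OF N] unfolding * by (simp only: of_nat_eq_iff)
qed

text \<open>The counts of the atoms are independent Poisson variables, and the counts of the given sets are sums of
  them.\<close>

lemma count_law_unique:
  fixes \<nu> :: "'s::metric_space measure"
  assumes P: "poisson_point_process M \<nu> N" and P': "poisson_point_process M' \<nu> N'"
    and fin: "finite \<A>" and \<A>: "\<And>A. A \<in> \<A> \<Longrightarrow> A \<in> sets \<nu> \<and> bounded A"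
    and \<nu>: "\<And>A. A \<in> sets \<nu> \<Longrightarrow> bounded A \<Longrightarrow> emeasure \<nu> A < \<infinity>"
  shows "measure M {\<omega> \<in> space M. \<forall>A\<in>\<A>. num_points (N \<omega>) A \<in> B A} =
    measure M' {\<omega> \<in> space M'. \<forall>A\<in>\<A>. num_points (N' \<omega>) A \<in> B A}"
proof -
  interpret P: poisson_process M \<nu> N using P by unfold_locales
  interpret P': poisson_process M' \<nu> N' using P' by unfold_locales
  obtain E n K where n: "0 < (n::nat)" and E: "\<And>k. E k \<in> sets \<nu>" "\<And>k. bounded (E k)" "disjoint_family E"
    and K: "\<And>A. A \<in> \<A> \<Longrightarrow> K A \<subseteq> {..<n}" "\<And>A. A \<in> \<A> \<Longrightarrow> A = (\<Union>k\<in>K A. E k)"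
    using finite_family_atoms[OF fin \<A>] by metis
  let ?S = "{v \<in> PiE {..<n} (\<lambda>_. UNIV). \<forall>A\<in>\<A>. (\<Sum>k\<in>K A. v k) \<in> B A}"
  let ?\<Pi> = "\<Pi>\<^sub>M k\<in>{..<n}. count_space (UNIV::nat set)"
  have \<Pi>: "?\<Pi> = count_space (PiE {..<n} (\<lambda>_. UNIV))"
    by (rule count_space_PiM_finite) auto
  have S: "?S \<in> sets ?\<Pi>" unfolding \<Pi> by auto
  have law: "measure M {\<omega> \<in> space M. \<forall>A\<in>\<A>. num_points (N \<omega>) A \<in> B A} =
      measure (\<Pi>\<^sub>M k\<in>{..<n}. distr M (count_space UNIV) (\<lambda>\<omega>. num_points (N \<omega>) (E k))) ?S"
    if Q: "poisson_process M \<nu> N" for M :: "'x measure" and N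
  proof -
    interpret Q: poisson_process M \<nu> N by (rule Q)
    have c: "num_points (N \<omega>) A = (\<Sum>k\<in>K A. num_points (N \<omega>) (E k))" if "\<omega> \<in> space M" "A \<in> \<A>" for \<omega> A
    proof -
      have "num_points (N \<omega>) (\<Union>k\<in>K A. E k) = (\<Sum>k\<in>K A. num_points (N \<omega>) (E k))"
        using that K(1)[OF that(2)] E Q.sets_N Q.emeasure_N_Nats
        by (intro count_additive) (auto intro: finite_subset disjoint_family_on_mono[of _ UNIV])
      then show ?thesis using K(2)[OF that(2)] by simp
    qed
    have m: "(\<lambda>\<omega>. \<lambda>k\<in>{..<n}. num_points (N \<omega>) (E k)) \<in> measurable M ?\<Pi>"
      by (intro measurable_restrict Q.count_measurable E)
    have "{\<omega> \<in> space M. \<forall>A\<in>\<A>. num_points (N \<omega>) A \<in> B A} =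
        (\<lambda>\<omega>. \<lambda>k\<in>{..<n}. num_points (N \<omega>) (E k)) -` ?S \<inter> space M"
    proof (intro set_eqI iffI)
      fix \<omega> assume "\<omega> \<in> {\<omega> \<in> space M. \<forall>A\<in>\<A>. num_points (N \<omega>) A \<in> B A}"
      then have \<omega>: "\<omega> \<in> space M" "\<And>A. A \<in> \<A> \<Longrightarrow> (\<Sum>k\<in>K A. num_points (N \<omega>) (E k)) \<in> B A"
        using c by auto
      have "(\<Sum>k\<in>K A. (\<lambda>k\<in>{..<n}. num_points (N \<omega>) (E k)) k) = (\<Sum>k\<in>K A. num_points (N \<omega>) (E k))" if "A \<in> \<A>" for A
        using K(1)[OF that] by (intro sum.cong) auto
      then show "\<omega> \<in> (\<lambda>\<omega>. \<lambda>k\<in>{..<n}. num_points (N \<omega>) (E k)) -` ?S \<inter> space M" using \<omega> by auto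
    next
      fix \<omega> assume a: "\<omega> \<in> (\<lambda>\<omega>. \<lambda>k\<in>{..<n}. num_points (N \<omega>) (E k)) -` ?S \<inter> space M"
      have "(\<Sum>k\<in>K A. (\<lambda>k\<in>{..<n}. num_points (N \<omega>) (E k)) k) = (\<Sum>k\<in>K A. num_points (N \<omega>) (E k))" if "A \<in> \<A>" for A
        using K(1)[OF that] by (intro sum.cong) auto
      then show "\<omega> \<in> {\<omega> \<in> space M. \<forall>A\<in>\<A>. num_points (N \<omega>) A \<in> B A}" using a c by auto
    qed
    then have "measure M {\<omega> \<in> space M. \<forall>A\<in>\<A>. num_points (N \<omega>) A \<in> B A} =
      measure (distr M ?\<Pi> (\<lambda>\<omega>. \<lambda>k\<in>{..<n}. num_points (N \<omega>) (E k))) ?S"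
      using measure_distr[OF m S] by simp
    also have "distr M ?\<Pi> (\<lambda>\<omega>. \<lambda>k\<in>{..<n}. num_points (N \<omega>) (E k)) =
      (\<Pi>\<^sub>M k\<in>{..<n}. distr M (count_space UNIV) (\<lambda>\<omega>. num_points (N \<omega>) (E k)))"
      by (rule Q.counts_indep_law) (use E n in auto)
    finally show ?thesis .
  qed
  have marg: "distr M (count_space UNIV) (\<lambda>\<omega>. num_points (N \<omega>) (E k)) =
    distr M' (count_space UNIV) (\<lambda>\<omega>. num_points (N' \<omega>) (E k))" for k
  proof (rule measure_eqI_countable[of _ UNIV])
    fix j :: nat
    have "emeasure (distr M (count_space UNIV) (\<lambda>\<omega>. num_points (N \<omega>) (E k))) {j} =
      P.prob {\<omega> \<in> space M. num_points (N \<omega>) (E k) = j}"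
      using P.count_measurable[OF E(1)]
      by (subst emeasure_distr) (auto simp: P.emeasure_eq_measure vimage_def Int_def conj_commute)
    moreover have "emeasure (distr M' (count_space UNIV) (\<lambda>\<omega>. num_points (N' \<omega>) (E k))) {j} =
      P'.prob {\<omega> \<in> space M'. num_points (N' \<omega>) (E k) = j}"
      using P'.count_measurable[OF E(1)]
      by (subst emeasure_distr) (auto simp: P'.emeasure_eq_measure vimage_def Int_def conj_commute)
    ultimately show "emeasure (distr M (count_space UNIV) (\<lambda>\<omega>. num_points (N \<omega>) (E k))) {j} =
      emeasure (distr M' (count_space UNIV) (\<lambda>\<omega>. num_points (N' \<omega>) (E k))) {j}"
      using E \<nu> by (simp add: P.prob_count P'.prob_count)
  qed auto
  show ?thesis
    unfolding law[OF P.poisson_process_axioms] law[OF P'.poisson_process_axioms] marg ..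
qed

section \<open>The driving noise\<close>

lemma sets_halfline_intensity: "A \<in> sets (halfline_intensity r) \<longleftrightarrow> A \<in> sets borel \<and> A \<subseteq> {0..}"
  unfolding halfline_intensity_def by (auto simp: sets_restrict_space_iff)

lemma sets_quadrant_intensity:
  "A \<in> sets (quadrant_intensity r) \<longleftrightarrow> A \<in> sets borel \<and> A \<subseteq> {0..} \<times> {0..}"
proof -
  have "{0..} \<times> {0..} \<in> sets (borel :: (real \<times> real) measure)"
    by (intro borel_closed closed_Times closed_atLeast)
  then show ?thesis unfolding quadrant_intensity_def by (auto simp: sets_restrict_space_iff)
qed

lemma emeasure_halfline_intensity:
  assumes "A \<in> sets borel" "A \<subseteq> {0..}"
  shows "emeasure (halfline_intensity r) A = ennreal r * emeasure lborel A"
  using assms unfolding halfline_intensity_def by (simp add: emeasure_restrict_space)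

lemma emeasure_quadrant_intensity:
  assumes "A \<in> sets borel" "A \<subseteq> {0..} \<times> {0..}"
  shows "emeasure (quadrant_intensity r) A = ennreal r * emeasure lborel A"
proof -
  have "{0..} \<times> {0..} \<in> sets (borel :: (real \<times> real) measure)"
    by (intro borel_closed closed_Times closed_atLeast)
  then show ?thesis using assms unfolding quadrant_intensity_def by (simp add: emeasure_restrict_space)
qed

lemma halfline_intensity_finite:
  "A \<in> sets (halfline_intensity r) \<Longrightarrow> bounded A \<Longrightarrow> emeasure (halfline_intensity r) A < \<infinity>"
  using emeasure_bounded_finite[of A]
  by (auto simp: sets_halfline_intensity emeasure_halfline_intensity ennreal_mult_less_top)

lemma quadrant_intensity_finite:
  "A \<in> sets (quadrant_intensity r) \<Longrightarrow> bounded A \<Longrightarrow> emeasure (quadrant_intensity r) A < \<infinity>"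
  using emeasure_bounded_finite[of A]
  by (auto simp: sets_quadrant_intensity emeasure_quadrant_intensity ennreal_mult_less_top)

text \<open>The four processes are treated as one: a realisation of the noise is recorded by the number of points in
  each bounded region of each process. Every event below is a function of countably many of these numbers,
  which reduces the law of a solution to the law of the record.\<close>

datatype region = Mu_line "real set" | Lam_line "real set"
  | Mu_plane "(real \<times> real) set" | Lam_plane "(real \<times> real) set"

definition bounded_line :: "real set set" where
  "bounded_line = {A. A \<in> sets borel \<and> A \<subseteq> {0..} \<and> bounded A}"

definition bounded_plane :: "(real \<times> real) set set" where
  "bounded_plane = {A. A \<in> sets borel \<and> A \<subseteq> {0..} \<times> {0..} \<and> bounded A}"

definition bounded_regions :: "region set" where
  "bounded_regions = Mu_line ` bounded_line \<union> Lam_line ` bounded_line \<union>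
     Mu_plane ` bounded_plane \<union> Lam_plane ` bounded_plane"

lemma bounded_regions_simps [simp]:
  "Mu_line A \<in> bounded_regions \<longleftrightarrow> A \<in> bounded_line"
  "Lam_line A \<in> bounded_regions \<longleftrightarrow> A \<in> bounded_line"
  "Mu_plane C \<in> bounded_regions \<longleftrightarrow> C \<in> bounded_plane"
  "Lam_plane C \<in> bounded_regions \<longleftrightarrow> C \<in> bounded_plane"
  by (auto simp: bounded_regions_def)

definition pattern :: "real measure \<Rightarrow> real measure \<Rightarrow> (real \<times> real) measure \<Rightarrow> (real \<times> real) measure \<Rightarrow> region \<Rightarrow> nat" where
  "pattern \<alpha> \<beta> \<gamma> \<delta> = (\<lambda>r\<in>bounded_regions. case r of
     Mu_line A \<Rightarrow> num_points \<alpha> A | Lam_line A \<Rightarrow> num_points \<beta> A | Mu_plane C \<Rightarrow> num_points \<gamma> C | Lam_plane C \<Rightarrow> num_points \<delta> C)"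

lemma pattern_simps:
  "A \<in> bounded_line \<Longrightarrow> pattern \<alpha> \<beta> \<gamma> \<delta> (Mu_line A) = num_points \<alpha> A"
  "A \<in> bounded_line \<Longrightarrow> pattern \<alpha> \<beta> \<gamma> \<delta> (Lam_line A) = num_points \<beta> A"
  "C \<in> bounded_plane \<Longrightarrow> pattern \<alpha> \<beta> \<gamma> \<delta> (Mu_plane C) = num_points \<gamma> C"
  "C \<in> bounded_plane \<Longrightarrow> pattern \<alpha> \<beta> \<gamma> \<delta> (Lam_plane C) = num_points \<delta> C"
  by (auto simp: pattern_def)

abbreviation pattern_space :: "(region \<Rightarrow> nat) measure" where
  "pattern_space \<equiv> \<Pi>\<^sub>M r\<in>bounded_regions. count_space UNIV"

locale noise =
  fixes M :: "'a measure" and \<mu> lam :: real and N\<mu> Nlam :: "'a \<Rightarrow> real measure"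
    and N2\<mu> N2lam :: "'a \<Rightarrow> (real \<times> real) measure"
  assumes noise: "driving_noise M \<mu> lam N\<mu> Nlam N2\<mu> N2lam" and rates: "0 < \<mu>" "0 < lam"

sublocale noise \<subseteq> A: poisson_process M "halfline_intensity \<mu>" N\<mu>
  using noise by unfold_locales (simp add: driving_noise_def)
sublocale noise \<subseteq> B: poisson_process M "halfline_intensity lam" Nlam
  using noise by unfold_locales (simp add: driving_noise_def)
sublocale noise \<subseteq> C: poisson_process M "quadrant_intensity \<mu>" N2\<mu>
  using noise by unfold_locales (simp add: driving_noise_def)
sublocale noise \<subseteq> D: poisson_process M "quadrant_intensity lam" N2lam
  using noise by unfold_locales (simp add: driving_noise_def)

context noise
begin

definition noise_pattern :: "'a \<Rightarrow> region \<Rightarrow> nat" where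
  "noise_pattern \<omega> = pattern (N\<mu> \<omega>) (Nlam \<omega>) (N2\<mu> \<omega>) (N2lam \<omega>)"

definition process_events :: "nat \<Rightarrow> 'a set set" where
  "process_events i = [events_generated_by M (halfline_intensity \<mu>) N\<mu>,
             events_generated_by M (halfline_intensity lam) Nlam,
             events_generated_by M (quadrant_intensity \<mu>) N2\<mu>,
             events_generated_by M (quadrant_intensity lam) N2lam] ! i"

lemma indep_process_events: "A.indep_sets process_events {..<4::nat}"
  using noise unfolding driving_noise_def process_events_def by simp

lemma noise_pattern_measurable: "noise_pattern \<in> measurable M pattern_space"
  unfolding noise_pattern_def pattern_def
proof (rule measurable_restrict)
  fix r assume "r \<in> bounded_regions"
  then show "(\<lambda>\<omega>. case r of Mu_line A \<Rightarrow> num_points (N\<mu> \<omega>) A | Lam_line A \<Rightarrow> num_points (Nlam \<omega>) A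
      | Mu_plane C \<Rightarrow> num_points (N2\<mu> \<omega>) C | Lam_plane C \<Rightarrow> num_points (N2lam \<omega>) C) \<in> measurable M (count_space UNIV)"
    by (cases r) (auto simp: bounded_line_def bounded_plane_def sets_halfline_intensity sets_quadrant_intensity
        intro!: A.count_measurable B.count_measurable C.count_measurable D.count_measurable)
qed

text \<open>Independence of the four processes; the conditions are grouped by process.\<close>

lemma prob_pattern_factor:
  assumes "finite J" "J \<subseteq> bounded_regions"
  shows "A.prob {\<omega> \<in> space M. \<forall>j\<in>J. noise_pattern \<omega> j \<in> S j} =
    A.prob {\<omega> \<in> space M. \<forall>A\<in>Mu_line -` J. num_points (N\<mu> \<omega>) A \<in> S (Mu_line A)} *
    A.prob {\<omega> \<in> space M. \<forall>A\<in>Lam_line -` J. num_points (Nlam \<omega>) A \<in> S (Lam_line A)} *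
    A.prob {\<omega> \<in> space M. \<forall>A\<in>Mu_plane -` J. num_points (N2\<mu> \<omega>) A \<in> S (Mu_plane A)} *
    A.prob {\<omega> \<in> space M. \<forall>A\<in>Lam_plane -` J. num_points (N2lam \<omega>) A \<in> S (Lam_plane A)}"
proof -
  define E where "E i = [{\<omega> \<in> space M. \<forall>A\<in>Mu_line -` J. num_points (N\<mu> \<omega>) A \<in> S (Mu_line A)},
    {\<omega> \<in> space M. \<forall>A\<in>Lam_line -` J. num_points (Nlam \<omega>) A \<in> S (Lam_line A)},
    {\<omega> \<in> space M. \<forall>A\<in>Mu_plane -` J. num_points (N2\<mu> \<omega>) A \<in> S (Mu_plane A)},
    {\<omega> \<in> space M. \<forall>A\<in>Lam_plane -` J. num_points (N2lam \<omega>) A \<in> S (Lam_plane A)}] ! i" for i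
  have I: "{..<4::nat} = {0, 1, 2, 3}" by auto
  have fin: "finite (Mu_line -` J)" "finite (Lam_line -` J)" "finite (Mu_plane -` J)" "finite (Lam_plane -` J)"
    using assms(1) by (auto intro!: finite_vimageI injI)
  have sub: "Mu_line -` J \<subseteq> bounded_line" "Lam_line -` J \<subseteq> bounded_line"
    "Mu_plane -` J \<subseteq> bounded_plane" "Lam_plane -` J \<subseteq> bounded_plane"
    using assms(2) bounded_regions_simps by blast+
  have line: "bounded_line \<subseteq> sets (halfline_intensity r)" for r
    by (auto simp: bounded_line_def sets_halfline_intensity)
  have plane: "bounded_plane \<subseteq> sets (quadrant_intensity r)" for r
    by (auto simp: bounded_plane_def sets_quadrant_intensity)
  have E: "E i \<in> process_events i" if "i \<in> {..<4}" for i
    using that A.counts_in_events_generated_by[OF fin(1) order_trans[OF sub(1) line]]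
      B.counts_in_events_generated_by[OF fin(2) order_trans[OF sub(2) line]]
      C.counts_in_events_generated_by[OF fin(3) order_trans[OF sub(3) plane]]
      D.counts_in_events_generated_by[OF fin(4) order_trans[OF sub(4) plane]]
    unfolding I E_def process_events_def by auto
  have "A.prob (\<Inter>i\<in>{..<4}. E i) = (\<Prod>i\<in>{..<4}. A.prob (E i))"
    by (rule A.indep_setsD[OF indep_process_events]) (use E I in auto)
  moreover have "{\<omega> \<in> space M. \<forall>j\<in>J. noise_pattern \<omega> j \<in> S j} = (\<Inter>i\<in>{..<4}. E i)"
  proof (rule set_eqI)
    fix \<omega>
    have "(\<forall>j\<in>J. noise_pattern \<omega> j \<in> S j) \<longleftrightarrow>
      (\<forall>A\<in>Mu_line -` J. num_points (N\<mu> \<omega>) A \<in> S (Mu_line A)) \<and>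
      (\<forall>A\<in>Lam_line -` J. num_points (Nlam \<omega>) A \<in> S (Lam_line A)) \<and>
      (\<forall>A\<in>Mu_plane -` J. num_points (N2\<mu> \<omega>) A \<in> S (Mu_plane A)) \<and>
      (\<forall>A\<in>Lam_plane -` J. num_points (N2lam \<omega>) A \<in> S (Lam_plane A))" (is "?L \<longleftrightarrow> ?R")
    proof
      assume ?L
      then show ?R using sub by (force simp: noise_pattern_def pattern_simps)
    next
      assume R: ?R
      show ?L
      proof
        fix j assume "j \<in> J"
        then show "noise_pattern \<omega> j \<in> S j"
          using R sub by (cases j) (auto simp: noise_pattern_def pattern_simps subset_iff)
      qed
    qed
    then show "\<omega> \<in> {\<omega> \<in> space M. \<forall>j\<in>J. noise_pattern \<omega> j \<in> S j} \<longleftrightarrow> \<omega> \<in> (\<Inter>i\<in>{..<4}. E i)"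
      unfolding I E_def by auto
  qed
  ultimately show ?thesis unfolding I by (simp add: E_def mult.assoc)
qed

lemma prob_two_processes:
  assumes "i < 4" "j < 4" "i \<noteq> j" "E \<in> process_events i" "F \<in> process_events j"
  shows "A.prob (E \<inter> F) = A.prob E * A.prob F"
proof -
  have "A.prob (\<Inter>k\<in>{i, j}. if k = i then E else F) = (\<Prod>k\<in>{i, j}. A.prob (if k = i then E else F))"
    by (rule A.indep_setsD[OF indep_process_events]) (use assms in auto)
  moreover have "(\<Inter>k\<in>{i, j}. if k = i then E else F) = E \<inter> F" using assms(3) by auto
  ultimately show ?thesis using assms(3) by simp
qed

end

text \<open>Both laws have the same finite-dimensional marginals: these factor over the four processes, and within a
  process they depend on the intensity only.\<close>

lemma noise_pattern_law_unique:
  assumes 1: "noise M \<mu> lam N\<mu> Nlam N2\<mu> N2lam" and 2: "noise M' \<mu> lam N\<mu>' Nlam' N2\<mu>' N2lam'"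
  shows "distr M pattern_space (noise.noise_pattern N\<mu> Nlam N2\<mu> N2lam) =
    distr M' pattern_space (noise.noise_pattern N\<mu>' Nlam' N2\<mu>' N2lam')"
proof -
  interpret X: noise M \<mu> lam N\<mu> Nlam N2\<mu> N2lam by (rule 1)
  interpret Y: noise M' \<mu> lam N\<mu>' Nlam' N2\<mu>' N2lam' by (rule 2)
  show ?thesis
  proof (rule measure_eqI_PiM_infinite)
    fix S and J :: "region set"
    assume J: "finite J" "J \<subseteq> bounded_regions"
    let ?S = "prod_emb bounded_regions (\<lambda>_. count_space (UNIV :: nat set)) J (Pi\<^sub>E J S)"
    have S: "?S \<in> sets pattern_space" using J by (intro sets_PiM_I) auto
    have emb: "f -` ?S \<inter> A = {\<omega> \<in> A. \<forall>j\<in>J. f \<omega> j \<in> S j}" if "f \<in> A \<rightarrow> extensional bounded_regions"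
      for A :: "'x set" and f
      using that J(2) by (auto simp: prod_emb_iff PiE_def Pi_def restrict_def extensional_def)
    have *: "emeasure (distr M pattern_space X.noise_pattern) ?S =
        X.A.prob {\<omega> \<in> space M. \<forall>j\<in>J. X.noise_pattern \<omega> j \<in> S j}"
      by (subst emeasure_distr[OF X.noise_pattern_measurable S], subst emb)
        (auto simp: X.noise_pattern_def pattern_def X.A.emeasure_eq_measure)
    have **: "emeasure (distr M' pattern_space Y.noise_pattern) ?S =
        Y.A.prob {\<omega> \<in> space M'. \<forall>j\<in>J. Y.noise_pattern \<omega> j \<in> S j}"
      by (subst emeasure_distr[OF Y.noise_pattern_measurable S], subst emb)
        (auto simp: Y.noise_pattern_def pattern_def Y.A.emeasure_eq_measure)
    have fin: "finite (Mu_line -` J)" "finite (Lam_line -` J)" "finite (Mu_plane -` J)" "finite (Lam_plane -` J)"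
      using J(1) by (auto intro!: finite_vimageI injI)
    have sub: "Mu_line -` J \<subseteq> bounded_line" "Lam_line -` J \<subseteq> bounded_line"
      "Mu_plane -` J \<subseteq> bounded_plane" "Lam_plane -` J \<subseteq> bounded_plane"
      using J(2) bounded_regions_simps by blast+
    have line: "A \<in> bounded_line \<Longrightarrow> A \<in> sets (halfline_intensity r) \<and> bounded A" for A r
      by (simp add: bounded_line_def sets_halfline_intensity)
    have plane: "A \<in> bounded_plane \<Longrightarrow> A \<in> sets (quadrant_intensity r) \<and> bounded A" for A r
      by (simp add: bounded_plane_def sets_quadrant_intensity)
    have "X.A.prob {\<omega> \<in> space M. \<forall>j\<in>J. X.noise_pattern \<omega> j \<in> S j} =
      Y.A.prob {\<omega> \<in> space M'. \<forall>j\<in>J. Y.noise_pattern \<omega> j \<in> S j}"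
      unfolding X.prob_pattern_factor[OF J] Y.prob_pattern_factor[OF J]
      by (intro arg_cong2[where f = "(*)"]
          count_law_unique[OF X.A.poisson Y.A.poisson] count_law_unique[OF X.B.poisson Y.B.poisson]
          count_law_unique[OF X.C.poisson Y.C.poisson] count_law_unique[OF X.D.poisson Y.D.poisson]
          fin line plane halfline_intensity_finite quadrant_intensity_finite)
        (use sub in auto)
    then show "emeasure (distr M pattern_space X.noise_pattern) ?S =
      emeasure (distr M' pattern_space Y.noise_pattern) ?S" unfolding * ** by simp
  next
    show "finite_measure (distr M pattern_space X.noise_pattern)"
      by (intro finite_measure.finite_measure_distr X.noise_pattern_measurable X.A.finite_measure_axioms)
  qed auto
qed

section \<open>Measures with natural values on bounded sets\<close>

text \<open>Realisations of point processes, without randomness, described by the numbers of points in bounded sets.\<close>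

locale discrete_measure =
  fixes m :: "'s::metric_space measure" and D :: "'s set"
  assumes domain: "D \<in> sets borel"
    and sets_iff: "\<And>A. A \<in> sets m \<longleftrightarrow> A \<in> sets borel \<and> A \<subseteq> D"
    and Nats: "\<And>A. A \<in> sets m \<Longrightarrow> bounded A \<Longrightarrow> emeasure m A \<in> \<nat>"
begin

lemma space_m: "space m = D"
proof
  show "space m \<subseteq> D" using sets_iff[of "space m"] by simp
  show "D \<subseteq> space m" using sets_iff[of D] domain sets.sets_into_space by blast
qed

lemma measurable_borel_m:
  assumes "g \<in> measurable borel N"
  shows "g \<in> measurable m N"
proof (rule measurableI)
  show "g x \<in> space N" for x using measurable_space[OF assms] by simp
  fix A assume "A \<in> sets N"
  then have "g -` A \<in> sets borel" using measurable_sets[OF assms, of A] by simp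
  then show "g -` A \<inter> space m \<in> sets m" using domain by (simp add: sets_iff space_m)
qed

lemma emeasure_m: "A \<in> sets m \<Longrightarrow> bounded A \<Longrightarrow> emeasure m A = of_nat (num_points m A)"
  by (rule emeasure_eq_num_points(1)) (rule Nats)

lemma measure_m: "A \<in> sets m \<Longrightarrow> bounded A \<Longrightarrow> measure m A = real (num_points m A)"
  by (rule emeasure_eq_num_points(2)) (rule Nats)

lemma num_points_mono:
  assumes "A \<in> sets m" "B \<in> sets m" "bounded B" "A \<subseteq> B"
  shows "num_points m A \<le> num_points m B"
proof -
  have "of_nat (num_points m A) \<le> (of_nat (num_points m B) :: ennreal)"
    using emeasure_mono[OF assms(4,2)] emeasure_m[OF assms(2,3)]
      emeasure_m[OF assms(1) bounded_subset[OF assms(3,4)]] by simp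
  then show ?thesis by (simp only: of_nat_le_iff)
qed

lemma num_points_Un:
  assumes "A \<in> sets m" "B \<in> sets m" "bounded A" "bounded B" "A \<inter> B = {}"
  shows "num_points m (A \<union> B) = num_points m A + num_points m B"
proof -
  have "emeasure m (A \<union> B) = emeasure m A + emeasure m B"
    using assms by (intro plus_emeasure[symmetric]) auto
  then have "(of_nat (num_points m (A \<union> B)) :: ennreal) = of_nat (num_points m A + num_points m B)"
    using emeasure_m[OF assms(1,3)] emeasure_m[OF assms(2,4)] emeasure_m[of "A \<union> B"] assms by simp
  then show ?thesis by (simp only: of_nat_eq_iff)
qed

lemma num_points_empty [simp]: "num_points m {} = 0"
  by (simp add: num_points_def)

lemma num_points_zero_iff:
  assumes "A \<in> sets m" "bounded A"
  shows "num_points m A = 0 \<longleftrightarrow> A \<in> null_sets m"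
  using emeasure_m[OF assms] assms(1) by (auto simp: null_sets_def)

lemma num_points_zero_AE:
  assumes "A \<in> sets m" "bounded A" "num_points m A = 0"
  shows "AE x in m. x \<notin> A"
  using assms num_points_zero_iff[OF assms(1,2)] by (intro AE_not_in) simp

lemma num_points_AE_cong:
  assumes "AE x in m. x \<in> A \<longleftrightarrow> x \<in> B" "A \<in> sets m" "B \<in> sets m"
  shows "num_points m A = num_points m B"
  using emeasure_eq_AE[OF assms] by (simp add: num_points_def measure_def)

lemma num_points_UN_zero:
  fixes A :: "nat \<Rightarrow> 's set"
  assumes "\<And>i. A i \<in> sets m" "\<And>i. num_points m (A i) = 0" "bounded (\<Union>i. A i)"
  shows "num_points m (\<Union>i. A i) = 0"
proof -
  have b: "bounded (A i)" for i using assms(3) by (rule bounded_subset) auto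
  have "(\<Union>i. A i) \<in> null_sets m"
    by (rule null_sets_UN) (use num_points_zero_iff assms b in blast)
  then show ?thesis using num_points_zero_iff[OF null_setsD2 assms(3)] by blast
qed

lemma set_integrable_m:
  fixes g :: "'s \<Rightarrow> real"
  assumes "g \<in> borel_measurable borel" "A \<in> sets m" "bounded A" "\<And>x. x \<in> A \<Longrightarrow> \<bar>g x\<bar> \<le> B"
  shows "set_integrable m A g"
  unfolding set_integrable_def
proof (rule integrableI_bounded_set[of A _ _ B])
  show "(\<lambda>x. indicator A x *\<^sub>R g x) \<in> borel_measurable m"
    using assms(2) measurable_borel_m[OF assms(1)] by measurable
  show "emeasure m A < \<infinity>" using emeasure_m[OF assms(2,3)] by (simp add: of_nat_less_top)
qed (use assms in auto)

lemma set_integral_const_AE: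
  fixes g :: "'s \<Rightarrow> real"
  assumes "g \<in> borel_measurable borel" "A \<in> sets m" "bounded A" "AE x in m. x \<in> A \<longrightarrow> g x = c"
  shows "(LINT x:A|m. g x) = c * real (num_points m A)"
proof -
  have "(LINT x:A|m. g x) = (LINT x:A|m. c)"
    unfolding set_lebesgue_integral_def
  proof (rule integral_cong_AE)
    show "(\<lambda>x. indicator A x *\<^sub>R g x) \<in> borel_measurable m"
      using assms(2) measurable_borel_m[OF assms(1)] by measurable
    show "(\<lambda>x. indicator A x *\<^sub>R c) \<in> borel_measurable m"
      using assms(2) by measurable
    show "AE x in m. indicator A x *\<^sub>R g x = indicator A x *\<^sub>R c"
      using assms(4) by (rule eventually_mono) (auto simp: indicator_def)
  qed
  also have "\<dots> = measure m A * c"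
    using assms(2) sets.sets_into_space[OF assms(2)] by (simp add: set_lebesgue_integral_def Int_absorb2)
  finally show ?thesis using measure_m[OF assms(2,3)] by simp
qed

lemma set_integral_indicator_region:
  assumes "R \<in> sets m" "bounded R" "\<And>x. x \<in> A \<and> P x \<longleftrightarrow> x \<in> R"
  shows "(LINT x:A|m. of_bool (P x)) = real (num_points m R)"
proof -
  have "(\<lambda>x. indicator A x *\<^sub>R of_bool (P x)) = (indicator R :: 's \<Rightarrow> real)"
    using assms(3) by (auto simp: indicator_def fun_eq_iff)
  then show ?thesis
    using measure_m[OF assms(1,2)] sets.sets_into_space[OF assms(1)]
    by (simp add: set_lebesgue_integral_def Int_absorb2)
qed

end

section \<open>Left limits of a path as a Borel function\<close>

text \<open>The value outside of [0,T] only serves to obtain a function that is Borel on the whole line.\<close>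

definition left_path :: "real \<Rightarrow> (real \<Rightarrow> nat \<times> nat) \<Rightarrow> real \<Rightarrow> nat \<times> nat" where
  "left_path T f s = (if s \<in> {0..T} then left_limit f s else (0, 0))"

text \<open>The left limit at s is the eventual value of the path along the grid points just before s, and
  these depend on s only through an integer.\<close>

lemma left_path_measurable:
  assumes f: "f \<in> cadlag_paths T"
  shows "left_path T f \<in> measurable borel (count_space UNIV)"
proof -
  \<comment> \<open>The grid point before s, strictly earlier than s unless s = 0.\<close>
  define q where "q n s = max 0 ((of_int \<lceil>s * real (Suc n)\<rceil> - 1) / real (Suc n))" for n and s :: real
  have q_less: "q n s < s" if "0 < s" for n s
  proof -
    have "of_int \<lceil>s * real (Suc n)\<rceil> - 1 < s * real (Suc n)" by linarith
    then have "(of_int \<lceil>s * real (Suc n)\<rceil> - 1) / real (Suc n) < s" by (simp add: pos_divide_less_eq)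
    then show ?thesis using that by (simp add: q_def)
  qed
  have q_ge: "s - 1 / real (Suc n) \<le> q n s" for n s
  proof -
    have "s * real (Suc n) - 1 \<le> of_int \<lceil>s * real (Suc n)\<rceil> - 1" by linarith
    then have "(s * real (Suc n) - 1) / real (Suc n) \<le> (of_int \<lceil>s * real (Suc n)\<rceil> - 1) / real (Suc n)"
      by (rule divide_right_mono) simp
    moreover have "(s * real (Suc n) - 1) / real (Suc n) = s - 1 / real (Suc n)"
      by (simp add: diff_divide_distrib del: of_nat_Suc)
    ultimately show ?thesis by (simp add: q_def le_max_iff_disj)
  qed
  have ev: "\<exists>N. \<forall>n\<ge>N. f (q n s) = left_limit f s" if s: "s \<in> {0..T}" for s
  proof (cases "s = 0")
    case True
    then show ?thesis by (simp add: q_def left_limit_def)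
  next
    case False
    with s have s': "0 < s" "s \<le> T" by auto
    obtain e where e: "e > 0" "e \<le> s" "\<And>r. s - e < r \<Longrightarrow> r < s \<Longrightarrow> f r = left_limit f s"
      using cadlag_left_limit[OF f s'] by blast
    obtain N where N: "1 / real (Suc N) < e" using nat_approx_posE[OF e(1)] by auto
    have "f (q n s) = left_limit f s" if "N \<le> n" for n
    proof (rule e(3))
      have "1 / real (Suc n) \<le> 1 / real (Suc N)" using that by (simp add: frac_le)
      then show "s - e < q n s" using q_ge[of s n] N by linarith
      show "q n s < s" by (rule q_less[OF s'(1)])
    qed
    then show ?thesis by blast
  qed
  have qm: "(\<lambda>s. f (q n s)) \<in> measurable borel (count_space UNIV)" for n
  proof -
    have c: "(\<lambda>s::real. \<lceil>s * real (Suc n)\<rceil>) \<in> measurable borel (count_space UNIV)"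
      by (rule measurable_compose[OF _ measurable_real_ceiling]) measurable
    show ?thesis unfolding q_def by (rule measurable_compose[OF c]) simp
  qed
  have eq: "left_path T f -` {v} \<inter> space borel =
      (if v = (0, 0) then - {0..T} else {}) \<union> ({0..T} \<inter> (\<Union>N. \<Inter>n\<in>{N..}. (\<lambda>s. f (q n s)) -` {v} \<inter> space borel))"
    for v
  proof (rule set_eqI)
    fix s
    show "s \<in> left_path T f -` {v} \<inter> space borel \<longleftrightarrow> s \<in> (if v = (0, 0) then - {0..T} else {}) \<union>
      ({0..T} \<inter> (\<Union>N. \<Inter>n\<in>{N..}. (\<lambda>s. f (q n s)) -` {v} \<inter> space borel))"
    proof (cases "s \<in> {0..T}")
      case True
      obtain N where N: "\<And>n. n \<ge> N \<Longrightarrow> f (q n s) = left_limit f s" using ev[OF True] by blast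
      have "left_limit f s = v \<longleftrightarrow> (\<exists>N. \<forall>n\<ge>N. f (q n s) = v)"
      proof
        assume "\<exists>N. \<forall>n\<ge>N. f (q n s) = v"
        then obtain N' where "\<forall>n\<ge>N'. f (q n s) = v" by blast
        then have "f (q (max N N') s) = v" by simp
        then show "left_limit f s = v" using N[of "max N N'"] by simp
      qed (use N in blast)
      then have "left_path T f s = v \<longleftrightarrow> (\<exists>N. \<forall>n\<ge>N. f (q n s) = v)" using True by (simp add: left_path_def)
      moreover have "s \<notin> (if v = (0, 0) then - {0..T} else {})" using True by simp
      ultimately show ?thesis using True by (simp only: vimage_singleton_eq INT_iff UN_iff Un_iff Int_iff space_borel UNIV_I atLeast_iff
          simp_thms Ball_def Bex_def)
    next
      case False
      then have "left_path T f s = (0, 0)" by (simp only: left_path_def if_False)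
      then show ?thesis using False by (cases "v = (0, 0)") auto
    qed
  qed
  have "left_path T f -` {v} \<inter> space borel \<in> sets borel" for v
    unfolding eq using measurable_sets[OF qm] by (intro sets.Un sets.Int sets.countable_UN sets.countable_INT) auto
  then show ?thesis by (subst measurable_count_space_eq_countable) auto
qed

lemma left_path_bounded:
  assumes f: "f \<in> cadlag_paths T" and T: "0 < T"
  obtains B where "\<And>s. real (fst (left_path T f s)) \<le> B" "\<And>s. real (snd (left_path T f s)) \<le> B"
proof -
  let ?R = "insert (0, 0) (f ` {0..T})"
  have fin: "finite ((\<lambda>v. real (fst v) + real (snd v)) ` ?R)" using cadlag_finite_range[OF f T] by simp
  have mem: "left_path T f s \<in> ?R" for s
  proof (cases "s \<in> {0..T}")
    case True
    show ?thesis
    proof (cases "s = 0")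
      case True
      then show ?thesis using T by (simp add: left_path_def left_limit_def)
    next
      case False
      with True have s: "0 < s" "s \<le> T" by auto
      obtain e where e: "e > 0" "e \<le> s" "\<And>r. s - e < r \<Longrightarrow> r < s \<Longrightarrow> f r = left_limit f s"
        using cadlag_left_limit[OF f s] by blast
      have "f (s - e / 2) = left_limit f s" by (rule e(3)) (use e in auto)
      moreover have "s - e / 2 \<in> {0..T}" using e s by auto
      ultimately show ?thesis using True by (metis image_eqI insertCI left_path_def)
    qed
  next
    case False
    then have "left_path T f s = (0, 0)" by (simp only: left_path_def if_False)
    then show ?thesis by simp
  qed
  let ?B = "Max ((\<lambda>v. real (fst v) + real (snd v)) ` ?R)"
  have "real (fst (left_path T f s)) + real (snd (left_path T f s)) \<le> ?B" for s
    by (rule Max_ge[OF fin]) (use mem in blast)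
  then have "real (fst (left_path T f s)) \<le> ?B" "real (snd (left_path T f s)) \<le> ?B" for s
    by (smt (verit) of_nat_0_le_iff)+
  then show ?thesis using that by blast
qed

section \<open>The equations for a fixed realisation of the noise\<close>

text \<open>With a profile p this region contains the points that trigger an arrival; with p the second component of
  a path it contains those that trigger a transfer. All integrals over the quadrant count points of such
  regions.\<close>

definition region_below :: "(real \<Rightarrow> real) \<Rightarrow> real set \<Rightarrow> (real \<times> real) set" where
  "region_below p A = {q. fst q \<in> A \<and> 0 \<le> snd q \<and> snd q \<le> p (fst q)}"

lemma region_below_sets:
  assumes "p \<in> borel_measurable borel" "A \<in> sets borel"
  shows "region_below p A \<in> sets borel"
proof -
  have "(\<lambda>q::real \<times> real. fst q) \<in> borel_measurable borel" "(\<lambda>q::real \<times> real. snd q) \<in> borel_measurable borel"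
    by (simp_all add: borel_prod[symmetric])
  note m = this measurable_compose[OF this(1) assms(1)]
  have "{q \<in> space borel. fst q \<in> A} \<in> sets (borel :: (real \<times> real) measure)"
    using measurable_sets[OF m(1) assms(2)] by (simp add: vimage_def)
  moreover have "{q \<in> space borel. 0 \<le> snd q} \<in> sets (borel :: (real \<times> real) measure)"
    using m by measurable
  moreover have "{q \<in> space borel. snd q \<le> p (fst q)} \<in> sets (borel :: (real \<times> real) measure)"
    using m by measurable
  ultimately have "{q \<in> space borel. fst q \<in> A} \<inter> ({q \<in> space borel. 0 \<le> snd q} \<inter> {q \<in> space borel. snd q \<le> p (fst q)})
     \<in> sets (borel :: (real \<times> real) measure)" by blast
  then show ?thesis by (simp add: region_below_def Int_def)
qed

lemma region_below_subset: "(\<And>s. s \<in> A \<Longrightarrow> p s \<le> B) \<Longrightarrow> region_below p A \<subseteq> A \<times> {0..B}"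
  by (force simp: region_below_def)

lemma region_below_const: "region_below (\<lambda>_. B) A = A \<times> {0..B}"
  by (auto simp: region_below_def)

lemma region_below_bounded_plane:
  assumes "p \<in> borel_measurable borel" "A \<in> bounded_line" "\<And>s. s \<in> A \<Longrightarrow> p s \<le> B"
  shows "region_below p A \<in> bounded_plane"
proof -
  have "bounded (A \<times> {0..B})" using assms(2) by (intro bounded_Times) (auto simp: bounded_line_def)
  moreover have "region_below p A \<subseteq> A \<times> {0..B}" using assms(3) by (rule region_below_subset)
  ultimately show ?thesis
    using assms(2) region_below_sets[OF assms(1), of A] bounded_subset
    by (auto simp: bounded_plane_def bounded_line_def region_below_def)
qed

lemma Times_bounded_plane: "A \<in> bounded_line \<Longrightarrow> A \<times> {0..B} \<in> bounded_plane"
  using region_below_bounded_plane[of "\<lambda>_. B" A B] by (simp add: region_below_const)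

lemma interval_bounded_line:
  "0 \<le> a \<Longrightarrow> {a<..b} \<in> bounded_line" "0 \<le> a \<Longrightarrow> {a..b} \<in> bounded_line" "{} \<in> bounded_line"
  by (auto simp: bounded_line_def intro: bounded_subset[OF bounded_closed_interval[of a b]])

text \<open>The right-hand sides of the equations, as functions of the path u of left limits and of the profile p
  that takes the place of the probabilities.\<close>

definition rhs1 :: "real measure \<Rightarrow> real measure \<Rightarrow> (real \<times> real) measure \<Rightarrow> nat \<Rightarrow>
    (real \<Rightarrow> nat \<times> nat) \<Rightarrow> real \<Rightarrow> real" where
  "rhs1 \<alpha> \<beta> \<gamma> x u t = real x
     - (LINT s:{0..t}|\<alpha>. real (fst (u s)))
     - (LINT s:{0..t}|\<beta>. of_bool (fst (u s) > 0))
     + (LINT q:{0..t} \<times> {0..}|\<gamma>. of_bool (0 \<le> snd q \<and> snd q \<le> real (snd (u (fst q)))))"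

definition rhs2 :: "real measure \<Rightarrow> real measure \<Rightarrow> (real \<times> real) measure \<Rightarrow> (real \<times> real) measure \<Rightarrow>
    (real \<Rightarrow> real) \<Rightarrow> nat \<Rightarrow> (real \<Rightarrow> nat \<times> nat) \<Rightarrow> real \<Rightarrow> real" where
  "rhs2 \<alpha> \<beta> \<gamma> \<delta> p y u t = real y
     - (LINT s:{0..t}|\<alpha>. real (snd (u s)))
     - (LINT q:{0..t} \<times> {0..}|\<gamma>. of_bool (0 \<le> snd q \<and> snd q \<le> real (snd (u (fst q)))))
     + (LINT s:{0..t}|\<beta>. of_bool (fst (u s) > 0))
     + (LINT q:{0..t} \<times> {0..}|\<delta>. of_bool (0 \<le> snd q \<and> snd q \<le> p (fst q)))"

definition solves_equations :: "real measure \<Rightarrow> real measure \<Rightarrow> (real \<times> real) measure \<Rightarrow> (real \<times> real) measure \<Rightarrow>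
    real \<Rightarrow> (real \<Rightarrow> real) \<Rightarrow> nat \<Rightarrow> nat \<Rightarrow> (real \<Rightarrow> nat \<times> nat) \<Rightarrow> bool" where
  "solves_equations \<alpha> \<beta> \<gamma> \<delta> T p x y f \<longleftrightarrow> (\<forall>t\<in>{0..T}.
     real (fst (f t)) = rhs1 \<alpha> \<beta> \<gamma> x (left_limit f) t \<and>
     real (snd (f t)) = rhs2 \<alpha> \<beta> \<gamma> \<delta> p y (left_limit f) t)"

lemma set_integral_eqI:
  assumes "\<And>x. x \<in> A \<Longrightarrow> f x = g x"
  shows "(LINT x:A|M. f x) = (LINT x:A|M. (g x :: real))"
proof -
  have "(\<lambda>x. indicator A x *\<^sub>R f x) = (\<lambda>x. indicator A x *\<^sub>R g x)"
    using assms by (auto simp: indicator_def fun_eq_iff)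
  then show ?thesis by (simp add: set_lebesgue_integral_def)
qed

lemma rhs_cong:
  fixes t :: real and p q :: "real \<Rightarrow> real"
  assumes "\<And>s. s \<in> {0..t} \<Longrightarrow> u s = v s" "\<And>s. s \<in> {0..t} \<Longrightarrow> p s = q s"
  shows "rhs1 \<alpha> \<beta> \<gamma> x u t = rhs1 \<alpha> \<beta> \<gamma> x v t" "rhs2 \<alpha> \<beta> \<gamma> \<delta> p y u t = rhs2 \<alpha> \<beta> \<gamma> \<delta> q y v t"
proof -
  have 1: "(LINT s:{0..t}|m. g (u s)) = (LINT s:{0..t}|m. g (v s))" for m and g :: "nat \<times> nat \<Rightarrow> real"
    by (rule set_integral_eqI) (simp only: assms(1))
  have 2: "(LINT q:{0..t} \<times> {0..}|m. of_bool (0 \<le> snd q \<and> snd q \<le> real (snd (u (fst q))))) =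
    (LINT q:{0..t} \<times> {0..}|m. (of_bool (0 \<le> snd q \<and> snd q \<le> real (snd (v (fst q)))) :: real))" for m :: "(real \<times> real) measure"
    by (rule set_integral_eqI) (simp add: assms(1) mem_Times_iff)
  have 3: "(LINT r:{0..t} \<times> {0..}|m. of_bool (0 \<le> snd r \<and> snd r \<le> p (fst r))) =
    (LINT r:{0..t} \<times> {0..}|m. (of_bool (0 \<le> snd r \<and> snd r \<le> q (fst r)) :: real))" for m :: "(real \<times> real) measure"
    by (rule set_integral_eqI) (simp add: assms(2) mem_Times_iff)
  show "rhs1 \<alpha> \<beta> \<gamma> x u t = rhs1 \<alpha> \<beta> \<gamma> x v t"
    unfolding rhs1_def 2 1[of \<alpha> "\<lambda>w. real (fst w)"] 1[of \<beta> "\<lambda>w. of_bool (0 < fst w)"] ..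
  show "rhs2 \<alpha> \<beta> \<gamma> \<delta> p y u t = rhs2 \<alpha> \<beta> \<gamma> \<delta> q y v t"
    unfolding rhs2_def 2 3 1[of \<alpha> "\<lambda>w. real (snd w)"] 1[of \<beta> "\<lambda>w. of_bool (0 < fst w)"] ..
qed

text \<open>The effect of a single point with time in A on the state r. A point of the first process empties both
  components; one of the second moves a unit from the first component to the second, unless the first is
  0; one of the third moves a unit back if its height is at most the second component; one of the fourth
  adds a unit to the second component if it lies below p.\<close>

definition step :: "(real \<Rightarrow> real) \<Rightarrow> (region \<Rightarrow> nat) \<Rightarrow> real set \<Rightarrow> nat \<times> nat \<Rightarrow> nat \<times> nat" where
  "step p c A r = (let i = c (Mu_line A); j = (if fst r > 0 then c (Lam_line A) else 0);
     k = c (Mu_plane (A \<times> {0..real (snd r)})); l = c (Lam_plane (region_below p A))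
   in (fst r + k - fst r * i - j, snd r + j + l - snd r * i - k))"

definition cell :: "real \<Rightarrow> nat \<Rightarrow> nat \<Rightarrow> real \<Rightarrow> real set" where
  "cell T n k t = {grid_point T n k <.. min t (grid_point T n (Suc k))}"

text \<open>Each cell is truncated at t, so that the state after all n cells is the value of the path at time t.
  This expresses the path by counts of points, without reference to jump times.\<close>

primrec grid_state where
  "grid_state p c T n z t 0 = z"
| "grid_state p c T n z t (Suc k) = step p c (cell T n k t) (grid_state p c T n z t k)"

definition grid_path :: "(real \<Rightarrow> real) \<Rightarrow> (region \<Rightarrow> nat) \<Rightarrow> real \<Rightarrow> nat \<Rightarrow> nat \<times> nat \<Rightarrow> real \<Rightarrow> nat \<times> nat" where
  "grid_path p c T n z = (\<lambda>t\<in>{0..T}. grid_state p c T n z t n)"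

text \<open>The number of points in A that can matter: the second component never exceeds the level K below, and
  profiles are at most 1.\<close>

definition activity :: "(region \<Rightarrow> nat) \<Rightarrow> real \<Rightarrow> real set \<Rightarrow> nat" where
  "activity c K A = c (Mu_line A) + c (Lam_line A) + c (Mu_plane (A \<times> {0..K})) + c (Lam_plane (A \<times> {0..1}))"

text \<open>The second component grows only at points of the two processes with rate lam, which bounds it by this
  number.\<close>

definition level :: "(region \<Rightarrow> nat) \<Rightarrow> real \<Rightarrow> nat \<Rightarrow> nat" where
  "level c T y = y + c (Lam_line {0..T}) + c (Lam_plane ({0..T} \<times> {0..1}))"

text \<open>A cell with at most one point has an unambiguous effect: simultaneous points could make the right-hand
  sides negative. Likewise a point of the third process at height 0 would lower a second component that is
  already 0. The point 0 of time belongs to no cell and is treated separately.\<close>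

definition sparse_grid :: "(region \<Rightarrow> nat) \<Rightarrow> real \<Rightarrow> real \<Rightarrow> nat \<Rightarrow> bool" where
  "sparse_grid c T K n \<longleftrightarrow> 0 < n \<and> activity c K {0..0} = 0 \<and> c (Mu_plane ({0..T} \<times> {0..0})) = 0 \<and>
     (\<forall>k<n. activity c K (cell T n k T) \<le> 1)"

lemma grid_cell_exists':
  assumes "0 < n" "0 \<le> t" "t < T"
  obtains k where "k < n" "grid_point T n k \<le> t" "t < grid_point T n (Suc k)"
proof -
  define k where "k = (LEAST k. t < grid_point T n k)"
  have n: "t < grid_point T n n" using assms by simp
  have k: "t < grid_point T n k" unfolding k_def by (rule LeastI[of _ n]) (rule n)
  have kn: "k \<le> n" unfolding k_def by (rule Least_le) (rule n)
  have "k \<noteq> 0" using k assms by (auto intro: ccontr)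
  then obtain j where j: "k = Suc j" by (cases k) auto
  have "\<not> t < grid_point T n j" using not_less_Least[of j "\<lambda>k. t < grid_point T n k"] j by (simp add: k_def)
  then show ?thesis using that[of j] k kn j by auto
qed

context discrete_measure
begin

lemma set_integral_split:
  fixes g :: "'s \<Rightarrow> real"
  assumes "g \<in> borel_measurable borel" "A \<in> sets m" "bounded A" "B \<in> sets m" "bounded B" "A \<inter> B = {}"
    "\<And>x. \<bar>g x\<bar> \<le> C"
  shows "(LINT x:A \<union> B|m. g x) = (LINT x:A|m. g x) + (LINT x:B|m. g x)"
  by (rule set_integral_Un[OF assms(6)]; rule set_integrable_m[OF assms(1)]) (use assms in auto)

end

locale realisation =
  \<alpha>: discrete_measure \<alpha> "{0..}" + \<beta>: discrete_measure \<beta> "{0..}" +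
  \<gamma>: discrete_measure \<gamma> "{0..} \<times> {0..}" + \<delta>: discrete_measure \<delta> "{0..} \<times> {0..}"
  for \<alpha> \<beta> :: "real measure" and \<gamma> \<delta> :: "(real \<times> real) measure" +
  fixes T :: real and p :: "real \<Rightarrow> real" and y :: nat
  assumes T: "0 < T" and p: "p \<in> borel_measurable borel" and p01: "\<And>s. 0 \<le> p s" "\<And>s. p s \<le> 1"
begin

abbreviation "c \<equiv> pattern \<alpha> \<beta> \<gamma> \<delta>"
abbreviation "K \<equiv> real (level c T y)"

lemma line_sets: "A \<in> bounded_line \<Longrightarrow> A \<in> sets \<alpha>" "A \<in> bounded_line \<Longrightarrow> A \<in> sets \<beta>"
    "A \<in> bounded_line \<Longrightarrow> bounded A"
  by (auto simp: bounded_line_def \<alpha>.sets_iff \<beta>.sets_iff)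

lemma plane_sets: "A \<in> bounded_plane \<Longrightarrow> A \<in> sets \<gamma>" "A \<in> bounded_plane \<Longrightarrow> A \<in> sets \<delta>"
    "A \<in> bounded_plane \<Longrightarrow> bounded A"
  by (auto simp: bounded_plane_def \<gamma>.sets_iff \<delta>.sets_iff)

lemma activity_eq:
  assumes "A \<in> bounded_line"
  shows "activity c B A = num_points \<alpha> A + num_points \<beta> A + num_points \<gamma> (A \<times> {0..B}) + num_points \<delta> (A \<times> {0..1})"
  using assms Times_bounded_plane[OF assms] by (simp add: activity_def pattern_simps)

lemma activity_Un:
  assumes "A \<in> bounded_line" "B \<in> bounded_line" "A \<inter> B = {}" "A \<union> B \<in> bounded_line"
  shows "activity c h (A \<union> B) = activity c h A + activity c h B"
proof -
  have "(A \<union> B) \<times> X = A \<times> X \<union> B \<times> X" "(A \<times> X) \<inter> (B \<times> X) = {}" for X :: "real set"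
    using assms(3) by blast+
  note X = this
  note t = Times_bounded_plane[OF assms(1)] Times_bounded_plane[OF assms(2)]
  have "num_points \<alpha> (A \<union> B) = num_points \<alpha> A + num_points \<alpha> B"
    by (intro \<alpha>.num_points_Un line_sets assms)
  moreover have "num_points \<beta> (A \<union> B) = num_points \<beta> A + num_points \<beta> B"
    by (intro \<beta>.num_points_Un line_sets assms)
  moreover have "num_points \<gamma> ((A \<union> B) \<times> {0..h}) = num_points \<gamma> (A \<times> {0..h}) + num_points \<gamma> (B \<times> {0..h})"
    unfolding X(1) by (intro \<gamma>.num_points_Un plane_sets t X(2))
  moreover have "num_points \<delta> ((A \<union> B) \<times> {0..1}) = num_points \<delta> (A \<times> {0..1}) + num_points \<delta> (B \<times> {0..1})"
    unfolding X(1) by (intro \<delta>.num_points_Un plane_sets t X(2))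
  ultimately show ?thesis using assms by (simp add: activity_eq)
qed

lemma activity_split:
  assumes "0 \<le> a" "a \<le> s" "s \<le> b"
  shows "activity c h {a<..b} = activity c h {a<..s} + activity c h {s<..b}"
proof -
  have eq: "{a<..b} = {a<..s} \<union> {s<..b}" using assms by auto
  show ?thesis
    using activity_Un[of "{a<..s}" "{s<..b}" h] eq assms interval_bounded_line(1)[of a b]
      interval_bounded_line(1)[of a s] interval_bounded_line(1)[of s b] by auto
qed

definition quiet :: "real \<Rightarrow> real \<Rightarrow> bool" where
  "quiet a b \<longleftrightarrow> activity c K {a<..b} = 0"

lemma quiet_refl: "b \<le> a \<Longrightarrow> quiet a b"
  using interval_bounded_line(3) by (simp add: quiet_def activity_eq)

lemma quiet_mono:
  assumes "quiet a b" "0 \<le> a" "a \<le> a'" "b' \<le> b"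
  shows "quiet a' b'"
proof (cases "a' \<le> b'")
  case True
  have "activity c K {a<..b} = activity c K {a<..a'} + (activity c K {a'<..b'} + activity c K {b'<..b})"
    using activity_split[of a a' b K] activity_split[of a' b' b K] assms True by simp
  then show ?thesis using assms(1) by (simp add: quiet_def)
qed (simp add: quiet_refl)

text \<open>Countable additivity: the interval open at \<sigma> is exhausted by intervals that start later.\<close>

lemma quiet_limit:
  assumes "0 \<le> \<sigma>" and q: "\<And>s. \<sigma> < s \<Longrightarrow> s < b \<Longrightarrow> quiet s b"
  shows "quiet \<sigma> b"
proof (cases "\<sigma> < b")
  case True
  define s where "s m = \<sigma> + (b - \<sigma>) / real (m + 2)" for m
  have s: "\<sigma> < s m" "s m < b" for m
  proof -
    have "(b - \<sigma>) / real (m + 2) > 0" "(b - \<sigma>) / real (m + 2) < b - \<sigma>"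
      using True by (simp_all add: divide_less_eq)
    then show "\<sigma> < s m" "s m < b" unfolding s_def by linarith+
  qed
  have I: "{\<sigma><..b} = (\<Union>m. {s m<..b})"
  proof (intro equalityI subsetI)
    fix r assume r: "r \<in> {\<sigma><..b}"
    then have "0 < r - \<sigma>" by simp
    then obtain m where m: "(b - \<sigma>) / real m < r - \<sigma>" "0 < m" using grid_fine[of "r - \<sigma>" "b - \<sigma>"] by blast
    have "(b - \<sigma>) / real (m + 2) \<le> (b - \<sigma>) / real m"
      using True m(2) by (intro divide_left_mono) auto
    then have "s m < r" using m(1) by (simp add: s_def)
    then show "r \<in> (\<Union>m. {s m<..b})" using r by auto
  next
    fix r assume "r \<in> (\<Union>m. {s m<..b})"
    then show "r \<in> {\<sigma><..b}" using s(1) by (auto intro: less_trans)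
  qed
  have X: "{\<sigma><..b} \<times> X = (\<Union>m. {s m<..b} \<times> X)" for X :: "real set" unfolding I by blast
  have line: "{s m<..b} \<in> bounded_line" for m using s(1)[of m] assms(1) by (intro interval_bounded_line) simp
  have line': "{\<sigma><..b} \<in> bounded_line" using assms(1) by (rule interval_bounded_line)
  have z: "activity c K {s m<..b} = 0" for m using q[OF s] by (simp add: quiet_def)
  have "num_points \<alpha> {\<sigma><..b} = 0"
    using line_sets(3)[OF line'] line_sets[OF line] z unfolding I
    by (intro \<alpha>.num_points_UN_zero) (simp_all add: activity_eq[OF line])
  moreover have "num_points \<beta> {\<sigma><..b} = 0"
    using line_sets(3)[OF line'] line_sets[OF line] z unfolding I
    by (intro \<beta>.num_points_UN_zero) (simp_all add: activity_eq[OF line])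
  moreover have "num_points \<gamma> ({\<sigma><..b} \<times> {0..K}) = 0"
    using plane_sets(3)[OF Times_bounded_plane[OF line', of K]] plane_sets[OF Times_bounded_plane[OF line]] z
    unfolding X by (intro \<gamma>.num_points_UN_zero) (simp_all add: activity_eq[OF line])
  moreover have "num_points \<delta> ({\<sigma><..b} \<times> {0..1}) = 0"
    using plane_sets(3)[OF Times_bounded_plane[OF line', of 1]] plane_sets[OF Times_bounded_plane[OF line]] z
    unfolding X by (intro \<delta>.num_points_UN_zero) (simp_all add: activity_eq[OF line])
  ultimately show ?thesis by (simp add: quiet_def activity_eq[OF line'])
qed (simp add: quiet_refl)

text \<open>Here \<sigma> is the supremum of the times up to which there are no points. If there were points both
  before and after a time, the interval would contain two. That nothing happens strictly before and
  strictly after \<sigma> is all that the integrals need; the process with a point at \<sigma> is never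
  identified.\<close>

lemma jump_time:
  assumes "0 \<le> a" "a < b" "activity c K {a<..b} \<le> 1"
  obtains \<sigma> where "a < \<sigma>" "\<sigma> \<le> b" "\<And>s. a \<le> s \<Longrightarrow> s < \<sigma> \<Longrightarrow> quiet a s" "quiet \<sigma> b"
proof -
  have dich: "quiet a s \<or> quiet s b" if "a \<le> s" "s \<le> b" for s
    using activity_split[of a s b K] that assms by (auto simp: quiet_def)
  define S where "S = {s \<in> {a..b}. quiet a s}"
  define \<sigma> where "\<sigma> = Sup S"
  have aS: "a \<in> S" using assms quiet_refl[of a a] by (simp add: S_def)
  have bdd: "bdd_above S" by (rule bdd_aboveI[of _ b]) (simp add: S_def)
  have "a \<le> \<sigma>" unfolding \<sigma>_def by (rule cSup_upper[OF aS bdd])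
  have "\<sigma> \<le> b" unfolding \<sigma>_def by (rule cSup_least) (use aS in \<open>auto simp: S_def\<close>)
  have before: "quiet a s" if as: "a \<le> s" and s\<sigma>: "s < \<sigma>" for s
  proof -
    obtain s' where "s' \<in> S" "s < s'" using s\<sigma> less_cSup_iff[OF _ bdd, of s] aS unfolding \<sigma>_def by blast
    then show ?thesis using quiet_mono[of a s' a s] assms(1) by (simp add: S_def)
  qed
  have after: "quiet \<sigma> b"
  proof (rule quiet_limit)
    show "0 \<le> \<sigma>" using \<open>a \<le> \<sigma>\<close> assms(1) by simp
    fix s assume s: "\<sigma> < s" "s < b"
    have "s \<notin> S" using cSup_upper[OF _ bdd, of s] s(1) by (auto simp: \<sigma>_def[symmetric])
    then show "quiet s b" using dich[of s] s \<open>a \<le> \<sigma>\<close> by (auto simp: S_def)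
  qed
  have "a \<noteq> \<sigma>"
  proof
    assume "a = \<sigma>"
    then have "b \<in> S" using after assms(2) by (simp add: S_def)
    then have "b \<le> \<sigma>" unfolding \<sigma>_def by (rule cSup_upper[OF _ bdd])
    then show False using \<open>a = \<sigma>\<close> assms(2) by simp
  qed
  then show ?thesis using that[of \<sigma>] \<open>a \<le> \<sigma>\<close> \<open>\<sigma> \<le> b\<close> before after by simp
qed

lemma quiet_counts:
  assumes "quiet a b" "0 \<le> a"
  shows "num_points \<alpha> {a<..b} = 0" "num_points \<beta> {a<..b} = 0" "num_points \<gamma> ({a<..b} \<times> {0..K}) = 0"
    "num_points \<delta> ({a<..b} \<times> {0..1}) = 0"
  using assms activity_eq[OF interval_bounded_line(1)[OF assms(2)], of K b] by (simp_all add: quiet_def)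

lemma quiet_AE:
  assumes "quiet a b" "0 \<le> a"
  shows "AE s in \<alpha>. s \<notin> {a<..b}" "AE s in \<beta>. s \<notin> {a<..b}" "AE q in \<gamma>. q \<notin> {a<..b} \<times> {0..K}"
proof -
  note l = interval_bounded_line(1)[OF assms(2), of b]
  show "AE s in \<alpha>. s \<notin> {a<..b}" by (rule \<alpha>.num_points_zero_AE[OF line_sets(1)[OF l] line_sets(3)[OF l] quiet_counts(1)[OF assms]])
  show "AE s in \<beta>. s \<notin> {a<..b}" by (rule \<beta>.num_points_zero_AE[OF line_sets(2)[OF l] line_sets(3)[OF l] quiet_counts(2)[OF assms]])
  show "AE q in \<gamma>. q \<notin> {a<..b} \<times> {0..K}"
    by (rule \<gamma>.num_points_zero_AE[OF plane_sets(1) plane_sets(3) quiet_counts(3)[OF assms]])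
      (rule Times_bounded_plane[OF l])+
qed

text \<open>The changes of the right-hand sides over A when the left limits have the value r there.\<close>

definition "increment1 A r = - real (fst r) * real (num_points \<alpha> A) - (if 0 < fst r then real (num_points \<beta> A) else 0)
   + real (num_points \<gamma> (A \<times> {0..real (snd r)}))" for A :: "real set" and r :: "nat \<times> nat"

definition "increment2 A r = - real (snd r) * real (num_points \<alpha> A) - real (num_points \<gamma> (A \<times> {0..real (snd r)}))
   + (if 0 < fst r then real (num_points \<beta> A) else 0) + real (num_points \<delta> (region_below p A))"
  for A :: "real set" and r :: "nat \<times> nat"

text \<open>Independently of the path: the two subtracted integrals are nonnegative, and the added ones count points
  of the processes with rate lam.\<close>

lemma rhs2_le_level:
  assumes u: "u \<in> measurable borel (count_space UNIV)" and t: "0 \<le> t" "t \<le> T"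
  shows "rhs2 \<alpha> \<beta> \<gamma> \<delta> p y u t \<le> K"
proof -
  have tl: "{0..t} \<in> bounded_line" "{0..T} \<in> bounded_line" by (simp_all add: interval_bounded_line)
  have sub: "{0..t} \<subseteq> {0..T}" using t by auto
  have 1: "(0::real) \<le> (LINT s:{0..t}|\<alpha>. real (snd (u s)))" unfolding set_lebesgue_integral_def
    by (rule Bochner_Integration.integral_nonneg) (simp add: indicator_def)
  have 2: "(0::real) \<le> (LINT q:{0..t} \<times> {0..}|\<gamma>. of_bool (0 \<le> snd q \<and> snd q \<le> real (snd (u (fst q)))))"
    unfolding set_lebesgue_integral_def
    by (rule Bochner_Integration.integral_nonneg) (simp add: indicator_def)
  have B: "{s \<in> {0..t}. 0 < fst (u s)} \<in> bounded_line"
  proof -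
    have "{s \<in> space borel. 0 < fst (u s)} \<in> sets borel"
      using measurable_sets[OF u, of "{v. 0 < fst v}"] by (simp add: vimage_def)
    then have "{0..t} \<inter> {s \<in> space borel. 0 < fst (u s)} \<in> sets borel" by (intro sets.Int) simp_all
    moreover have "{0..t} \<inter> {s \<in> space borel. 0 < fst (u s)} = {s \<in> {0..t}. 0 < fst (u s)}" by auto
    moreover have "bounded {s \<in> {0..t}. 0 < fst (u s)}" by (rule bounded_subset[of "{0..t}"]) auto
    ultimately show ?thesis by (auto simp: bounded_line_def)
  qed
  have "(LINT s:{0..t}|\<beta>. of_bool (0 < fst (u s))) = real (num_points \<beta> {s \<in> {0..t}. 0 < fst (u s)})"
    by (rule \<beta>.set_integral_indicator_region) (use line_sets[OF B] in auto)
  also have "num_points \<beta> {s \<in> {0..t}. 0 < fst (u s)} \<le> num_points \<beta> {0..T}"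
    by (rule \<beta>.num_points_mono) (use line_sets[OF B] line_sets[OF tl(2)] t in auto)
  also have "num_points \<beta> {0..T} = c (Lam_line {0..T})" using tl by (simp add: pattern_simps)
  finally have 3: "(LINT s:{0..t}|\<beta>. of_bool (0 < fst (u s))) \<le> real (c (Lam_line {0..T}))" by simp
  have D: "region_below p {0..t} \<in> bounded_plane" using p tl(1) p01(2) by (rule region_below_bounded_plane)
  have "(LINT q:{0..t} \<times> {0..}|\<delta>. of_bool (0 \<le> snd q \<and> snd q \<le> p (fst q))) = real (num_points \<delta> (region_below p {0..t}))"
    by (rule \<delta>.set_integral_indicator_region) (use plane_sets[OF D] in \<open>auto simp: region_below_def\<close>)
  also have "num_points \<delta> (region_below p {0..t}) \<le> num_points \<delta> ({0..T} \<times> {0..1})"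
    using plane_sets[OF D] plane_sets[OF Times_bounded_plane[OF tl(2), of 1]] sub p01
      region_below_subset[of "{0..t}" p 1]
    by (intro \<delta>.num_points_mono) auto
  also have "num_points \<delta> ({0..T} \<times> {0..1}) = c (Lam_plane ({0..T} \<times> {0..1}))"
    using Times_bounded_plane[OF tl(2)] by (simp add: pattern_simps)
  finally have 4: "(LINT q:{0..t} \<times> {0..}|\<delta>. of_bool (0 \<le> snd q \<and> snd q \<le> p (fst q))) \<le> real (c (Lam_plane ({0..T} \<times> {0..1})))"
    by simp
  show ?thesis using 1 2 3 4 unfolding rhs2_def level_def by simp
qed

text \<open>Up to null sets the processes charge (a,b] only up to \<sigma>, where the left limits are v, and points
  of the third process above the level K lie in neither region. So the integrands may be replaced by
  constants.\<close>

lemma rhs_increment_until: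
  assumes f: "f \<in> cadlag_paths T" and ab: "0 \<le> a" "b \<le> T" and t: "a \<le> t" "t \<le> b"
    and \<sigma>: "a \<le> \<sigma>" "\<sigma> \<le> b" "quiet \<sigma> b"
    and lim: "\<And>s. a < s \<Longrightarrow> s \<le> \<sigma> \<Longrightarrow> left_limit f s = v" and v_le: "real (snd v) \<le> K"
    and le: "\<And>s. 0 \<le> s \<Longrightarrow> s \<le> b \<Longrightarrow> real (snd (f s)) \<le> K"
  shows "rhs1 \<alpha> \<beta> \<gamma> x (left_limit f) t = rhs1 \<alpha> \<beta> \<gamma> x (left_limit f) a + increment1 {a<..t} v"
    and "rhs2 \<alpha> \<beta> \<gamma> \<delta> p y (left_limit f) t = rhs2 \<alpha> \<beta> \<gamma> \<delta> p y (left_limit f) a + increment2 {a<..t} v"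
proof -
  define u where "u = left_path T f"
  have um: "u \<in> measurable borel (count_space UNIV)" unfolding u_def by (rule left_path_measurable[OF f])
  have Gm: "(\<lambda>s. G (u s)) \<in> borel_measurable borel" for G :: "nat \<times> nat \<Rightarrow> real"
    by (rule measurable_compose[OF um]) simp
  obtain B where B: "\<And>s. real (fst (u s)) \<le> B" "\<And>s. real (snd (u s)) \<le> B"
    using left_path_bounded[OF f T, folded u_def] by blast
  have uv: "u s = v" if "a < s" "s \<le> \<sigma>" for s
    using lim[OF that] that ab \<sigma> by (simp add: u_def left_path_def)
  have u_le: "real (snd (u s)) \<le> K" if "s \<le> b" for s
  proof (cases "s \<in> {0..T}")
    case True
    show ?thesis
    proof (cases "s = 0")
      case True
      then show ?thesis using le[of 0] ab t T by (simp add: u_def left_path_def left_limit_def)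
    next
      case False
      with True have s: "0 < s" "s \<le> T" by auto
      obtain e where e: "e > 0" "e \<le> s" "\<And>r. s - e < r \<Longrightarrow> r < s \<Longrightarrow> f r = left_limit f s"
        using cadlag_left_limit[OF f s] by blast
      have "f (s - e / 2) = left_limit f s" by (rule e(3)) (use e in auto)
      moreover have "real (snd (f (s - e / 2))) \<le> K" by (rule le) (use e s that in auto)
      ultimately show ?thesis using s by (simp add: u_def left_path_def)
    qed
  next
    case False
    then have "u s = (0, 0)" by (simp only: u_def left_path_def if_False)
    then show ?thesis by simp
  qed
  note qa = quiet_AE[OF \<sigma>(3)]
  have \<sigma>0: "0 \<le> \<sigma>" using \<sigma>(1) ab(1) by simp
  have la: "{0..a} \<in> bounded_line" "{a<..t} \<in> bounded_line" "{0..t} \<in> bounded_line"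
    using ab by (simp_all add: interval_bounded_line)
  have un: "{0..t} = {0..a} \<union> {a<..t}" and dis: "{0..a} \<inter> {a<..t} = {}" using ab t by auto
  \<comment> \<open>Integrals over the two processes on the half line.\<close>
  have lineA: "(LINT s:{0..t}|\<alpha>. G (u s)) = (LINT s:{0..a}|\<alpha>. G (u s)) + G v * real (num_points \<alpha> {a<..t})"
    if G: "\<And>s. \<bar>G (u s)\<bar> \<le> C" for G :: "nat \<times> nat \<Rightarrow> real" and C
  proof -
    have "(LINT s:{0..t}|\<alpha>. G (u s)) = (LINT s:{0..a}|\<alpha>. G (u s)) + (LINT s:{a<..t}|\<alpha>. G (u s))"
      unfolding un by (rule \<alpha>.set_integral_split[OF Gm]) (use line_sets[OF la(1)] line_sets[OF la(2)] dis G in auto)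
    also have "(LINT s:{a<..t}|\<alpha>. G (u s)) = G v * real (num_points \<alpha> {a<..t})"
    proof (rule \<alpha>.set_integral_const_AE[OF Gm])
      show "AE s in \<alpha>. s \<in> {a<..t} \<longrightarrow> G (u s) = G v"
        using qa(1)[OF \<sigma>0] by (rule eventually_mono) (use uv t in force)
    qed (use line_sets[OF la(2)] in auto)
    finally show ?thesis .
  qed
  have lineB: "(LINT s:{0..t}|\<beta>. G (u s)) = (LINT s:{0..a}|\<beta>. G (u s)) + G v * real (num_points \<beta> {a<..t})"
    if G: "\<And>s. \<bar>G (u s)\<bar> \<le> C" for G :: "nat \<times> nat \<Rightarrow> real" and C
  proof -
    have "(LINT s:{0..t}|\<beta>. G (u s)) = (LINT s:{0..a}|\<beta>. G (u s)) + (LINT s:{a<..t}|\<beta>. G (u s))"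
      unfolding un by (rule \<beta>.set_integral_split[OF Gm]) (use line_sets[OF la(1)] line_sets[OF la(2)] dis G in auto)
    also have "(LINT s:{a<..t}|\<beta>. G (u s)) = G v * real (num_points \<beta> {a<..t})"
    proof (rule \<beta>.set_integral_const_AE[OF Gm])
      show "AE s in \<beta>. s \<in> {a<..t} \<longrightarrow> G (u s) = G v"
        using qa(2)[OF \<sigma>0] by (rule eventually_mono) (use uv t in force)
    qed (use line_sets[OF la(2)] in auto)
    finally show ?thesis .
  qed
  \<comment> \<open>Integrals over the two processes on the quadrant are numbers of points below a graph.\<close>
  have below_Un: "region_below U {0..t} = region_below U {0..a} \<union> region_below U {a<..t}"
    "region_below U {0..a} \<inter> region_below U {a<..t} = {}" for U
    using un dis by (auto simp: region_below_def)
  define U where "U s = real (snd (u s))" for s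
  have Um: "U \<in> borel_measurable borel" unfolding U_def by (rule Gm)
  have U_le: "U s \<le> K" if "s \<le> b" for s using u_le[OF that] by (simp add: U_def)
  have Ureg: "region_below U A \<in> bounded_plane" if "A \<in> bounded_line" for A
    using Um that B(2) unfolding U_def by (rule region_below_bounded_plane)
  have preg: "region_below p A \<in> bounded_plane" if "A \<in> bounded_line" for A
    using p that p01(2) by (rule region_below_bounded_plane)
  have planeG: "(LINT q:{0..t'} \<times> {0..}|\<gamma>. of_bool (0 \<le> snd q \<and> snd q \<le> real (snd (u (fst q))))) =
    real (num_points \<gamma> (region_below U {0..t'}))" if "{0..t'} \<in> bounded_line" for t'
    by (rule \<gamma>.set_integral_indicator_region)
      (use plane_sets[OF Ureg[OF that]] in \<open>auto simp: region_below_def U_def\<close>)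
  have planeD: "(LINT q:{0..t'} \<times> {0..}|\<delta>. of_bool (0 \<le> snd q \<and> snd q \<le> p (fst q))) =
    real (num_points \<delta> (region_below p {0..t'}))" if "{0..t'} \<in> bounded_line" for t'
    by (rule \<delta>.set_integral_indicator_region)
      (use plane_sets[OF preg[OF that]] in \<open>auto simp: region_below_def\<close>)
  have "num_points \<gamma> (region_below U {a<..t}) = num_points \<gamma> ({a<..t} \<times> {0..real (snd v)})"
  proof (rule \<gamma>.num_points_AE_cong)
    show "AE q in \<gamma>. q \<in> region_below U {a<..t} \<longleftrightarrow> q \<in> {a<..t} \<times> {0..real (snd v)}"
      using qa(3)[OF \<sigma>0]
    proof (rule eventually_mono)
      fix q :: "real \<times> real"
      assume q: "q \<notin> {\<sigma><..b} \<times> {0..K}"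
      show "q \<in> region_below U {a<..t} \<longleftrightarrow> q \<in> {a<..t} \<times> {0..real (snd v)}"
      proof (cases "fst q \<in> {a<..t} \<and> 0 \<le> snd q")
        case True
        show ?thesis
        proof (cases "snd q \<le> K")
          case False
          then have "\<not> snd q \<le> U (fst q)" "\<not> snd q \<le> real (snd v)"
            using U_le[of "fst q"] v_le True t by auto
          then show ?thesis by (simp add: region_below_def mem_Times_iff)
        next
          case le: True
          then have "fst q \<le> \<sigma>" using q True t by (auto simp: mem_Times_iff)
          then have "U (fst q) = real (snd v)" using uv[of "fst q"] True by (simp add: U_def)
          then show ?thesis using True by (simp add: region_below_def mem_Times_iff)
        qed
      qed (auto simp: region_below_def mem_Times_iff)
    qed
  qed (use plane_sets(1)[OF Ureg[OF la(2)]] plane_sets(1)[OF Times_bounded_plane[OF la(2)]] in auto)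
  moreover have "num_points \<gamma> (region_below U {0..t}) = num_points \<gamma> (region_below U {0..a}) + num_points \<gamma> (region_below U {a<..t})"
    unfolding below_Un(1) by (rule \<gamma>.num_points_Un)
      (use plane_sets[OF Ureg[OF la(1)]] plane_sets[OF Ureg[OF la(2)]] below_Un(2) in auto)
  ultimately have G: "num_points \<gamma> (region_below U {0..t}) = num_points \<gamma> (region_below U {0..a}) + num_points \<gamma> ({a<..t} \<times> {0..real (snd v)})"
    by simp
  have D: "num_points \<delta> (region_below p {0..t}) = num_points \<delta> (region_below p {0..a}) + num_points \<delta> (region_below p {a<..t})"
    unfolding below_Un(1) by (rule \<delta>.num_points_Un)
      (use plane_sets[OF preg[OF la(1)]] plane_sets[OF preg[OF la(2)]] below_Un(2) in auto)
  have cong: "rhs1 \<alpha> \<beta> \<gamma> x (left_limit f) t' = rhs1 \<alpha> \<beta> \<gamma> x u t'"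
    "rhs2 \<alpha> \<beta> \<gamma> \<delta> p y (left_limit f) t' = rhs2 \<alpha> \<beta> \<gamma> \<delta> p y u t'" if "t' \<le> T" for t'
    using that by (auto intro!: rhs_cong simp: u_def left_path_def)
  have A1: "(LINT s:{0..t}|\<alpha>. real (fst (u s))) = (LINT s:{0..a}|\<alpha>. real (fst (u s))) + real (fst v) * real (num_points \<alpha> {a<..t})"
    by (rule lineA[of "\<lambda>w. real (fst w)" B]) (use B(1) in simp)
  have A2: "(LINT s:{0..t}|\<alpha>. real (snd (u s))) = (LINT s:{0..a}|\<alpha>. real (snd (u s))) + real (snd v) * real (num_points \<alpha> {a<..t})"
    by (rule lineA[of "\<lambda>w. real (snd w)" B]) (use B(2) in simp)
  have BB: "(LINT s:{0..t}|\<beta>. of_bool (0 < fst (u s))) = (LINT s:{0..a}|\<beta>. of_bool (0 < fst (u s))) + (if 0 < fst v then real (num_points \<beta> {a<..t}) else 0)"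
    using lineB[of "\<lambda>w. of_bool (0 < fst w)" 1] by simp
  have tT: "t \<le> T" "a \<le> T" using t ab by auto
  show "rhs1 \<alpha> \<beta> \<gamma> x (left_limit f) t = rhs1 \<alpha> \<beta> \<gamma> x (left_limit f) a + increment1 {a<..t} v"
    unfolding cong(1)[OF tT(1)] cong(1)[OF tT(2)] unfolding rhs1_def planeG[OF la(1)] planeG[OF la(3)] A1 BB G increment1_def by simp
  show "rhs2 \<alpha> \<beta> \<gamma> \<delta> p y (left_limit f) t = rhs2 \<alpha> \<beta> \<gamma> \<delta> p y (left_limit f) a + increment2 {a<..t} v"
    unfolding cong(2)[OF tT(1)] cong(2)[OF tT(2)] unfolding rhs2_def planeG[OF la(1)] planeG[OF la(3)]
      planeD[OF la(1)] planeD[OF la(3)] A2 BB G D increment2_def by simp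
qed

text \<open>A path that stays at v as long as there are no points has left limit v up to and including the time of
  the first point.\<close>

lemma rhs_increment:
  assumes f: "f \<in> cadlag_paths T" and ab: "0 \<le> a" "a < b" "b \<le> T" and t: "a \<le> t" "t \<le> b"
    and one: "activity c K {a<..b} \<le> 1"
    and H: "\<And>s. a \<le> s \<Longrightarrow> s \<le> b \<Longrightarrow> quiet a s \<Longrightarrow> f s = v"
    and le: "\<And>s. 0 \<le> s \<Longrightarrow> s \<le> b \<Longrightarrow> real (snd (f s)) \<le> K"
  shows "rhs1 \<alpha> \<beta> \<gamma> x (left_limit f) t = rhs1 \<alpha> \<beta> \<gamma> x (left_limit f) a + increment1 {a<..t} v"
    and "rhs2 \<alpha> \<beta> \<gamma> \<delta> p y (left_limit f) t = rhs2 \<alpha> \<beta> \<gamma> \<delta> p y (left_limit f) a + increment2 {a<..t} v"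
proof -
  obtain \<sigma> where \<sigma>: "a < \<sigma>" "\<sigma> \<le> b" "\<And>s. a \<le> s \<Longrightarrow> s < \<sigma> \<Longrightarrow> quiet a s" "quiet \<sigma> b"
    using jump_time[OF ab(1,2) one] by blast
  have lim: "left_limit f s = v" if "a < s" "s \<le> \<sigma>" for s
    by (rule left_limit_eqI[OF ab(1) that(1)]) (use that H \<sigma> in auto)
  have v_le: "real (snd v) \<le> K" using le[of a] H[of a] quiet_refl[of a a] ab by simp
  have \<sigma>': "a \<le> \<sigma>" using \<sigma>(1) by simp
  show "rhs1 \<alpha> \<beta> \<gamma> x (left_limit f) t = rhs1 \<alpha> \<beta> \<gamma> x (left_limit f) a + increment1 {a<..t} v"
    by (rule rhs_increment_until(1)[OF f ab(1,3) t \<sigma>' \<sigma>(2,4) lim v_le le])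
  show "rhs2 \<alpha> \<beta> \<gamma> \<delta> p y (left_limit f) t = rhs2 \<alpha> \<beta> \<gamma> \<delta> p y (left_limit f) a + increment2 {a<..t} v"
    by (rule rhs_increment_until(2)[OF f ab(1,3) t \<sigma>' \<sigma>(2,4) lim v_le le])
qed

lemma increment_quiet:
  assumes "quiet a s" "0 \<le> a" "real (snd v) \<le> K"
  shows "increment1 {a<..s} v = 0" "increment2 {a<..s} v = 0"
proof -
  note l = interval_bounded_line(1)[OF assms(2), of s]
  note z = quiet_counts[OF assms(1,2)]
  have "num_points \<gamma> ({a<..s} \<times> {0..real (snd v)}) \<le> num_points \<gamma> ({a<..s} \<times> {0..K})"
    by (rule \<gamma>.num_points_mono) (use plane_sets[OF Times_bounded_plane[OF l]] assms(3) in auto)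
  moreover have "num_points \<delta> (region_below p {a<..s}) \<le> num_points \<delta> ({a<..s} \<times> {0..1})"
    by (rule \<delta>.num_points_mono)
      (use plane_sets[OF Times_bounded_plane[OF l]] plane_sets[OF region_below_bounded_plane[OF p l p01(2)]]
        region_below_subset[of "{a<..s}" p 1] p01 in auto)
  ultimately show "increment1 {a<..s} v = 0" "increment2 {a<..s} v = 0"
    using z by (simp_all add: increment1_def increment2_def)
qed

lemma rhs_quiet:
  assumes f: "f \<in> cadlag_paths T" and ab: "0 \<le> a" "a \<le> s" "s \<le> T" and q: "quiet a s"
    and le: "\<And>r. 0 \<le> r \<Longrightarrow> r \<le> s \<Longrightarrow> real (snd (f r)) \<le> K"
  shows "rhs1 \<alpha> \<beta> \<gamma> x (left_limit f) s = rhs1 \<alpha> \<beta> \<gamma> x (left_limit f) a"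
    and "rhs2 \<alpha> \<beta> \<gamma> \<delta> p y (left_limit f) s = rhs2 \<alpha> \<beta> \<gamma> \<delta> p y (left_limit f) a"
proof -
  have "left_limit f r = (0, 0)" if "a < r" "r \<le> a" for r using that by simp
  \<comment> \<open>The previous lemma with \<open>\<sigma> = a\<close>, where the condition on left limits is void and any value v serves.\<close>
  note u = rhs_increment_until[OF f ab(1,3,2) order_refl order_refl ab(2) q this _ le]
  show "rhs1 \<alpha> \<beta> \<gamma> x (left_limit f) s = rhs1 \<alpha> \<beta> \<gamma> x (left_limit f) a"
    using u(1)[of x] increment_quiet(1)[OF q ab(1), of "(0, 0)"] by simp
  show "rhs2 \<alpha> \<beta> \<gamma> \<delta> p y (left_limit f) s = rhs2 \<alpha> \<beta> \<gamma> \<delta> p y (left_limit f) a"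
    using u(2) increment_quiet(2)[OF q ab(1), of "(0, 0)"] by simp
qed

section \<open>The path built cell by cell\<close>

lemma step_empty: "step p c {} r = r"
proof -
  have e: "{} \<in> bounded_line" "{} \<in> bounded_plane" by (simp_all add: bounded_line_def bounded_plane_def)
  have "region_below p {} = {}" by (simp add: region_below_def)
  then show ?thesis using e by (cases r) (simp add: step_def pattern_simps)
qed

lemma step_counts:
  assumes "A \<in> bounded_line"
  shows "step p c A r = (fst r + num_points \<gamma> (A \<times> {0..real (snd r)}) - fst r * num_points \<alpha> A - (if 0 < fst r then num_points \<beta> A else 0),
    snd r + (if 0 < fst r then num_points \<beta> A else 0) + num_points \<delta> (region_below p A) - snd r * num_points \<alpha> A - num_points \<gamma> (A \<times> {0..real (snd r)}))"
  using assms Times_bounded_plane[OF assms] region_below_bounded_plane[OF p assms p01(2)]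
  by (simp add: step_def pattern_simps Let_def)

text \<open>With at most one relevant point in A the truncated subtractions of a step are exact, once points of the third
  process at height 0 are excluded, which would act on a second component equal to 0.\<close>

lemma step_increment:
  assumes A: "A \<in> bounded_line" and one: "activity c K A \<le> 1" and r: "real (snd r) \<le> K"
    and axis: "num_points \<gamma> (A \<times> {0..0}) = 0"
  shows "real (fst (step p c A r)) = real (fst r) + increment1 A r"
    and "real (snd (step p c A r)) = real (snd r) + increment2 A r"
proof -
  define i j k l where "i = num_points \<alpha> A" and "j = (if 0 < fst r then num_points \<beta> A else 0)"
    and "k = num_points \<gamma> (A \<times> {0..real (snd r)})" and "l = num_points \<delta> (region_below p A)"
  have "k \<le> num_points \<gamma> (A \<times> {0..K})" unfolding k_def
    by (rule \<gamma>.num_points_mono) (use plane_sets[OF Times_bounded_plane[OF A]] r in auto)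
  moreover have "l \<le> num_points \<delta> (A \<times> {0..1})" unfolding l_def
    by (rule \<delta>.num_points_mono)
      (use plane_sets[OF Times_bounded_plane[OF A]] plane_sets[OF region_below_bounded_plane[OF p A p01(2)]]
        region_below_subset[of A p 1] p01 in auto)
  moreover have "j \<le> num_points \<beta> A" by (simp add: j_def)
  ultimately have sum: "i + j + k + l \<le> 1" using one unfolding activity_eq[OF A] i_def by simp
  have j0: "fst r = 0 \<Longrightarrow> j = 0" by (simp add: j_def)
  have k0: "snd r = 0 \<Longrightarrow> k = 0" using axis by (simp add: k_def)
  have jr: "(if 0 < fst r then real (num_points \<beta> A) else 0) = real j" by (simp add: j_def)
  have st: "step p c A r = (fst r + k - fst r * i - j, snd r + j + l - snd r * i - k)"
    unfolding step_counts[OF A] i_def j_def k_def l_def ..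
  have i1: "i = 0 \<or> i = 1" using sum by auto
  have ge1: "fst r * i + j \<le> fst r + k"
  proof (cases "i = 0")
    case True
    then show ?thesis using sum j0 by (cases "fst r = 0") auto
  next
    case False
    then have "i = 1" using i1 by blast
    moreover have "j + k + l = 0" using sum \<open>i = 1\<close> by simp
    ultimately show ?thesis by simp
  qed
  have ge2: "snd r * i + k \<le> snd r + j + l"
  proof (cases "i = 0")
    case True
    then show ?thesis using sum k0 by (cases "snd r = 0") auto
  next
    case False
    then have "i = 1" using i1 by blast
    moreover have "j + k + l = 0" using sum \<open>i = 1\<close> by simp
    ultimately show ?thesis by simp
  qed
  have "real (fst r + k - fst r * i - j) = real (fst r + k) - real (fst r * i + j)"
    using of_nat_diff[OF ge1, where ?'a = real] by (simp only: diff_diff_left)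
  then show "real (fst (step p c A r)) = real (fst r) + increment1 A r"
    unfolding st increment1_def jr i_def[symmetric] k_def[symmetric] by simp
  have "real (snd r + j + l - snd r * i - k) = real (snd r + j + l) - real (snd r * i + k)"
    using of_nat_diff[OF ge2, where ?'a = real] by (simp only: diff_diff_left)
  then show "real (snd (step p c A r)) = real (snd r) + increment2 A r"
    unfolding st increment2_def jr i_def[symmetric] k_def[symmetric] l_def[symmetric] by simp
qed

lemma step_snd_le:
  assumes "A \<in> bounded_line"
  shows "snd (step p c A r) \<le> snd r + num_points \<beta> A + num_points \<delta> (A \<times> {0..1})"
proof -
  have "num_points \<delta> (region_below p A) \<le> num_points \<delta> (A \<times> {0..1})"
    by (rule \<delta>.num_points_mono)
      (use plane_sets[OF Times_bounded_plane[OF assms]] plane_sets[OF region_below_bounded_plane[OF p assms p01(2)]]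
        region_below_subset[of A p 1] p01 in auto)
  moreover have "snd (step p c A r) \<le> snd r + (if 0 < fst r then num_points \<beta> A else 0) + num_points \<delta> (region_below p A)"
    unfolding step_counts[OF assms] snd_conv by (rule order_trans[OF diff_le_self diff_le_self])
  moreover have "(if 0 < fst r then num_points \<beta> A else 0) \<le> num_points \<beta> A" by simp
  ultimately show ?thesis by linarith
qed

lemma grid_state_stable:
  assumes "t \<le> grid_point T n k" "k \<le> m"
  shows "grid_state p c T n z t m = grid_state p c T n z t k"
  using assms(2)
proof (induction m rule: dec_induct)
  case (step m)
  have "grid_point T n k \<le> grid_point T n m" using T step(1) by (intro grid_point_mono) auto
  then have "cell T n m t = {}" using assms(1) by (simp add: cell_def)
  then show ?case using step by (simp add: step_empty)
qed simp

lemma grid_state_agree: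
  assumes "grid_point T n k \<le> t" "grid_point T n k \<le> t'"
  shows "grid_state p c T n z t k = grid_state p c T n z t' k"
  using assms
proof (induction k)
  case (Suc k)
  have "grid_point T n k \<le> grid_point T n (Suc k)" using T by (intro grid_point_mono) auto
  then have "grid_state p c T n z t k = grid_state p c T n z t' k" using Suc by auto
  moreover have "cell T n k t = cell T n k t'" using Suc.prems by (simp add: cell_def)
  ultimately show ?case by simp
qed simp

lemma grid_path_0: "0 < n \<Longrightarrow> grid_path p c T n z 0 = z"
  using grid_state_stable[of 0 n 0 n z] T by (simp add: grid_path_def)

lemma grid_path_step:
  assumes k: "k < n" and t: "grid_point T n k \<le> t" "t \<le> grid_point T n (Suc k)"
  shows "grid_path p c T n z t = step p c {grid_point T n k<..t} (grid_path p c T n z (grid_point T n k))"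
proof -
  have g: "0 \<le> grid_point T n k" "grid_point T n (Suc k) \<le> T" "grid_point T n k \<le> T"
    using grid_point_bounds[of T k n] grid_point_bounds[of T "Suc k" n] T k by auto
  have "grid_path p c T n z t = grid_state p c T n z t (Suc k)"
    using grid_state_stable[OF t(2), of n z] k t g by (simp add: grid_path_def)
  also have "\<dots> = step p c {grid_point T n k<..t} (grid_state p c T n z t k)"
    using t(2) by (simp add: cell_def)
  also have "grid_state p c T n z t k = grid_state p c T n z (grid_point T n k) k"
    by (rule grid_state_agree) (use t in auto)
  also have "\<dots> = grid_path p c T n z (grid_point T n k)"
    using grid_state_stable[OF order_refl, of k n n z] k g by (simp add: grid_path_def)
  finally show ?thesis .
qed

text \<open>The bound telescopes over the cells, since a step raises the second component by at most the number of
  points of the processes with rate lam.\<close>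

lemma grid_path_le:
  assumes n: "0 < n" and t: "0 \<le> t" "t \<le> T"
  shows "real (snd (grid_path p c T n (x, y) t)) \<le> K"
proof -
  let ?L = "\<lambda>t. num_points \<beta> {0<..t} + num_points \<delta> ({0<..t} \<times> {0..1})"
  let ?f = "grid_path p c T n (x, y)"
  have add: "?L a + (num_points \<beta> {a<..b} + num_points \<delta> ({a<..b} \<times> {0..1})) = ?L b"
    if "0 \<le> a" "a \<le> b" for a b
  proof -
    have l: "{0<..a} \<in> bounded_line" "{a<..b} \<in> bounded_line" using that by (simp_all add: interval_bounded_line)
    have u: "{0<..b} = {0<..a} \<union> {a<..b}" using that by auto
    have "num_points \<beta> {0<..b} = num_points \<beta> {0<..a} + num_points \<beta> {a<..b}"
      unfolding u by (rule \<beta>.num_points_Un) (use line_sets[OF l(1)] line_sets[OF l(2)] in auto)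
    moreover have "num_points \<delta> ({0<..b} \<times> {0..1}) = num_points \<delta> ({0<..a} \<times> {0..1}) + num_points \<delta> ({a<..b} \<times> {0..1})"
      unfolding u Sigma_Un_distrib1
      by (rule \<delta>.num_points_Un) (use plane_sets[OF Times_bounded_plane[OF l(1)]] plane_sets[OF Times_bounded_plane[OF l(2)]] in auto)
    ultimately show ?thesis by simp
  qed
  have cell_bound: "snd (?f t) \<le> y + ?L t"
    if k: "k < n" and t: "grid_point T n k \<le> t" "t \<le> grid_point T n (Suc k)"
      and IH: "snd (?f (grid_point T n k)) \<le> y + ?L (grid_point T n k)" for k t
  proof -
    have g: "0 \<le> grid_point T n k" using grid_point_bounds[of T k n] T k by auto
    have "snd (?f t) \<le> snd (?f (grid_point T n k)) + num_points \<beta> {grid_point T n k<..t} + num_points \<delta> ({grid_point T n k<..t} \<times> {0..1})"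
      unfolding grid_path_step[OF k t] by (rule step_snd_le) (rule interval_bounded_line(1)[OF g])
    then show ?thesis using IH add[OF g t(1)] by linarith
  qed
  have grid: "snd (?f (grid_point T n k)) \<le> y + ?L (grid_point T n k)" if "k \<le> n" for k
    using that
  proof (induction k)
    case 0
    then show ?case using grid_path_0[OF n] by simp
  next
    case (Suc k)
    have le: "grid_point T n k \<le> grid_point T n (Suc k)" using T by (intro grid_point_mono) simp_all
    show ?case by (rule cell_bound[of k, OF _ le order_refl]) (use Suc in simp_all)
  qed
  have "snd (?f t) \<le> y + ?L t"
  proof (cases "t = 0")
    case True
    then show ?thesis using grid_path_0[OF n] by simp
  next
    case False
    then obtain k where k: "k < n" "grid_point T n k < t" "t \<le> grid_point T n (Suc k)"
      using grid_cell_exists[of n t T] n t by auto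
    show ?thesis by (rule cell_bound[OF k(1) less_imp_le[OF k(2)] k(3) grid]) (use k in simp)
  qed
  also have "\<dots> \<le> level c T y"
  proof -
    have l: "{0<..t} \<in> bounded_line" "{0..T} \<in> bounded_line" by (simp_all add: interval_bounded_line)
    have "num_points \<beta> {0<..t} \<le> num_points \<beta> {0..T}"
      by (rule \<beta>.num_points_mono) (use line_sets[OF l(1)] line_sets[OF l(2)] t in auto)
    moreover have "num_points \<delta> ({0<..t} \<times> {0..1}) \<le> num_points \<delta> ({0..T} \<times> {0..1})"
      by (rule \<delta>.num_points_mono)
        (use plane_sets[OF Times_bounded_plane[OF l(1)]] plane_sets[OF Times_bounded_plane[OF l(2)]] t in auto)
    ultimately show ?thesis using l Times_bounded_plane[OF l(2)] by (simp add: level_def pattern_simps)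
  qed
  finally show ?thesis by simp
qed

context
  fixes n :: nat and x :: nat
  assumes sp: "sparse_grid c T K n"
begin

abbreviation "g \<equiv> grid_point T n"
abbreviation "F \<equiv> grid_path p c T n (x, y)"

lemma n_pos: "0 < n" using sp by (simp add: sparse_grid_def)

lemma g_bounds: "k < n \<Longrightarrow> 0 \<le> g k \<and> g k < g (Suc k) \<and> g (Suc k) \<le> T"
  using grid_point_bounds[of T k n] grid_point_bounds[of T "Suc k" n] grid_point_less_Suc[of T n k] T n_pos by auto

lemma cell_sparse:
  assumes "k < n" "t \<le> g (Suc k)"
  shows "activity c K {g k<..t} \<le> 1"
proof (cases "g k \<le> t")
  case True
  have "cell T n k T = {g k<..g (Suc k)}" using g_bounds[OF assms(1)] by (simp add: cell_def)
  then have "activity c K {g k<..g (Suc k)} \<le> 1" using sp assms(1) by (auto simp: sparse_grid_def)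
  then show ?thesis using activity_split[of "g k" t "g (Suc k)" K] g_bounds[OF assms(1)] assms(2) True by simp
next
  case False
  then have "quiet (g k) t" by (intro quiet_refl) simp
  then show ?thesis by (simp add: quiet_def)
qed

lemma no_axis_points:
  assumes "0 \<le> a" "t \<le> T"
  shows "num_points \<gamma> ({a<..t} \<times> {0..0}) = 0"
proof -
  have l: "{a<..t} \<in> bounded_line" "{0..T} \<in> bounded_line" using assms by (simp_all add: interval_bounded_line)
  have "num_points \<gamma> ({a<..t} \<times> {0..0}) \<le> num_points \<gamma> ({0..T} \<times> {0..0})"
    by (rule \<gamma>.num_points_mono[OF plane_sets(1)[OF Times_bounded_plane[OF l(1)]]
          plane_sets(1)[OF Times_bounded_plane[OF l(2)]] plane_sets(3)[OF Times_bounded_plane[OF l(2)]]])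
      (use assms in auto)
  moreover have "num_points \<gamma> ({0..T} \<times> {0..0}) = 0"
    using sp unfolding sparse_grid_def pattern_simps(3)[OF Times_bounded_plane[OF l(2)]] by blast
  ultimately show ?thesis by simp
qed

lemma F_increment:
  assumes k: "k < n" and t: "g k \<le> t" "t \<le> g (Suc k)"
  shows "real (fst (F t)) = real (fst (F (g k))) + increment1 {g k<..t} (F (g k))"
    and "real (snd (F t)) = real (snd (F (g k))) + increment2 {g k<..t} (F (g k))"
proof -
  have b: "0 \<le> g k" "t \<le> T" "g k \<le> T" using g_bounds[OF k] t by auto
  note st = step_increment[OF interval_bounded_line(1)[OF b(1)] cell_sparse[OF k t(2)] grid_path_le[OF n_pos b(1,3)] no_axis_points[OF b(1,2)]]
  show "real (fst (F t)) = real (fst (F (g k))) + increment1 {g k<..t} (F (g k))"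
    "real (snd (F t)) = real (snd (F (g k))) + increment2 {g k<..t} (F (g k))"
    unfolding grid_path_step[OF k t] by (rule st)+
qed

lemma F_quiet:
  assumes k: "k < n" and t: "g k \<le> t" "t \<le> g (Suc k)" and q: "quiet (g k) t"
  shows "F t = F (g k)"
proof -
  have b: "0 \<le> g k" "g k \<le> T" using g_bounds[OF k] t by auto
  show ?thesis
    using F_increment[OF k t] increment_quiet[OF q b(1) grid_path_le[OF n_pos b]] by (simp add: prod_eq_iff)
qed

lemma step_quiet_cong:
  assumes q: "quiet s t" and a: "0 \<le> a" "a \<le> s" "s \<le> t" and r: "real (snd r) \<le> K"
  shows "step p c {a<..t} r = step p c {a<..s} r"
proof -
  have u: "{a<..t} = {a<..s} \<union> {s<..t}" and d: "{a<..s} \<inter> {s<..t} = {}" using a by auto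
  have l: "{a<..s} \<in> bounded_line" "{s<..t} \<in> bounded_line" "{a<..t} \<in> bounded_line"
    using a by (simp_all add: interval_bounded_line)
  have s0: "0 \<le> s" using a by simp
  note z = quiet_counts[OF q s0]
  have rb: "region_below p {a<..t} = region_below p {a<..s} \<union> region_below p {s<..t}"
    "region_below p {a<..s} \<inter> region_below p {s<..t} = {}" using u d by (auto simp: region_below_def)
  note pl = plane_sets[OF region_below_bounded_plane[OF p l(1) p01(2)]] plane_sets[OF region_below_bounded_plane[OF p l(2) p01(2)]]
  have "num_points \<delta> (region_below p {s<..t}) \<le> num_points \<delta> ({s<..t} \<times> {0..1})"
    by (rule \<delta>.num_points_mono)
      (use plane_sets[OF Times_bounded_plane[OF l(2)]] pl region_below_subset[of "{s<..t}" p 1] p01 in auto)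
  moreover have "num_points \<gamma> ({s<..t} \<times> {0..real (snd r)}) \<le> num_points \<gamma> ({s<..t} \<times> {0..K})"
    by (rule \<gamma>.num_points_mono) (use plane_sets[OF Times_bounded_plane[OF l(2)]] r in auto)
  moreover have "num_points \<alpha> {a<..t} = num_points \<alpha> {a<..s} + num_points \<alpha> {s<..t}"
    unfolding u by (rule \<alpha>.num_points_Un) (use line_sets[OF l(1)] line_sets[OF l(2)] d in auto)
  moreover have "num_points \<beta> {a<..t} = num_points \<beta> {a<..s} + num_points \<beta> {s<..t}"
    unfolding u by (rule \<beta>.num_points_Un) (use line_sets[OF l(1)] line_sets[OF l(2)] d in auto)
  moreover have "num_points \<gamma> ({a<..t} \<times> X) = num_points \<gamma> ({a<..s} \<times> X) + num_points \<gamma> ({s<..t} \<times> X)"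
    if X: "X = {0..real (snd r)}" for X
  proof -
    have "({a<..s} \<times> X) \<inter> ({s<..t} \<times> X) = {}" using d by blast
    then show ?thesis unfolding u Sigma_Un_distrib1 unfolding X
      using plane_sets[OF Times_bounded_plane[OF l(1)]] plane_sets[OF Times_bounded_plane[OF l(2)]]
      by (intro \<gamma>.num_points_Un)
  qed
  moreover have "num_points \<delta> (region_below p {a<..t}) = num_points \<delta> (region_below p {a<..s}) + num_points \<delta> (region_below p {s<..t})"
    unfolding rb(1) by (rule \<delta>.num_points_Un[OF pl(2) pl(5) pl(3) pl(6) rb(2)])
  ultimately show ?thesis unfolding step_counts[OF l(3)] step_counts[OF l(1)] using z by simp
qed

text \<open>By the choice of \<sigma>, the counts for (g k, s] that enter a step do not change as s varies on one
  side of \<sigma>.\<close>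

lemma F_cell_shape:
  assumes k: "k < n"
  obtains \<sigma> where "g k < \<sigma>" "\<sigma> \<le> g (Suc k)" "\<And>s. g k \<le> s \<Longrightarrow> s < \<sigma> \<Longrightarrow> F s = F (g k)"
    "\<And>s. \<sigma> \<le> s \<Longrightarrow> s \<le> g (Suc k) \<Longrightarrow> F s = F \<sigma>"
proof -
  have b: "0 \<le> g k" "g k < g (Suc k)" "g (Suc k) \<le> T" "g k \<le> T" using g_bounds[OF k] by auto
  obtain \<sigma> where \<sigma>: "g k < \<sigma>" "\<sigma> \<le> g (Suc k)" "\<And>s. g k \<le> s \<Longrightarrow> s < \<sigma> \<Longrightarrow> quiet (g k) s" "quiet \<sigma> (g (Suc k))"
    using jump_time[OF b(1,2) cell_sparse[OF k order_refl]] by blast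
  show ?thesis
  proof (rule that[OF \<sigma>(1,2)])
    show "F s = F (g k)" if "g k \<le> s" "s < \<sigma>" for s
      by (rule F_quiet[OF k that(1)]) (use that \<sigma> in auto)
    show "F s = F \<sigma>" if s: "\<sigma> \<le> s" "s \<le> g (Suc k)" for s
    proof -
      have gs: "g k \<le> s" "g k \<le> \<sigma>" using \<sigma> s by auto
      have "quiet \<sigma> s" by (rule quiet_mono[OF \<sigma>(4)]) (use b \<sigma> s in auto)
      then show ?thesis
        unfolding grid_path_step[OF k gs(1) s(2)] grid_path_step[OF k gs(2) \<sigma>(2)]
        by (rule step_quiet_cong[OF _ b(1) gs(2) s(1) grid_path_le[OF n_pos b(1,4)]])
    qed
  qed
qed

lemma F_cadlag: "F \<in> cadlag_paths T"
proof (rule cadlag_pathsI)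
  show "F \<in> extensional {0..T}" by (simp add: grid_path_def)
  fix t assume t: "0 \<le> t" "t < T"
  obtain k where k: "k < n" "g k \<le> t" "t < g (Suc k)" using grid_cell_exists'[OF n_pos t] by blast
  obtain \<sigma> where \<sigma>: "g k < \<sigma>" "\<sigma> \<le> g (Suc k)" "\<And>s. g k \<le> s \<Longrightarrow> s < \<sigma> \<Longrightarrow> F s = F (g k)"
    "\<And>s. \<sigma> \<le> s \<Longrightarrow> s \<le> g (Suc k) \<Longrightarrow> F s = F \<sigma>"
    using F_cell_shape[OF k(1)] by blast
  show "\<exists>b>t. \<forall>s. t < s \<and> s < b \<longrightarrow> F s = F t"
  proof (cases "t < \<sigma>")
    case True
    have "F s = F t" if "t < s" "s < \<sigma>" for s
    proof -
      have "F s = F (g k)" by (rule \<sigma>(3)) (use that k in linarith)+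
      moreover have "F t = F (g k)" by (rule \<sigma>(3)) (use True k in linarith)+
      ultimately show ?thesis by simp
    qed
    then show ?thesis using True by blast
  next
    case False
    have "F s = F t" if "t < s" "s < g (Suc k)" for s
    proof -
      have "F s = F \<sigma>" by (rule \<sigma>(4)) (use that k False in linarith)+
      moreover have "F t = F \<sigma>" by (rule \<sigma>(4)) (use False k in linarith)+
      ultimately show ?thesis by simp
    qed
    then show ?thesis using k(3) by blast
  qed
next
  fix t assume t: "0 < t" "t \<le> T"
  obtain k where k: "k < n" "g k < t" "t \<le> g (Suc k)" using grid_cell_exists[OF n_pos t] by blast
  obtain \<sigma> where \<sigma>: "g k < \<sigma>" "\<sigma> \<le> g (Suc k)" "\<And>s. g k \<le> s \<Longrightarrow> s < \<sigma> \<Longrightarrow> F s = F (g k)"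
    "\<And>s. \<sigma> \<le> s \<Longrightarrow> s \<le> g (Suc k) \<Longrightarrow> F s = F \<sigma>"
    using F_cell_shape[OF k(1)] by blast
  show "\<exists>a<t. \<exists>l. \<forall>s. a < s \<and> s < t \<longrightarrow> F s = l"
  proof (cases "t \<le> \<sigma>")
    case True
    have "\<forall>s. g k < s \<and> s < t \<longrightarrow> F s = F (g k)"
      by (intro allI impI \<sigma>(3)) (use True in linarith)+
    then show ?thesis using k(2) by blast
  next
    case False
    have "\<forall>s. \<sigma> < s \<and> s < t \<longrightarrow> F s = F \<sigma>"
      by (intro allI impI \<sigma>(4)) (use k(3) in linarith)+
    then show ?thesis using False by (meson not_le)
  qed
qed

lemma rhs_0:
  assumes f: "f \<in> cadlag_paths T" and le: "real (snd (f 0)) \<le> K"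
  shows "rhs1 \<alpha> \<beta> \<gamma> x (left_limit f) 0 = real x" "rhs2 \<alpha> \<beta> \<gamma> \<delta> p y (left_limit f) 0 = real y"
proof -
  have l: "{0::real} \<in> bounded_line" by (simp add: bounded_line_def)
  have "activity c K {0} = 0" using sp by (simp add: sparse_grid_def)
  then have z: "num_points \<alpha> {0} = 0" "num_points \<beta> {0} = 0" "num_points \<gamma> ({0} \<times> {0..K}) = 0"
    "num_points \<delta> ({0} \<times> {0..1}) = 0"
    by (simp_all add: activity_eq[OF l])
  note pl = plane_sets[OF Times_bounded_plane[OF l]]
  have AE: "AE s in \<alpha>. s \<notin> {0}" "AE s in \<beta>. s \<notin> {0}" "AE q in \<gamma>. q \<notin> {0} \<times> {0..K}" "AE q in \<delta>. q \<notin> {0} \<times> {0..1}"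
    using \<alpha>.num_points_zero_AE[OF line_sets(1)[OF l] line_sets(3)[OF l] z(1)]
      \<beta>.num_points_zero_AE[OF line_sets(2)[OF l] line_sets(3)[OF l] z(2)]
      \<gamma>.num_points_zero_AE[OF pl(1) pl(3) z(3)] \<delta>.num_points_zero_AE[OF pl(2) pl(3) z(4)] by blast+
  have f0: "left_limit f 0 = f 0" by (simp add: left_limit_def)
  have 1: "(LINT s:{0..0}|\<alpha>. G s) = 0" "(LINT s:{0..0}|\<beta>. G s) = 0" for G :: "real \<Rightarrow> real"
    unfolding set_lebesgue_integral_def
    by (rule integral_eq_zero_AE, rule eventually_mono[OF AE(1)], simp add: indicator_def)
      (rule integral_eq_zero_AE, rule eventually_mono[OF AE(2)], simp add: indicator_def)
  have 2: "(LINT q:{0..0} \<times> {0..}|\<gamma>. of_bool (0 \<le> snd q \<and> snd q \<le> real (snd (left_limit f (fst q))))) = (0::real)"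
    unfolding set_lebesgue_integral_def
  proof (rule integral_eq_zero_AE)
    show "AE q in \<gamma>. indicator ({0..0} \<times> {0..}) q *\<^sub>R of_bool (0 \<le> snd q \<and> snd q \<le> real (snd (left_limit f (fst q)))) = (0::real)"
      using AE(3) by (rule eventually_mono) (use le f0 in \<open>auto simp: indicator_def mem_Times_iff\<close>)
  qed
  have 3: "(LINT q:{0..0} \<times> {0..}|\<delta>. of_bool (0 \<le> snd q \<and> snd q \<le> p (fst q))) = (0::real)"
    unfolding set_lebesgue_integral_def
  proof (rule integral_eq_zero_AE)
    show "AE q in \<delta>. indicator ({0..0} \<times> {0..}) q *\<^sub>R of_bool (0 \<le> snd q \<and> snd q \<le> p (fst q)) = (0::real)"
      using AE(4) by (rule eventually_mono) (use p01(2)[of 0] in \<open>auto simp: indicator_def mem_Times_iff\<close>)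
  qed
  show "rhs1 \<alpha> \<beta> \<gamma> x (left_limit f) 0 = real x" unfolding rhs1_def 1 2 by simp
  show "rhs2 \<alpha> \<beta> \<gamma> \<delta> p y (left_limit f) 0 = real y" unfolding rhs2_def 1 2 3 by simp
qed

text \<open>On each cell the increments of the right-hand sides, evaluated along the path, are the increments of a
  step.\<close>

lemma grid_path_solves: "solves_equations \<alpha> \<beta> \<gamma> \<delta> T p x y F"
proof -
  let ?E = "\<lambda>t. real (fst (F t)) = rhs1 \<alpha> \<beta> \<gamma> x (left_limit F) t \<and> real (snd (F t)) = rhs2 \<alpha> \<beta> \<gamma> \<delta> p y (left_limit F) t"
  have E0: "?E 0"
    using rhs_0[OF F_cadlag] grid_path_le[OF n_pos, of 0 x] grid_path_0[OF n_pos, of "(x, y)"] T by simp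
  have cell_ok: "?E t" if k: "k < n" and t: "g k \<le> t" "t \<le> g (Suc k)" and IH: "?E (g k)" for k t
  proof -
    have b: "0 \<le> g k" "g k < g (Suc k)" "g (Suc k) \<le> T" using g_bounds[OF k] by auto
    have H: "F s = F (g k)" if "g k \<le> s" "s \<le> g (Suc k)" "quiet (g k) s" for s
      by (rule F_quiet[OF k that])
    have le: "real (snd (F s)) \<le> K" if "0 \<le> s" "s \<le> g (Suc k)" for s
      by (rule grid_path_le[OF n_pos]) (use that b in auto)
    note ri = rhs_increment[OF F_cadlag b t cell_sparse[OF k order_refl] H le]
    show ?thesis using ri(1)[of x] ri(2) F_increment[OF k t] IH by simp
  qed
  have grid: "?E (g k)" if "k \<le> n" for k
    using that
  proof (induction k)
    case 0
    then show ?case using E0 by simp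
  next
    case (Suc k)
    have le: "g k \<le> g (Suc k)" using g_bounds[of k] Suc.prems by simp
    show ?case by (rule cell_ok[of k, OF _ le order_refl]) (use Suc in simp_all)
  qed
  show ?thesis unfolding solves_equations_def
  proof
    fix t assume t: "t \<in> {0..T}"
    show "?E t"
    proof (cases "t = 0")
      case True
      then show ?thesis using E0 by simp
    next
      case False
      then obtain k where k: "k < n" "g k < t" "t \<le> g (Suc k)"
        using grid_cell_exists[OF n_pos, of t T] t by auto
      show ?thesis by (rule cell_ok[OF k(1) less_imp_le[OF k(2)] k(3) grid]) (use k in simp)
    qed
  qed
qed

text \<open>A solution stays constant while there are no points, because the right-hand sides do. Hence their
  increments over a cell are those of a step from the value at the left end of the cell, and the two paths
  agree cell by cell.\<close>

lemma solution_eq_grid_path: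
  assumes f: "f \<in> cadlag_paths T" and sol: "solves_equations \<alpha> \<beta> \<gamma> \<delta> T p x y f"
  shows "f = F"
proof -
  have E: "real (fst (f t)) = rhs1 \<alpha> \<beta> \<gamma> x (left_limit f) t" "real (snd (f t)) = rhs2 \<alpha> \<beta> \<gamma> \<delta> p y (left_limit f) t"
    if "0 \<le> t" "t \<le> T" for t
    using bspec[OF sol[unfolded solves_equations_def], of t] that by simp_all
  have le: "real (snd (f t)) \<le> K" if t: "0 \<le> t" "t \<le> T" for t
  proof -
    have "rhs2 \<alpha> \<beta> \<gamma> \<delta> p y (left_limit f) t = rhs2 \<alpha> \<beta> \<gamma> \<delta> p y (left_path T f) t"
      by (rule rhs_cong) (use t in \<open>auto simp: left_path_def\<close>)
    then show ?thesis using E(2)[OF t] rhs2_le_level[OF left_path_measurable[OF f] t] by simp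
  qed
  have cell_eq: "f t = F t" if k: "k < n" and t: "g k \<le> t" "t \<le> g (Suc k)" and IH: "f (g k) = F (g k)" for k t
  proof -
    have b: "0 \<le> g k" "g k < g (Suc k)" "g (Suc k) \<le> T" "g k \<le> T" "t \<le> T" "0 \<le> t" using g_bounds[OF k] t by auto
    have H: "f s = F (g k)" if s: "g k \<le> s" "s \<le> g (Suc k)" "quiet (g k) s" for s
    proof -
      have sT: "0 \<le> s" "s \<le> T" using s b by auto
      have "real (snd (f r)) \<le> K" if "0 \<le> r" "r \<le> s" for r using le[of r] that sT by simp
      note q = rhs_quiet[OF f b(1) s(1) sT(2) s(3) this]
      have "f s = f (g k)" using q(1)[of x] q(2) E[OF sT] E[OF b(1,4)] by (simp add: prod_eq_iff)
      then show ?thesis using IH by simp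
    qed
    have le': "real (snd (f s)) \<le> K" if "0 \<le> s" "s \<le> g (Suc k)" for s
      by (rule le) (use that b in auto)
    note ri = rhs_increment[OF f b(1-3) t cell_sparse[OF k order_refl] H le']
    show ?thesis
      using ri(1)[of x] ri(2) F_increment[OF k t] E[OF b(6,5)] E[OF b(1,4)] IH by (simp add: prod_eq_iff)
  qed
  have f0: "f 0 = F 0"
    using rhs_0[OF f le[of 0]] E[of 0] T grid_path_0[OF n_pos, of "(x, y)"] by (simp add: prod_eq_iff)
  have grid: "f (g k) = F (g k)" if "k \<le> n" for k
    using that
  proof (induction k)
    case 0
    then show ?case using f0 by simp
  next
    case (Suc k)
    have le: "g k \<le> g (Suc k)" using g_bounds[of k] Suc.prems by simp
    show ?case by (rule cell_eq[of k, OF _ le order_refl]) (use Suc in simp_all)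
  qed
  have "f t = F t" if t: "t \<in> {0..T}" for t
  proof (cases "t = 0")
    case True
    then show ?thesis using f0 by simp
  next
    case False
    then obtain k where k: "k < n" "g k < t" "t \<le> g (Suc k)"
      using grid_cell_exists[OF n_pos, of t T] t by auto
    show ?thesis by (rule cell_eq[OF k(1) less_imp_le[OF k(2)] k(3) grid]) (use k in simp)
  qed
  then show ?thesis
    using f F_cadlag by (intro extensionalityI[of _ "{0..T}"]) (auto simp: cadlag_paths_def)
qed

end

end

section \<open>The solution for a given profile as a function of the noise pattern\<close>

text \<open>The solution with profile p, read off the record c of the noise. The coarsest sparse grid is a
  measurable choice, and by uniqueness all sparse grids give the same path. Records without sparse grids
  have probability 0.\<close>

definition flow :: "(real \<Rightarrow> real) \<Rightarrow> real \<Rightarrow> nat \<Rightarrow> nat \<Rightarrow> (region \<Rightarrow> nat) \<Rightarrow> real \<Rightarrow> nat \<times> nat" where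
  "flow p T x y c = (if \<exists>n. sparse_grid c T (real (level c T y)) n
     then grid_path p c T (LEAST n. sparse_grid c T (real (level c T y)) n) (x, y) else (\<lambda>t\<in>{0..T}. (x, y)))"

lemma pattern_function_measurable:
  assumes "set rs \<subseteq> bounded_regions"
  shows "(\<lambda>c. h (map c rs)) \<in> measurable pattern_space (count_space UNIV)"
proof -
  have "(\<lambda>c. map c rs) \<in> measurable pattern_space (count_space UNIV)"
    using assms
  proof (induction rs)
    case (Cons r rs)
    have c: "(\<lambda>c. c r) \<in> measurable pattern_space (count_space UNIV)"
      using Cons.prems by (intro measurable_component_singleton) auto
    have "(\<lambda>c. map c rs) \<in> measurable pattern_space (count_space UNIV)" using Cons by simp
    then have "(\<lambda>c. i # map c rs) \<in> measurable pattern_space (count_space UNIV)" for i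
      by (rule measurable_compose) simp
    from measurable_compose_countable[where f = "\<lambda>i c. i # map c rs", OF this c]
    show ?case by simp
  qed simp
  then show ?thesis by (rule measurable_compose) simp
qed

lemma cell_bounded_line: "0 \<le> T \<Longrightarrow> cell T n k t \<in> bounded_line"
  unfolding cell_def grid_point_def by (intro interval_bounded_line) auto

lemma activity_measurable:
  assumes "A \<in> bounded_line"
  shows "(\<lambda>c. h (activity c K A)) \<in> measurable pattern_space (count_space UNIV)"
proof -
  let ?rs = "[Mu_line A, Lam_line A, Mu_plane (A \<times> {0..K}), Lam_plane (A \<times> {0..1})]"
  have "set ?rs \<subseteq> bounded_regions" using assms Times_bounded_plane[OF assms] by simp
  note m = pattern_function_measurable[OF this, of "\<lambda>l. h (l ! 0 + l ! 1 + l ! 2 + l ! 3)"]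
  have "(\<lambda>c. h (activity c K A)) = (\<lambda>c. h (map c ?rs ! 0 + map c ?rs ! 1 + map c ?rs ! 2 + map c ?rs ! 3))"
    by (simp add: activity_def)
  then show ?thesis by (simp only: m)
qed

lemma level_measurable: "(\<lambda>c. level c T y) \<in> measurable pattern_space (count_space UNIV)"
proof -
  let ?rs = "[Lam_line {0..T}, Lam_plane ({0..T} \<times> {0..1})]"
  have "{0..T} \<in> bounded_line" by (rule interval_bounded_line) simp
  then have "set ?rs \<subseteq> bounded_regions" using Times_bounded_plane by simp
  note m = pattern_function_measurable[OF this, of "\<lambda>l. y + l ! 0 + l ! 1"]
  have "(\<lambda>c. level c T y) = (\<lambda>c. y + map c ?rs ! 0 + map c ?rs ! 1)"
    by (simp add: level_def)
  then show ?thesis by (simp only: m)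
qed

lemma sparse_measurable:
  assumes "0 \<le> T"
  shows "Measurable.pred pattern_space (\<lambda>c. sparse_grid c T K n)"
proof -
  have 1: "Measurable.pred pattern_space (\<lambda>c. activity c K {0..0} = 0)"
    by (rule activity_measurable[where h = "\<lambda>a. a = 0"]) (rule interval_bounded_line, simp)
  have 2: "Measurable.pred pattern_space (\<lambda>c. c (Mu_plane ({0..T} \<times> {0..0})) = 0)"
    using pattern_function_measurable[of "[Mu_plane ({0..T} \<times> {0..0})]" "\<lambda>l. l ! 0 = 0"]
      Times_bounded_plane[of "{0..T}" 0] by (simp only: interval_bounded_line bounded_regions_simps set_simps list.map nth_Cons_0) auto
  have 3: "Measurable.pred pattern_space (\<lambda>c. \<forall>k\<in>{..<n}. activity c K (cell T n k T) \<le> 1)"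
    by (intro pred_intros_finite activity_measurable[where h = "\<lambda>a. a \<le> 1"] cell_bounded_line assms) simp
  have eq: "sparse_grid c T K n \<longleftrightarrow> 0 < n \<and> activity c K {0..0} = 0 \<and> c (Mu_plane ({0..T} \<times> {0..0})) = 0 \<and>
    (\<forall>k\<in>{..<n}. activity c K (cell T n k T) \<le> 1)" for c
    unfolding sparse_grid_def by blast
  show ?thesis unfolding eq pred_def
    by (intro sets.sets_Collect_conj sets.sets_Collect_const 1[unfolded pred_def] 2[unfolded pred_def] 3[unfolded pred_def])
qed

lemma step_measurable:
  assumes p: "p \<in> borel_measurable borel" "\<And>s. p s \<le> 1" and A: "A \<in> bounded_line"
  shows "(\<lambda>c. step p c A r) \<in> measurable pattern_space (count_space UNIV)"
proof -
  let ?rs = "[Mu_line A, Lam_line A, Mu_plane (A \<times> {0..real (snd r)}), Lam_plane (region_below p A)]"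
  let ?h = "\<lambda>l. let i = l ! 0; j = (if fst r > 0 then l ! 1 else 0); k = l ! 2; m = l ! 3
    in (fst r + k - fst r * i - j, snd r + j + m - snd r * i - k)"
  have "set ?rs \<subseteq> bounded_regions"
    using A Times_bounded_plane[OF A] region_below_bounded_plane[OF p(1) A p(2)] by simp
  note m = pattern_function_measurable[OF this, of ?h]
  have "(\<lambda>c. step p c A r) = (\<lambda>c. ?h (map c ?rs))" by (simp add: step_def fun_eq_iff)
  then show ?thesis by (simp only: m)
qed

lemma grid_state_measurable:
  assumes p: "p \<in> borel_measurable borel" "\<And>s. p s \<le> 1" and T: "0 \<le> T"
  shows "(\<lambda>c. grid_state p c T n z t k) \<in> measurable pattern_space (count_space UNIV)"
proof (induction k)
  case (Suc k)
  have "(\<lambda>c. step p c (cell T n k t) (grid_state p c T n z t k)) \<in> measurable pattern_space (count_space UNIV)"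
    by (rule measurable_compose_countable[OF step_measurable[OF p cell_bounded_line[OF T]] Suc])
  then show ?case by simp
qed simp

lemma flow_measurable:
  assumes p: "p \<in> borel_measurable borel" "\<And>s. p s \<le> 1" and T: "0 \<le> T" and t: "t \<in> {0..T}"
  shows "(\<lambda>c. flow p T x y c t) \<in> measurable pattern_space (count_space UNIV)"
proof -
  have sp: "Measurable.pred pattern_space (\<lambda>c. sparse_grid c T (real (level c T y)) n)" for n
    by (rule measurable_compose_countable[OF sparse_measurable[OF T] level_measurable])
  have L: "(\<lambda>c. LEAST n. sparse_grid c T (real (level c T y)) n) \<in> measurable pattern_space (count_space UNIV)"
    by (rule measurable_Least[OF sp])
  have G: "(\<lambda>c. grid_state p c T (LEAST n. sparse_grid c T (real (level c T y)) n) (x, y) t (LEAST n. sparse_grid c T (real (level c T y)) n))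
    \<in> measurable pattern_space (count_space UNIV)"
    by (rule measurable_compose_countable[OF grid_state_measurable[OF p T] L])
  have E: "Measurable.pred pattern_space (\<lambda>c. \<exists>n. sparse_grid c T (real (level c T y)) n)"
    unfolding pred_def by (rule sets.sets_Collect_countable_Ex) (rule sp[unfolded pred_def])
  have "(\<lambda>c. if \<exists>n. sparse_grid c T (real (level c T y)) n
      then grid_state p c T (LEAST n. sparse_grid c T (real (level c T y)) n) (x, y) t (LEAST n. sparse_grid c T (real (level c T y)) n)
      else (x, y)) \<in> measurable pattern_space (count_space UNIV)"
    by (rule measurable_If[OF G _ E[unfolded pred_def]]) simp
  also have "(\<lambda>c. if \<exists>n. sparse_grid c T (real (level c T y)) n
      then grid_state p c T (LEAST n. sparse_grid c T (real (level c T y)) n) (x, y) t (LEAST n. sparse_grid c T (real (level c T y)) n)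
      else (x, y)) = (\<lambda>c. flow p T x y c t)"
    using t by (auto simp: flow_def grid_path_def fun_eq_iff)
  finally show ?thesis .
qed

lemma constant_cadlag: "(\<lambda>t\<in>{0..T}. v) \<in> cadlag_paths T"
proof (rule cadlag_pathsI)
  fix t assume "0 \<le> t" "t < T"
  then show "\<exists>b>t. \<forall>s. t < s \<and> s < b \<longrightarrow> (\<lambda>t\<in>{0..T}. v) s = (\<lambda>t\<in>{0..T}. v) t"
    by (intro exI[of _ T] conjI allI impI) simp_all
next
  fix t assume "0 < t" "t \<le> T"
  then show "\<exists>a<t. \<exists>l. \<forall>s. a < s \<and> s < t \<longrightarrow> (\<lambda>t\<in>{0..T}. v) s = l"
    by (intro exI[of _ "0::real"] conjI exI[of _ v] allI impI) simp_all
qed simp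

lemma (in realisation) flow_cadlag: "flow p T x y c \<in> cadlag_paths T"
proof (cases "\<exists>n. sparse_grid c T K n")
  case True
  then have "sparse_grid c T K (LEAST n. sparse_grid c T K n)" by (rule LeastI_ex)
  from F_cadlag[OF this] True show ?thesis by (simp only: flow_def if_True)
next
  case False
  then show ?thesis using constant_cadlag by (simp only: flow_def if_False)
qed

lemma (in realisation) solves_iff_flow:
  assumes "\<exists>n. sparse_grid c T K n"
  shows "f \<in> cadlag_paths T \<and> solves_equations \<alpha> \<beta> \<gamma> \<delta> T p x y f \<longleftrightarrow> f = flow p T x y c"
proof -
  from assms have sp: "sparse_grid c T K (LEAST n. sparse_grid c T K n)" by (rule LeastI_ex)
  have fl: "flow p T x y c = grid_path p c T (LEAST n. sparse_grid c T K n) (x, y)"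
    using assms by (simp only: flow_def if_True)
  show ?thesis unfolding fl
    using F_cadlag[OF sp, of x] grid_path_solves[OF sp, of x] solution_eq_grid_path[OF sp, of f x] by blast
qed

text \<open>Candidates for the function that maps s to the probability of a positive first component at time s.\<close>

definition profile :: "(real \<Rightarrow> real) \<Rightarrow> bool" where
  "profile p \<longleftrightarrow> p \<in> borel_measurable borel \<and> (\<forall>s. 0 \<le> p s \<and> p s \<le> 1)"

section \<open>Almost surely there are sparse grids\<close>

lemma emeasure_lborel_box:
  assumes "a \<le> b" "0 \<le> K"
  shows "emeasure lborel ({a<..b} \<times> {0..K::real}) = ennreal ((b - a) * K)"
proof -
  have "emeasure (lborel \<Otimes>\<^sub>M lborel) ({a<..b} \<times> {0..K}) = emeasure lborel {a<..b} * emeasure lborel {0..K}"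
    by (rule lborel.emeasure_pair_measure_Times) auto
  then show ?thesis using assms by (simp add: lborel_prod ennreal_mult)
qed

context noise
begin

lemma noise_realisation:
  assumes "\<omega> \<in> space M" "0 < T" "profile p"
  shows "realisation (N\<mu> \<omega>) (Nlam \<omega>) (N2\<mu> \<omega>) (N2lam \<omega>) T p"
proof -
  have Q: "{0..} \<times> {0..} \<in> sets (borel :: (real \<times> real) measure)"
    by (intro borel_closed closed_Times closed_atLeast)
  have "discrete_measure (N\<mu> \<omega>) {0..}"
    by unfold_locales (use assms A.sets_N A.emeasure_N_Nats sets_halfline_intensity in auto)
  moreover have "discrete_measure (Nlam \<omega>) {0..}"
    by unfold_locales (use assms B.sets_N B.emeasure_N_Nats sets_halfline_intensity in auto)
  moreover have "discrete_measure (N2\<mu> \<omega>) ({0..} \<times> {0..})"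
    by unfold_locales (use assms Q C.sets_N C.emeasure_N_Nats sets_quadrant_intensity in auto)
  moreover have "discrete_measure (N2lam \<omega>) ({0..} \<times> {0..})"
    by unfold_locales (use assms Q D.sets_N D.emeasure_N_Nats sets_quadrant_intensity in auto)
  ultimately show ?thesis
    unfolding realisation_def realisation_axioms_def using assms by (simp add: profile_def)
qed

lemma noise_pattern_pred:
  assumes "Measurable.pred pattern_space P"
  shows "{\<omega> \<in> space M. P (noise_pattern \<omega>)} \<in> sets M"
  using measurable_sets[OF measurable_compose[OF noise_pattern_measurable assms], of "{True}"]
  by (simp add: vimage_def Int_def conj_commute)

text \<open>Either one process has two points in the cell, or two independent processes have one each. There are 4
  events of the first kind and 12 ordered pairs for the second; each has probability at most the square of
  a common bound \<rho> of the four mean numbers of points.\<close>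

lemma prob_cell_busy:
  assumes ab: "0 \<le> a" "a \<le> b" and K: "0 \<le> K"
  shows "A.prob {\<omega> \<in> space M. 2 \<le> activity (noise_pattern \<omega>) K {a<..b}} \<le> 16 * ((\<mu> + lam) * (K + 1) * (b - a))\<^sup>2"
proof -
  define \<rho> where "\<rho> = (\<mu> + lam) * (K + 1) * (b - a)"
  let ?A = "{a<..b}"
  have l: "?A \<in> bounded_line" using ab by (intro interval_bounded_line)
  have lA: "?A \<in> sets (halfline_intensity r)" "bounded ?A" for r
    using l by (auto simp: bounded_line_def sets_halfline_intensity)
  have pA: "?A \<times> {0..h} \<in> sets (quadrant_intensity r)" "bounded (?A \<times> {0..h})" for r h
    using Times_bounded_plane[OF l, of h] by (auto simp: bounded_plane_def sets_quadrant_intensity)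
  have ml: "measure (halfline_intensity r) ?A = r * (b - a)" if "0 < r" for r
    using that ab lA(1)[of r] unfolding sets_halfline_intensity
    by (simp add: measure_def emeasure_halfline_intensity enn2real_mult)
  have mp: "measure (quadrant_intensity r) (?A \<times> {0..h}) = r * ((b - a) * h)" if "0 < r" "0 \<le> h" for r h
    using that ab pA(1)[of h r] unfolding sets_quadrant_intensity
    by (simp add: measure_def emeasure_quadrant_intensity emeasure_lborel_box enn2real_mult)
  define X where "X i \<omega> = [num_points (N\<mu> \<omega>) ?A, num_points (Nlam \<omega>) ?A,
    num_points (N2\<mu> \<omega>) (?A \<times> {0..K}), num_points (N2lam \<omega>) (?A \<times> {0..1})] ! i" for i :: nat and \<omega>
  have I: "{..<4::nat} = {0, 1, 2, 3}" by auto
  have ba: "0 \<le> b - a" using ab by simp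
  have bnd: "\<mu> * (b - a) \<le> \<rho>" "lam * (b - a) \<le> \<rho>" "\<mu> * ((b - a) * K) \<le> \<rho>" "lam * ((b - a) * 1) \<le> \<rho>"
  proof -
    have e: "\<rho> = \<mu> * ((b - a) * K) + \<mu> * (b - a) + lam * ((b - a) * K) + lam * (b - a)"
      by (simp add: \<rho>_def algebra_simps)
    have "0 \<le> \<mu> * ((b - a) * K)" "0 \<le> \<mu> * (b - a)" "0 \<le> lam * ((b - a) * K)" "0 \<le> lam * (b - a)"
      using rates ba K by simp_all
    then show "\<mu> * (b - a) \<le> \<rho>" "lam * (b - a) \<le> \<rho>" "\<mu> * ((b - a) * K) \<le> \<rho>" "lam * ((b - a) * 1) \<le> \<rho>"
      unfolding e by simp_all
  qed
  note fin = halfline_intensity_finite[OF lA] quadrant_intensity_finite[OF pA]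
  have X1: "A.prob {\<omega> \<in> space M. 1 \<le> X i \<omega>} \<le> \<rho>" if "i \<in> {..<4}" for i
    using that bnd A.prob_count_pos[OF lA fin(1)] B.prob_count_pos[OF lA fin(1)]
      C.prob_count_pos[OF pA fin(2), of K] D.prob_count_pos[OF pA fin(2), of 1] ml mp[OF _ K] mp[of _ 1] rates
    unfolding I by (auto simp: X_def)
  have sq: "r\<^sup>2 \<le> \<rho>\<^sup>2" if "0 \<le> r" "r \<le> \<rho>" for r using that by (intro power_mono)
  have X2: "A.prob {\<omega> \<in> space M. 2 \<le> X i \<omega>} \<le> \<rho>\<^sup>2" if "i \<in> {..<4}" for i
    using that order_trans[OF A.prob_count_ge_2[OF lA fin(1)] sq[OF measure_nonneg]] order_trans[OF B.prob_count_ge_2[OF lA fin(1)] sq[OF measure_nonneg]]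
      order_trans[OF C.prob_count_ge_2[OF pA fin(2), of K] sq[OF measure_nonneg]]
      order_trans[OF D.prob_count_ge_2[OF pA fin(2), of 1] sq[OF measure_nonneg]] bnd ml mp[OF _ K] mp[of _ 1] rates
    unfolding I by (auto simp: X_def)
  have XP: "{\<omega> \<in> space M. 1 \<le> X i \<omega>} \<in> process_events i" if "i \<in> {..<4}" for i
  proof -
    have s: "{\<omega> \<in> space M. \<forall>A\<in>{A}. f \<omega> A \<in> {1..}} = {\<omega> \<in> space M. 1 \<le> f \<omega> A}" for f :: "'a \<Rightarrow> 'x \<Rightarrow> nat" and A
      by auto
    show ?thesis
      using that A.counts_in_events_generated_by[of "{?A}" "\<lambda>_. {1..}"] B.counts_in_events_generated_by[of "{?A}" "\<lambda>_. {1..}"]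
        C.counts_in_events_generated_by[of "{?A \<times> {0..K}}" "\<lambda>_. {1..}"] D.counts_in_events_generated_by[of "{?A \<times> {0..1}}" "\<lambda>_. {1..}"]
        lA(1) pA(1)
      unfolding I s by (auto simp: X_def process_events_def)
  qed
  have XS: "{\<omega> \<in> space M. m \<le> X i \<omega>} \<in> sets M" if "i \<in> {..<4}" for i m
    using that A.count_sets[OF lA(1)[of \<mu>], of "{m..}"] B.count_sets[OF lA(1)[of lam], of "{m..}"]
      C.count_sets[OF pA(1)[of K \<mu>], of "{m..}"] D.count_sets[OF pA(1)[of 1 lam], of "{m..}"]
    unfolding I by (auto simp: X_def)
  have pair: "A.prob ({\<omega> \<in> space M. 1 \<le> X i \<omega>} \<inter> {\<omega> \<in> space M. 1 \<le> X j \<omega>}) \<le> \<rho>\<^sup>2"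
    if "i \<in> {..<4}" "j \<in> {..<4} - {i}" for i j
  proof -
    have "A.prob ({\<omega> \<in> space M. 1 \<le> X i \<omega>} \<inter> {\<omega> \<in> space M. 1 \<le> X j \<omega>}) =
        A.prob {\<omega> \<in> space M. 1 \<le> X i \<omega>} * A.prob {\<omega> \<in> space M. 1 \<le> X j \<omega>}"
      by (rule prob_two_processes[OF _ _ _ XP XP]) (use that in auto)
    also have "\<dots> \<le> \<rho> * \<rho>"
      using X1[of i] X1[of j] that order_trans[OF measure_nonneg X1[of i]] by (intro mult_mono) auto
    finally show ?thesis by (simp add: power2_eq_square)
  qed
  let ?U = "\<Union>i\<in>{..<4}. {\<omega> \<in> space M. 2 \<le> X i \<omega>}"
  let ?W = "\<Union>i\<in>{..<4}. \<Union>j\<in>{..<4} - {i}. {\<omega> \<in> space M. 1 \<le> X i \<omega>} \<inter> {\<omega> \<in> space M. 1 \<le> X j \<omega>}"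
  have UM: "?U \<in> sets M" using XS by (intro sets.finite_UN) auto
  have WM: "?W \<in> sets M" using XS by (intro sets.finite_UN sets.Int) auto
  have "{\<omega> \<in> space M. 2 \<le> activity (noise_pattern \<omega>) K ?A} \<subseteq> ?U \<union> ?W"
  proof
    fix \<omega> assume \<omega>: "\<omega> \<in> {\<omega> \<in> space M. 2 \<le> activity (noise_pattern \<omega>) K ?A}"
    then have "2 \<le> X 0 \<omega> + X 1 \<omega> + X 2 \<omega> + X 3 \<omega>"
      using l Times_bounded_plane[OF l] by (simp add: activity_def noise_pattern_def pattern_simps X_def)
    then have cases: "2 \<le> X 0 \<omega> \<or> 2 \<le> X 1 \<omega> \<or> 2 \<le> X 2 \<omega> \<or> 2 \<le> X 3 \<omega> \<or>
      1 \<le> X 0 \<omega> \<and> 1 \<le> X 1 \<omega> \<or> 1 \<le> X 0 \<omega> \<and> 1 \<le> X 2 \<omega> \<or> 1 \<le> X 0 \<omega> \<and> 1 \<le> X 3 \<omega> \<or>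
      1 \<le> X 1 \<omega> \<and> 1 \<le> X 2 \<omega> \<or> 1 \<le> X 1 \<omega> \<and> 1 \<le> X 3 \<omega> \<or> 1 \<le> X 2 \<omega> \<and> 1 \<le> X 3 \<omega>"
      by linarith
    define hit where "hit \<longleftrightarrow> \<omega> \<in> ?U \<union> ?W"
    have U: hit if "i \<in> {..<4}" "2 \<le> X i \<omega>" for i
      unfolding hit_def using that \<omega> by blast
    have W: hit if "i \<in> {..<4}" "j \<in> {..<4} - {i}" "1 \<le> X i \<omega>" "1 \<le> X j \<omega>" for i j
      unfolding hit_def using that \<omega> by blast
    have hit
      using cases U[of 0] U[of 1] U[of 2] U[of 3] W[of 0 1] W[of 0 2] W[of 0 3] W[of 1 2] W[of 1 3] W[of 2 3] by auto
    then show "\<omega> \<in> ?U \<union> ?W" by (simp only: hit_def)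
  qed
  then have "A.prob {\<omega> \<in> space M. 2 \<le> activity (noise_pattern \<omega>) K ?A} \<le> A.prob (?U \<union> ?W)"
    using UM WM by (intro A.finite_measure_mono) auto
  moreover have "A.prob (?U \<union> ?W) \<le> A.prob ?U + A.prob ?W" using UM WM by (rule measure_Un_le)
  moreover have "A.prob ?U \<le> 4 * \<rho>\<^sup>2"
  proof -
    have "A.prob ?U \<le> (\<Sum>i\<in>{..<4}. A.prob {\<omega> \<in> space M. 2 \<le> X i \<omega>})"
      using XS by (intro A.finite_measure_subadditive_finite) auto
    also have "\<dots> \<le> (\<Sum>i\<in>{..<4::nat}. \<rho>\<^sup>2)" by (intro sum_mono X2)
    finally show ?thesis by simp
  qed
  moreover have "A.prob ?W \<le> 12 * \<rho>\<^sup>2"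
  proof -
    have "A.prob ?W \<le> (\<Sum>i\<in>{..<4}. A.prob (\<Union>j\<in>{..<4} - {i}. {\<omega> \<in> space M. 1 \<le> X i \<omega>} \<inter> {\<omega> \<in> space M. 1 \<le> X j \<omega>}))"
      using XS by (intro A.finite_measure_subadditive_finite) (auto intro!: sets.finite_UN sets.Int)
    also have "\<dots> \<le> (\<Sum>i\<in>{..<4}. \<Sum>j\<in>{..<4} - {i}. A.prob ({\<omega> \<in> space M. 1 \<le> X i \<omega>} \<inter> {\<omega> \<in> space M. 1 \<le> X j \<omega>}))"
      using XS by (intro sum_mono A.finite_measure_subadditive_finite) (auto intro!: sets.Int)
    also have "\<dots> \<le> (\<Sum>i\<in>{..<4::nat}. \<Sum>j\<in>{..<4::nat} - {i}. \<rho>\<^sup>2)"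
      by (intro sum_mono pair)
    also have "\<dots> = 12 * \<rho>\<^sup>2" by simp
    finally show ?thesis .
  qed
  ultimately show ?thesis by (simp add: \<rho>_def)
qed

lemma AE_no_points:
  shows "AE \<omega> in M. activity (noise_pattern \<omega>) K {0..0} = 0"
    and "AE \<omega> in M. noise_pattern \<omega> (Mu_plane ({0..T} \<times> {0..0})) = 0"
proof -
  have l: "{0..0::real} \<in> bounded_line" "{0..T} \<in> bounded_line" by (rule interval_bounded_line, simp)+
  have lA: "{0..0} \<in> sets (halfline_intensity r)" "bounded {0..0::real}" for r
    using l by (auto simp: bounded_line_def sets_halfline_intensity)
  have pA: "A \<times> {0..h} \<in> sets (quadrant_intensity r)" "bounded (A \<times> {0..h})" if "A \<in> bounded_line" for A r h
    using Times_bounded_plane[OF that, of h] by (auto simp: bounded_plane_def sets_quadrant_intensity)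
  have zl: "emeasure (halfline_intensity r) {0..0} = 0" for r
    using lA(1)[of r] unfolding sets_halfline_intensity by (simp add: emeasure_halfline_intensity)
  have box: "emeasure lborel (A \<times> B) = emeasure lborel A * emeasure lborel B" if "A \<in> sets borel" "B \<in> sets borel" for A B :: "real set"
    unfolding lborel_prod[symmetric] using that by (intro lborel.emeasure_pair_measure_Times) auto
  have zp: "emeasure (quadrant_intensity r) ({0..0} \<times> {0..h}) = 0" for r h
    using pA(1)[OF l(1), of h r] unfolding sets_quadrant_intensity
    by (subst emeasure_quadrant_intensity) (auto simp: box simp del: atLeastAtMost_singleton)
  have za: "emeasure (quadrant_intensity r) ({0..T} \<times> {0..0}) = 0" for r
    using pA(1)[OF l(2), of 0 r] unfolding sets_quadrant_intensity
    by (subst emeasure_quadrant_intensity) (auto simp: box simp del: atLeastAtMost_singleton)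
  have "AE \<omega> in M. num_points (N\<mu> \<omega>) {0..0} = 0" "AE \<omega> in M. num_points (Nlam \<omega>) {0..0} = 0"
    "AE \<omega> in M. num_points (N2\<mu> \<omega>) ({0..0} \<times> {0..K}) = 0" "AE \<omega> in M. num_points (N2lam \<omega>) ({0..0} \<times> {0..1}) = 0"
    using A.count_null[OF lA zl] B.count_null[OF lA zl] C.count_null[OF pA[OF l(1)] zp] D.count_null[OF pA[OF l(1)] zp] by blast+
  then show "AE \<omega> in M. activity (noise_pattern \<omega>) K {0..0} = 0"
    by eventually_elim
      (use l Times_bounded_plane[OF l(1)] in \<open>simp add: activity_def noise_pattern_def pattern_simps del: atLeastAtMost_singleton\<close>)
  show "AE \<omega> in M. noise_pattern \<omega> (Mu_plane ({0..T} \<times> {0..0})) = 0"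
    using C.count_null[OF pA[OF l(2)] za]
    by eventually_elim (use Times_bounded_plane[OF l(2)] in \<open>simp add: noise_pattern_def pattern_simps del: atLeastAtMost_singleton\<close>)
qed

text \<open>A cell fails with probability of order 1 / n^2 and the grid with probability of order 1 / n, so that
  almost surely some grid succeeds.\<close>

lemma AE_sparse_level:
  assumes T: "0 < T" and K: "0 \<le> K"
  shows "AE \<omega> in M. \<exists>n. sparse_grid (noise_pattern \<omega>) T K n"
proof -
  define bad where "bad n = {\<omega> \<in> space M. \<exists>k\<in>{..<n}. 2 \<le> activity (noise_pattern \<omega>) K (cell T n k T)}" for n
  define C where "C = (\<mu> + lam) * (K + 1) * T"
  have cellM: "{\<omega> \<in> space M. 2 \<le> activity (noise_pattern \<omega>) K (cell T n k T)} \<in> sets M" for n k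
    using T by (intro noise_pattern_pred activity_measurable[where h = "\<lambda>a. 2 \<le> a"] cell_bounded_line) simp
  have bad_eq: "bad n = (\<Union>k\<in>{..<n}. {\<omega> \<in> space M. 2 \<le> activity (noise_pattern \<omega>) K (cell T n k T)})" for n
    by (auto simp: bad_def)
  have badM: "bad n \<in> sets M" for n unfolding bad_eq using cellM by (intro sets.finite_UN) auto
  have bad_le: "A.prob (bad n) \<le> 16 * C\<^sup>2 / real n" if n: "0 < n" for n
  proof -
    have "A.prob (bad n) \<le> (\<Sum>k\<in>{..<n}. A.prob {\<omega> \<in> space M. 2 \<le> activity (noise_pattern \<omega>) K (cell T n k T)})"
      unfolding bad_eq using cellM by (intro A.finite_measure_subadditive_finite) auto
    also have "\<dots> \<le> (\<Sum>k\<in>{..<n}. 16 * (C / real n)\<^sup>2)"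
    proof (rule sum_mono)
      fix k assume k: "k \<in> {..<n}"
      then have c: "cell T n k T = {grid_point T n k<..grid_point T n (Suc k)}"
        using grid_point_bounds[of T "Suc k" n] T by (simp add: cell_def)
      have "0 \<le> grid_point T n k" using grid_point_bounds[of T k n] T k by simp
      then have "A.prob {\<omega> \<in> space M. 2 \<le> activity (noise_pattern \<omega>) K (cell T n k T)} \<le>
        16 * ((\<mu> + lam) * (K + 1) * (grid_point T n (Suc k) - grid_point T n k))\<^sup>2"
        unfolding c using grid_point_less_Suc[OF T n, of k] K by (intro prob_cell_busy) auto
      also have "(\<mu> + lam) * (K + 1) * (grid_point T n (Suc k) - grid_point T n k) = C / real n"
        by (simp add: grid_point_Suc C_def)
      finally show "A.prob {\<omega> \<in> space M. 2 \<le> activity (noise_pattern \<omega>) K (cell T n k T)} \<le> 16 * (C / real n)\<^sup>2" .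
    qed
    also have "\<dots> = 16 * C\<^sup>2 / real n" using n by (simp add: power2_eq_square)
    finally show ?thesis .
  qed
  let ?N = "\<Inter>n\<in>{0<..}. bad n"
  have NM: "?N \<in> sets M" by (rule sets.countable_INT') (use badM in auto)
  have "A.prob ?N \<le> e" if e: "0 < e" for e
  proof -
    obtain n where n: "0 < n" "16 * C\<^sup>2 / real n < e" using grid_fine[OF e, of "16 * C\<^sup>2"] by blast
    have "A.prob ?N \<le> A.prob (bad n)" using n badM by (intro A.finite_measure_mono) auto
    then show ?thesis using bad_le[OF n(1)] n(2) by linarith
  qed
  then have "A.prob ?N \<le> 0" by (rule field_le_epsilon[of _ 0, simplified])
  then have "A.prob ?N = 0" using measure_nonneg[of M ?N] by linarith
  then have "AE \<omega> in M. \<omega> \<notin> ?N" using NM by (simp add: A.prob_eq_0)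
  moreover have "AE \<omega> in M. \<omega> \<in> space M" by (rule AE_space)
  ultimately show ?thesis using AE_no_points(1)[of K] AE_no_points(2)[of T]
  proof eventually_elim
    case (elim \<omega>)
    then obtain n where n: "0 < n" "\<omega> \<notin> bad n" by auto
    then have "\<not> 2 \<le> activity (noise_pattern \<omega>) K (cell T n k T)" if "k < n" for k
      using elim(2) that unfolding bad_def by blast
    then have "\<forall>k<n. activity (noise_pattern \<omega>) K (cell T n k T) \<le> 1" by (metis Suc_1 not_less_eq_eq)
    then show ?case using n(1) elim(3,4) unfolding sparse_grid_def by blast
  qed
qed

lemma AE_sparse:
  assumes T: "0 < T"
  shows "AE \<omega> in M. \<exists>n. sparse_grid (noise_pattern \<omega>) T (real (level (noise_pattern \<omega>) T y)) n"
proof -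
  have "AE \<omega> in M. \<forall>K::nat. \<exists>n. sparse_grid (noise_pattern \<omega>) T (real K) n"
    unfolding AE_all_countable using AE_sparse_level[OF T] by simp
  then show ?thesis by eventually_elim blast
qed

end

section \<open>Occupation probabilities are Borel functions of time\<close>

text \<open>The function is right-continuous by dominated convergence, and so it is the limit of its values at the
  next grid points, each of which depends on the time only through an integer.\<close>

lemma occupation_borel:
  assumes M: "prob_space M" and T: "0 < T" and R: "R \<in> measurable M (skorohod_borel T)"
  shows "(\<lambda>s. if s \<in> {0..T} then measure M {\<omega> \<in> space M. 0 < fst (R \<omega> s)} else 0) \<in> borel_measurable borel"
proof -
  interpret prob_space M by (rule M)
  \<comment> \<open>The grid point after s, strictly later than s unless s = T.\<close>
  define r where "r n s = min T ((of_int \<lfloor>s * real (Suc n)\<rfloor> + 1) / real (Suc n))" for n and s :: real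
  have r_gt: "s < r n s" if "s < T" for s n
  proof -
    have "s * real (Suc n) < of_int \<lfloor>s * real (Suc n)\<rfloor> + 1" by linarith
    then have "s < (of_int \<lfloor>s * real (Suc n)\<rfloor> + 1) / real (Suc n)" by (simp add: pos_less_divide_eq)
    then show ?thesis using that by (simp add: r_def)
  qed
  have r_le: "r n s \<le> s + 1 / real (Suc n)" for s n
  proof -
    have "of_int \<lfloor>s * real (Suc n)\<rfloor> + 1 \<le> s * real (Suc n) + 1" by linarith
    then have "(of_int \<lfloor>s * real (Suc n)\<rfloor> + 1) / real (Suc n) \<le> (s * real (Suc n) + 1) / real (Suc n)"
      by (rule divide_right_mono) simp
    moreover have "(s * real (Suc n) + 1) / real (Suc n) = s + 1 / real (Suc n)"
      by (simp add: add_divide_distrib del: of_nat_Suc)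
    ultimately show ?thesis by (simp add: r_def min_le_iff_disj)
  qed
  have r_T: "r n T = T" for n
  proof -
    have "T * real (Suc n) \<le> of_int \<lfloor>T * real (Suc n)\<rfloor> + 1" by linarith
    then have "T \<le> (of_int \<lfloor>T * real (Suc n)\<rfloor> + 1) / real (Suc n)" by (simp add: pos_le_divide_eq)
    then show ?thesis by (simp add: r_def)
  qed
  have r_mem: "r n s \<in> {0..T}" if "s \<in> {0..T}" for n s
  proof (cases "s = T")
    case True
    then show ?thesis using r_T T by simp
  next
    case False
    then show ?thesis using that r_gt[of s n] by (auto simp: r_def)
  qed
  have Rc: "R \<omega> \<in> cadlag_paths T" if "\<omega> \<in> space M" for \<omega>
    using measurable_space[OF R that] by (simp add: space_skorohod_borel)
  have Rm: "(\<lambda>\<omega>. R \<omega> s) \<in> measurable M (count_space UNIV)" if "s \<in> {0..T}" for s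
    using measurable_compose[OF R evaluation_measurable[OF T that]] .
  define g where "g s = measure M {\<omega> \<in> space M. 0 < fst (R \<omega> s)}" for s
  have ev: "\<exists>N. \<forall>n\<ge>N. R \<omega> (r n s) = R \<omega> s" if \<omega>: "\<omega> \<in> space M" and s: "s \<in> {0..T}" for \<omega> s
  proof (cases "s = T")
    case True
    then show ?thesis using r_T by simp
  next
    case False
    with s have s': "0 \<le> s" "s < T" by auto
    obtain e where e: "e > 0" "s + e \<le> T" "\<And>u. s \<le> u \<Longrightarrow> u < s + e \<Longrightarrow> R \<omega> u = R \<omega> s"
      using cadlag_right_const[OF Rc[OF \<omega>] s'] by blast
    obtain N where N: "1 / real (Suc N) < e" using nat_approx_posE[OF e(1)] by auto
    have "R \<omega> (r n s) = R \<omega> s" if "N \<le> n" for n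
    proof (rule e(3))
      have "1 / real (Suc n) \<le> 1 / real (Suc N)" using that by (simp add: frac_le)
      then show "r n s < s + e" using r_le[of n s] N by linarith
      show "s \<le> r n s" using r_gt[OF s'(2), of n] by simp
    qed
    then show ?thesis by blast
  qed
  have lim: "(\<lambda>n. g (r n s)) \<longlonglongrightarrow> g s" if s: "s \<in> {0..T}" for s
  proof -
    have ind: "g u = (\<integral>\<omega>. of_bool (0 < fst (R \<omega> u)) \<partial>M)" if u: "u \<in> {0..T}" for u
    proof -
      have "{\<omega> \<in> space M. 0 < fst (R \<omega> u)} \<in> sets M"
        using measurable_sets[OF Rm[OF u], of "{v. 0 < fst v}"] by (simp add: vimage_def Int_def conj_commute)
      then have "g u = (\<integral>\<omega>. indicator {\<omega> \<in> space M. 0 < fst (R \<omega> u)} \<omega> \<partial>M)"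
        by (simp add: g_def Int_absorb2)
      also have "\<dots> = (\<integral>\<omega>. of_bool (0 < fst (R \<omega> u)) \<partial>M)"
        by (rule Bochner_Integration.integral_cong) (auto simp: indicator_def)
      finally show ?thesis .
    qed
    have bm: "(\<lambda>\<omega>. of_bool (0 < fst (R \<omega> u)) :: real) \<in> borel_measurable M" if "u \<in> {0..T}" for u
      by (rule measurable_compose[OF Rm[OF that]]) simp
    have "(\<lambda>n. \<integral>\<omega>. of_bool (0 < fst (R \<omega> (r n s))) \<partial>M) \<longlonglongrightarrow> (\<integral>\<omega>. (of_bool (0 < fst (R \<omega> s)) :: real) \<partial>M)"
    proof (rule integral_dominated_convergence[where w = "\<lambda>_. 1"])
      show "AE \<omega> in M. (\<lambda>n. of_bool (0 < fst (R \<omega> (r n s))) :: real) \<longlonglongrightarrow> of_bool (0 < fst (R \<omega> s))"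
      proof (rule AE_I2)
        fix \<omega> assume "\<omega> \<in> space M"
        from ev[OF this s] obtain N where N: "\<And>n. N \<le> n \<Longrightarrow> R \<omega> (r n s) = R \<omega> s" by blast
        show "(\<lambda>n. of_bool (0 < fst (R \<omega> (r n s))) :: real) \<longlonglongrightarrow> of_bool (0 < fst (R \<omega> s))"
          by (rule tendsto_eventually, rule eventually_sequentiallyI[of N]) (simp add: N)
      qed
    qed (use bm s r_mem in auto)
    then show ?thesis using ind[OF s] ind[OF r_mem[OF s]] by simp
  qed
  show ?thesis
  proof (rule borel_measurable_LIMSEQ_real)
    show "(\<lambda>n. if s \<in> {0..T} then g (r n s) else 0) \<longlonglongrightarrow> (if s \<in> {0..T} then measure M {\<omega> \<in> space M. 0 < fst (R \<omega> s)} else 0)" for s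
    proof (cases "s \<in> {0..T}")
      case True
      show ?thesis using lim[OF True] unfolding g_def by (simp only: True if_True)
    next
      case False
      show ?thesis by (simp only: False if_False tendsto_const)
    qed
    have c: "(\<lambda>s::real. \<lfloor>s * real (Suc n)\<rfloor>) \<in> measurable borel (count_space UNIV)" for n
      by (rule measurable_compose[OF _ measurable_real_floor]) measurable
    have "(\<lambda>s. g (r n s)) \<in> borel_measurable borel" for n
      unfolding r_def by (rule measurable_compose[OF c]) simp
    then show "(\<lambda>s. if s \<in> {0..T} then g (r n s) else 0) \<in> borel_measurable borel" for n
      by (intro measurable_If_set) auto
  qed
qed

section \<open>The fixed point\<close>

text \<open>The McKean-Vlasov map: a profile is sent to the probabilities that the first component is positive under
  the solution that it drives. It depends on the noise only through the law Q of the record. The value 0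
  outside of [0,T] makes a fixed point determined on the whole line.\<close>

definition occupation :: "(region \<Rightarrow> nat) measure \<Rightarrow> real \<Rightarrow> nat \<Rightarrow> nat \<Rightarrow> (real \<Rightarrow> real) \<Rightarrow> real \<Rightarrow> real" where
  "occupation Q T x y p t = (if t \<in> {0..T}
     then measure Q {c \<in> space pattern_space. 0 < fst (flow p T x y c t)} else 0)"

lemma grid_state_profile_cong:
  assumes "\<And>k. k < m \<Longrightarrow> c (Lam_plane (region_below p (cell T n k t))) = c (Lam_plane (region_below q (cell T n k t)))"
  shows "grid_state p c T n z t m = grid_state q c T n z t m"
  using assms by (induction m) (simp_all add: step_def)

locale driven_noise = noise +
  fixes T :: real and x y :: nat
  assumes T: "0 < T"
begin

abbreviation "law \<equiv> distr M pattern_space noise_pattern"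
abbreviation "F p \<omega> \<equiv> flow p T x y (noise_pattern \<omega>)"
abbreviation "occ \<equiv> occupation law T x y"

lemma F_cadlag: "profile p \<Longrightarrow> \<omega> \<in> space M \<Longrightarrow> F p \<omega> \<in> cadlag_paths T"
  using realisation.flow_cadlag[OF noise_realisation[OF _ T]] by (simp add: noise_pattern_def)

lemma F_evaluation_measurable:
  assumes "profile p" "t \<in> {0..T}"
  shows "(\<lambda>\<omega>. F p \<omega> t) \<in> measurable M (count_space UNIV)"
  using measurable_compose[OF noise_pattern_measurable flow_measurable[of p T t x y]] assms T by (simp add: profile_def)

lemma F_measurable: "profile p \<Longrightarrow> F p \<in> measurable M (skorohod_borel T)"
  by (rule measurable_skorohod_borelI[OF T F_cadlag F_evaluation_measurable])

lemma occupation_eq: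
  assumes "profile p" "t \<in> {0..T}"
  shows "occ p t = measure M {\<omega> \<in> space M. 0 < fst (F p \<omega> t)}"
proof -
  have "(\<lambda>c. flow p T x y c t) \<in> measurable pattern_space (count_space UNIV)"
    using assms T by (intro flow_measurable) (auto simp: profile_def)
  then have "{c \<in> space pattern_space. 0 < fst (flow p T x y c t)} \<in> sets pattern_space"
    using measurable_sets[of "\<lambda>c. flow p T x y c t" pattern_space "count_space UNIV" "{v. 0 < fst v}"]
    by (simp add: vimage_def Int_def conj_commute)
  then have "occ p t = measure M (noise_pattern -` {c \<in> space pattern_space. 0 < fst (flow p T x y c t)} \<inter> space M)"
    using assms(2) by (simp add: occupation_def measure_distr[OF noise_pattern_measurable])
  also have "noise_pattern -` {c \<in> space pattern_space. 0 < fst (flow p T x y c t)} \<inter> space M =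
      {\<omega> \<in> space M. 0 < fst (F p \<omega> t)}"
    using measurable_space[OF noise_pattern_measurable] by auto
  finally show ?thesis .
qed

lemma occupation_outside: "t \<notin> {0..T} \<Longrightarrow> occ p t = 0"
  unfolding occupation_def by (simp only: if_False)

lemma occupation_profile:
  assumes "profile p"
  shows "profile (occ p)"
proof -
  have "occ p = (\<lambda>s. if s \<in> {0..T} then measure M {\<omega> \<in> space M. 0 < fst (F p \<omega> s)} else 0)"
    using occupation_eq[OF assms] occupation_outside by (intro ext) (simp del: atLeastAtMost_iff)
  then have "occ p \<in> borel_measurable borel"
    using occupation_borel[OF A.prob_space_axioms T F_measurable[OF assms]] by simp
  moreover have "0 \<le> occ p s \<and> occ p s \<le> 1" for s
  proof (cases "s \<in> {0..T}")
    case True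
    then show ?thesis using occupation_eq[OF assms True] by simp
  next
    case False
    then show ?thesis using occupation_outside[OF False] by simp
  qed
  ultimately show ?thesis by (simp add: profile_def)
qed

text \<open>Where the graphs of p and q disagree about an arrival up to time t. Without a point in this region the
  two profiles drive the same path up to t.\<close>

definition profile_gap :: "(real \<Rightarrow> real) \<Rightarrow> (real \<Rightarrow> real) \<Rightarrow> real \<Rightarrow> (real \<times> real) set" where
  "profile_gap p q t = (region_below p {0..t} - region_below q {0..t}) \<union> (region_below q {0..t} - region_below p {0..t})"

lemma profile_gap_bounded_plane:
  assumes "profile p" "profile q"
  shows "profile_gap p q t \<in> bounded_plane"
proof -
  have l: "{0..t} \<in> bounded_line" by (rule interval_bounded_line) simp
  have "region_below p {0..t} \<in> bounded_plane" "region_below q {0..t} \<in> bounded_plane"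
    using assms l by (auto intro!: region_below_bounded_plane simp: profile_def)
  then have b: "region_below p {0..t} \<in> sets borel" "region_below p {0..t} \<subseteq> {0..} \<times> {0..}" "bounded (region_below p {0..t})"
    "region_below q {0..t} \<in> sets borel" "region_below q {0..t} \<subseteq> {0..} \<times> {0..}" "bounded (region_below q {0..t})"
    by (simp_all add: bounded_plane_def)
  have "profile_gap p q t \<in> sets borel" unfolding profile_gap_def using b by blast
  moreover have "profile_gap p q t \<subseteq> {0..} \<times> {0..}" unfolding profile_gap_def using b by blast
  moreover have "bounded (profile_gap p q t)"
    by (rule bounded_subset[of "region_below p {0..t} \<union> region_below q {0..t}"]) (use b in \<open>auto simp: profile_gap_def\<close>)
  ultimately show ?thesis by (simp add: bounded_plane_def)
qed

lemma F_eq_if_gap_empty: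
  assumes p: "profile p" and q: "profile q" and \<omega>: "\<omega> \<in> space M" and t: "t \<in> {0..T}"
    and z: "num_points (N2lam \<omega>) (profile_gap p q t) = 0"
  shows "F p \<omega> t = F q \<omega> t"
proof -
  interpret P: realisation "N\<mu> \<omega>" "Nlam \<omega>" "N2\<mu> \<omega>" "N2lam \<omega>" T p y by (rule noise_realisation[OF \<omega> T p])
  have AE: "AE z in N2lam \<omega>. z \<notin> profile_gap p q t"
    by (rule P.\<delta>.num_points_zero_AE[OF _ _ z]) (use P.plane_sets[OF profile_gap_bounded_plane[OF p q]] in auto)
  have eq: "noise_pattern \<omega> (Lam_plane (region_below p A)) = noise_pattern \<omega> (Lam_plane (region_below q A))"
    if A: "A \<in> bounded_line" "A \<subseteq> {0..t}" for A
  proof -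
    have b: "region_below p A \<in> bounded_plane" "region_below q A \<in> bounded_plane"
      using p q A(1) by (auto intro!: region_below_bounded_plane simp: profile_def)
    have "num_points (N2lam \<omega>) (region_below p A) = num_points (N2lam \<omega>) (region_below q A)"
    proof (rule P.\<delta>.num_points_AE_cong)
      show "AE z in N2lam \<omega>. z \<in> region_below p A \<longleftrightarrow> z \<in> region_below q A"
        using AE by (rule eventually_mono) (use A(2) in \<open>auto simp: profile_gap_def region_below_def\<close>)
    qed (use P.plane_sets[OF b(1)] P.plane_sets[OF b(2)] in auto)
    then show ?thesis using b by (simp add: noise_pattern_def pattern_simps)
  qed
  have "grid_state p (noise_pattern \<omega>) T n (x, y) t n = grid_state q (noise_pattern \<omega>) T n (x, y) t n" for n
  proof (rule grid_state_profile_cong, rule eq)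
    fix k
    show "cell T n k t \<in> bounded_line" using T by (intro cell_bounded_line) simp
    have "0 \<le> grid_point T n k" using T by (simp add: grid_point_def)
    then show "cell T n k t \<subseteq> {0..t}" by (auto simp: cell_def)
  qed
  note eq_grid = this
  show ?thesis
  proof (cases "\<exists>n. sparse_grid (noise_pattern \<omega>) T (real (level (noise_pattern \<omega>) T y)) n")
    case True
    then show ?thesis using t by (simp only: flow_def if_True grid_path_def restrict_apply eq_grid)
  next
    case False
    then show ?thesis by (simp only: flow_def if_False)
  qed
qed

text \<open>Fubini: the mean number of points is lam times the integral of the distance of the profiles over [0,t].\<close>

lemma measure_profile_gap_le:
  assumes p: "profile p" and q: "profile q" and C: "0 \<le> C" and t: "t \<in> {0..T}"
    and d: "\<And>s. s \<in> {0..T} \<Longrightarrow> \<bar>p s - q s\<bar> \<le> C * exp (2 * lam * s)"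
  shows "measure (quadrant_intensity lam) (profile_gap p q t) \<le> C / 2 * exp (2 * lam * t)"
proof -
  have B: "profile_gap p q t \<in> sets borel" "profile_gap p q t \<subseteq> {0..} \<times> {0..}"
    using profile_gap_bounded_plane[OF p q, of t] by (auto simp: bounded_plane_def)
  let ?f = "\<lambda>s. C * exp (2 * lam * s)"
  let ?F = "\<lambda>s. C / (2 * lam) * exp (2 * lam * s)"
  have sec: "emeasure lborel (Pair s -` profile_gap p q t) \<le> ennreal (?f s) * indicator {0..t} s" for s
  proof (cases "s \<in> {0..t}")
    case True
    have "Pair s -` profile_gap p q t \<subseteq> {min (p s) (q s)..max (p s) (q s)}"
      by (auto simp: profile_gap_def region_below_def)
    then have "emeasure lborel (Pair s -` profile_gap p q t) \<le> emeasure lborel {min (p s) (q s)..max (p s) (q s)}"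
      by (rule emeasure_mono) simp
    also have "\<dots> = ennreal \<bar>p s - q s\<bar>" by (auto simp: min_def max_def)
    also have "\<dots> \<le> ennreal (?f s)" using d[of s] True t by (intro ennreal_leI) auto
    finally show ?thesis using True by simp
  next
    case False
    then have "Pair s -` profile_gap p q t = {}" by (auto simp: profile_gap_def region_below_def)
    then show ?thesis by simp
  qed
  have "emeasure lborel (profile_gap p q t) = emeasure (lborel \<Otimes>\<^sub>M lborel) (profile_gap p q t)" by (simp only: lborel_prod)
  also have "\<dots> = (\<integral>\<^sup>+s. emeasure lborel (Pair s -` profile_gap p q t) \<partial>lborel)"
    using B(1) by (intro lborel.emeasure_pair_measure_alt) (simp only: lborel_prod sets_lborel)
  also have "\<dots> \<le> (\<integral>\<^sup>+s. ennreal (?f s) * indicator {0..t} s \<partial>lborel)"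
    by (intro nn_integral_mono sec)
  also have "\<dots> = ennreal (?F t - ?F 0)"
  proof (rule nn_integral_FTC_Icc)
    show "?f \<in> borel_measurable borel" by measurable
    show "(?F has_real_derivative ?f s) (at s)" for s
    proof -
      have "(?F has_real_derivative C / (2 * lam) * (exp (2 * lam * s) * (2 * lam))) (at s)"
        by (auto intro!: derivative_eq_intros)
      moreover have "C / (2 * lam) * (exp (2 * lam * s) * (2 * lam)) = ?f s" using rates by simp
      ultimately show ?thesis by simp
    qed
    show "0 \<le> ?f s" for s using C by simp
    show "0 \<le> t" using t by simp
  qed
  finally have "emeasure (quadrant_intensity lam) (profile_gap p q t) \<le> ennreal lam * ennreal (?F t - ?F 0)"
    by (subst emeasure_quadrant_intensity[OF B]) (rule mult_left_mono, auto)
  also have "\<dots> = ennreal (lam * (?F t - ?F 0))" using rates by (simp add: ennreal_mult')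
  finally have 1: "emeasure (quadrant_intensity lam) (profile_gap p q t) \<le> ennreal (lam * (?F t - ?F 0))" .
  have "lam * (?F t - ?F 0) = C / 2 * (exp (2 * lam * t) - 1)" using rates by (simp add: field_simps)
  also have "\<dots> \<le> C / 2 * exp (2 * lam * t)" using C by (intro mult_left_mono) auto
  finally have "emeasure (quadrant_intensity lam) (profile_gap p q t) \<le> ennreal (C / 2 * exp (2 * lam * t))"
    by (rule order_trans[OF 1 ennreal_leI])
  then show ?thesis unfolding measure_def using C by (intro enn2real_leI) auto
qed

text \<open>A coupling by common noise: the two paths differ at time t only if there is a point in the gap of the
  profiles. The weight exp (2 lam s) turns the integral of the distances into a factor 1/2, whatever T is.\<close>

lemma occupation_contraction:
  assumes p: "profile p" and q: "profile q" and C: "0 \<le> C"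
    and d: "\<And>s. s \<in> {0..T} \<Longrightarrow> \<bar>p s - q s\<bar> \<le> C * exp (2 * lam * s)" and t: "t \<in> {0..T}"
  shows "\<bar>occ p t - occ q t\<bar> \<le> C / 2 * exp (2 * lam * t)"
proof -
  let ?E = "\<lambda>p. {\<omega> \<in> space M. 0 < fst (F p \<omega> t)}"
  let ?D = "{\<omega> \<in> space M. 1 \<le> num_points (N2lam \<omega>) (profile_gap p q t)}"
  have B: "profile_gap p q t \<in> sets (quadrant_intensity lam)" "bounded (profile_gap p q t)"
    using profile_gap_bounded_plane[OF p q, of t] by (auto simp: bounded_plane_def sets_quadrant_intensity)
  have E: "?E p' \<in> sets M" if "profile p'" for p'
    using measurable_sets[OF F_evaluation_measurable[OF that t], of "{v. 0 < fst v}"]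
    by (simp add: vimage_def Int_def conj_commute)
  have D: "?D \<in> sets M" using D.count_sets[OF B(1), of "{1..}"] by simp
  have sub: "?E p \<subseteq> ?E q \<union> ?D" "?E q \<subseteq> ?E p \<union> ?D"
    using F_eq_if_gap_empty[OF p q _ t] by (auto simp: not_less_eq_eq)
  have le: "A.prob (?E p') \<le> A.prob (?E q') + A.prob ?D" if "?E p' \<subseteq> ?E q' \<union> ?D" "profile p'" "profile q'" for p' q'
  proof -
    have "A.prob (?E p') \<le> A.prob (?E q' \<union> ?D)" using that E D by (intro A.finite_measure_mono) auto
    also have "\<dots> \<le> A.prob (?E q') + A.prob ?D" using E[OF that(3)] D by (rule measure_Un_le)
    finally show ?thesis .
  qed
  have "A.prob ?D \<le> C / 2 * exp (2 * lam * t)"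
    using D.prob_count_pos[OF B quadrant_intensity_finite[OF B]] measure_profile_gap_le[OF p q C t d] by linarith
  then show ?thesis
    using le[OF sub(1) p q] le[OF sub(2) q p] occupation_eq[OF p t] occupation_eq[OF q t] by linarith
qed

lemma occupation_contraction_everywhere:
  assumes p: "profile p" and q: "profile q" and C: "0 \<le> C"
    and d: "\<And>s. \<bar>p s - q s\<bar> \<le> C * exp (2 * lam * s)"
  shows "\<bar>occ p t - occ q t\<bar> \<le> C / 2 * exp (2 * lam * t)"
proof (cases "t \<in> {0..T}")
  case True
  then show ?thesis by (rule occupation_contraction[OF p q C d])
next
  case False
  then show ?thesis using C occupation_outside[OF False] by simp
qed

lemma fixed_point_unique:
  assumes p: "profile p" "occ p = p" and q: "profile q" "occ q = q"
  shows "p = q"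
proof
  fix t
  have bnd: "\<bar>p s - q s\<bar> \<le> (1 / 2) ^ n * exp (2 * lam * s)" for n s
  proof (induction n arbitrary: s)
    case 0
    show ?case
    proof (cases "s \<in> {0..T}")
      case True
      have "\<bar>p s - q s\<bar> \<le> 1" using p(1) q(1) unfolding profile_def by (smt (verit))
      also have "1 \<le> exp (2 * lam * s)" using rates True by simp
      finally show ?thesis by simp
    next
      case False
      then have "p s = 0" "q s = 0" using occupation_outside[OF False] p(2) q(2) by metis+
      then show ?thesis by simp
    qed
  next
    case (Suc n)
    have "\<bar>occ p s - occ q s\<bar> \<le> (1 / 2) ^ n / 2 * exp (2 * lam * s)"
      by (rule occupation_contraction_everywhere[OF p(1) q(1) _ Suc.IH]) simp
    then show ?case using p(2) q(2) by (simp add: mult.commute)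
  qed
  have "(\<lambda>n. (1 / 2) ^ n * exp (2 * lam * t)) \<longlonglongrightarrow> 0 * exp (2 * lam * t)"
    by (intro tendsto_mult tendsto_const LIMSEQ_power_zero) simp
  then have "\<bar>p t - q t\<bar> \<le> 0 * exp (2 * lam * t)"
    by (rule LIMSEQ_le_const) (use bnd in auto)
  then show "p t = q t" by simp
qed

text \<open>Picard iteration from the zero profile; the iterates are uniformly Cauchy in the weighted distance.\<close>

lemma fixed_point_exists: "\<exists>p. profile p \<and> occ p = p"
proof -
  define P where "P n = (occ ^^ n) (\<lambda>_. 0)" for n
  have P_Suc: "P (Suc n) = occ (P n)" for n by (simp add: P_def)
  have prof: "profile (P n)" for n
    by (induction n) (simp_all add: P_Suc occupation_profile, simp add: P_def profile_def)
  have P_out: "P n s = 0" if "s \<notin> {0..T}" for n s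
    using occupation_outside[OF that] by (cases n) (simp_all add: P_Suc, simp add: P_def)
  \<comment> \<open>Induction on n for all j at once spares a geometric series: contraction shifts both indices.\<close>
  have bnd: "\<bar>P (n + j) s - P n s\<bar> \<le> (1 / 2) ^ n * exp (2 * lam * s)" for n j s
  proof (induction n arbitrary: s)
    case 0
    show ?case
    proof (cases "s \<in> {0..T}")
      case True
      have "\<bar>P j s - P 0 s\<bar> \<le> 1" using prof[of j] prof[of 0] unfolding profile_def by (smt (verit))
      also have "1 \<le> exp (2 * lam * s)" using rates True by simp
      finally show ?thesis by simp
    next
      case False
      then show ?thesis using P_out[OF False] by simp
    qed
  next
    case (Suc n)
    have "\<bar>occ (P (n + j)) s - occ (P n) s\<bar> \<le> (1 / 2) ^ n / 2 * exp (2 * lam * s)"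
      by (rule occupation_contraction_everywhere[OF prof prof _ Suc.IH]) simp
    then show ?case by (simp add: P_Suc mult.commute)
  qed
  have pow0: "(\<lambda>n. (1 / 2) ^ n * exp (2 * lam * s)) \<longlonglongrightarrow> 0" for s
    using tendsto_mult[OF LIMSEQ_power_zero[of "1 / 2 :: real"] tendsto_const[of "exp (2 * lam * s)"]] by simp
  have conv: "convergent (\<lambda>n. P n s)" for s
  proof -
    have "Cauchy (\<lambda>n. P n s)"
    proof (rule metric_CauchyI)
      fix e :: real assume e: "0 < e"
      from order_tendstoD(2)[OF pow0[of s], of "e / 2"] e obtain N where N: "(1 / 2) ^ N * exp (2 * lam * s) < e / 2"
        by (auto simp: eventually_sequentially)
      have near: "dist (P m s) (P N s) < e / 2" if "N \<le> m" for m
        using bnd[of N "m - N" s] N that by (simp add: dist_real_def)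
      have "dist (P m s) (P n s) < e" if "N \<le> m" "N \<le> n" for m n
        by (rule dist_triangle_half_l[OF near[OF that(1)] near[OF that(2)]])
      then show "\<exists>N. \<forall>m\<ge>N. \<forall>n\<ge>N. dist (P m s) (P n s) < e" by blast
    qed
    then show ?thesis by (rule Cauchy_convergent)
  qed
  define p where "p s = lim (\<lambda>n. P n s)" for s
  have lim: "(\<lambda>n. P n s) \<longlonglongrightarrow> p s" for s
    using conv[of s] unfolding p_def by (simp add: convergent_LIMSEQ_iff)
  have prof_p: "profile p"
  proof -
    have "p \<in> borel_measurable borel"
      by (rule borel_measurable_LIMSEQ_real[OF lim]) (use prof in \<open>auto simp: profile_def\<close>)
    moreover have "0 \<le> p s" "p s \<le> 1" for s
      using LIMSEQ_le_const[OF lim[of s]] LIMSEQ_le_const2[OF lim[of s]] prof unfolding profile_def by blast+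
    ultimately show ?thesis by (simp add: profile_def)
  qed
  have close: "\<bar>p s - P n s\<bar> \<le> (1 / 2) ^ n * exp (2 * lam * s)" for n s
  proof (rule LIMSEQ_le_const2)
    have "(\<lambda>j. P (j + n) s) \<longlonglongrightarrow> p s" using lim[of s] by (rule LIMSEQ_ignore_initial_segment)
    then show "(\<lambda>j. \<bar>P (j + n) s - P n s\<bar>) \<longlonglongrightarrow> \<bar>p s - P n s\<bar>" by (intro tendsto_intros)
    show "\<exists>N. \<forall>j\<ge>N. \<bar>P (j + n) s - P n s\<bar> \<le> (1 / 2) ^ n * exp (2 * lam * s)"
      using bnd[of n _ s] by (simp add: add.commute)
  qed
  have "occ p t = p t" for t
  proof -
    have "\<bar>occ p t - p t\<bar> \<le> 2 * ((1 / 2) ^ n * exp (2 * lam * t))" for n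
    proof -
      have "\<bar>occ p t - occ (P n) t\<bar> \<le> (1 / 2) ^ n / 2 * exp (2 * lam * t)"
        by (rule occupation_contraction_everywhere[OF prof_p prof _ close]) simp
      moreover have "\<bar>p t - occ (P n) t\<bar> \<le> (1 / 2) ^ n / 2 * exp (2 * lam * t)"
        using close[of t "Suc n"] by (simp add: P_Suc mult.commute)
      moreover have "(1 / 2) ^ n / 2 * exp (2 * lam * t) = ((1 / 2) ^ n * exp (2 * lam * t)) / 2"
        "0 \<le> (1 / 2) ^ n * exp (2 * lam * t)" by simp_all
      ultimately show ?thesis by linarith
    qed
    note occ_close = this
    have "(\<lambda>n. 2 * ((1 / 2) ^ n * exp (2 * lam * t))) \<longlonglongrightarrow> 2 * 0"
      by (intro tendsto_mult tendsto_const pow0)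
    then have "\<bar>occ p t - p t\<bar> \<le> 2 * 0"
      by (rule LIMSEQ_le_const) (intro exI[of _ 0] allI impI occ_close)
    then show ?thesis by simp
  qed
  then show ?thesis using prof_p by blast
qed

abbreviation "solution R \<equiv> mckean_vlasov_solution M N\<mu> Nlam N2\<mu> N2lam T x y R"

lemma solution_iff_solves:
  "solution R \<longleftrightarrow> R \<in> measurable M (skorohod_borel T) \<and>
    (AE \<omega> in M. solves_equations (N\<mu> \<omega>) (Nlam \<omega>) (N2\<mu> \<omega>) (N2lam \<omega>) T
      (\<lambda>s. measure M {\<omega>' \<in> space M. 0 < fst (R \<omega>' s)}) x y (R \<omega>))"
  unfolding mckean_vlasov_solution_def solves_equations_def rhs1_def rhs2_def ..

lemma solves_equations_profile_cong:
  assumes "\<And>s. s \<in> {0..T} \<Longrightarrow> p s = q s"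
  shows "solves_equations \<alpha> \<beta> \<gamma> \<delta> T p x y f \<longleftrightarrow> solves_equations \<alpha> \<beta> \<gamma> \<delta> T q x y f"
proof -
  have "rhs2 \<alpha> \<beta> \<gamma> \<delta> p y u t = rhs2 \<alpha> \<beta> \<gamma> \<delta> q y u t" if "t \<in> {0..T}" for u t
    by (rule rhs_cong) (use assms that in auto)
  then show ?thesis unfolding solves_equations_def by simp
qed

text \<open>Existence and uniqueness for a given profile, simultaneously for all paths on an event of probability 1.\<close>

lemma AE_solves_iff_flow:
  assumes p: "profile p"
  shows "AE \<omega> in M. \<forall>f. f \<in> cadlag_paths T \<and>
    solves_equations (N\<mu> \<omega>) (Nlam \<omega>) (N2\<mu> \<omega>) (N2lam \<omega>) T p x y f \<longleftrightarrow> f = F p \<omega>"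
  using AE_sparse[OF T, of y] AE_space
proof eventually_elim
  case (elim \<omega>)
  interpret P: realisation "N\<mu> \<omega>" "Nlam \<omega>" "N2\<mu> \<omega>" "N2lam \<omega>" T p y by (rule noise_realisation[OF elim(2) T p])
  show ?case using P.solves_iff_flow[of _ x] elim(1) unfolding noise_pattern_def by blast
qed

lemma fixed_point_solution:
  assumes p: "profile p" "occ p = p"
  shows "solution (F p)"
  unfolding solution_iff_solves
proof (intro conjI F_measurable p)
  have eq: "measure M {\<omega>' \<in> space M. 0 < fst (F p \<omega>' s)} = p s" if "s \<in> {0..T}" for s
    using occupation_eq[OF p(1) that] p(2) by simp
  show "AE \<omega> in M. solves_equations (N\<mu> \<omega>) (Nlam \<omega>) (N2\<mu> \<omega>) (N2lam \<omega>) T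
      (\<lambda>s. measure M {\<omega>' \<in> space M. 0 < fst (F p \<omega>' s)}) x y (F p \<omega>)"
    using AE_solves_iff_flow[OF p(1)]
    by (rule eventually_mono)
      (use solves_equations_profile_cong[of "\<lambda>s. measure M {\<omega>' \<in> space M. 0 < fst (F p \<omega>' s)}" p, OF eq] in blast)
qed

text \<open>The probabilities of a solution form a profile q, and almost surely the solution is the flow that q
  drives. So q reproduces itself under the occupation map, and uniqueness of the fixed point applies.\<close>

lemma solution_is_fixed_point_flow:
  assumes p: "profile p" "occ p = p" and R: "solution R"
  shows "AE \<omega> in M. R \<omega> = F p \<omega>"
proof -
  define q where "q s = (if s \<in> {0..T} then measure M {\<omega> \<in> space M. 0 < fst (R \<omega> s)} else 0)" for s
  have Rm: "R \<in> measurable M (skorohod_borel T)" using R by (simp add: solution_iff_solves)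
  have q_eq: "q = (\<lambda>s. if s \<in> {0..T} then measure M {\<omega> \<in> space M. 0 < fst (R \<omega> s)} else 0)"
    by (rule ext) (rule q_def)
  have "q \<in> borel_measurable borel" unfolding q_eq by (rule occupation_borel[OF A.prob_space_axioms T Rm])
  moreover have "0 \<le> q s \<and> q s \<le> 1" for s unfolding q_def by simp
  ultimately have q: "profile q" by (simp add: profile_def)
  have "AE \<omega> in M. solves_equations (N\<mu> \<omega>) (Nlam \<omega>) (N2\<mu> \<omega>) (N2lam \<omega>) T
      (\<lambda>s. measure M {\<omega>' \<in> space M. 0 < fst (R \<omega>' s)}) x y (R \<omega>)"
    using R by (simp add: solution_iff_solves)
  moreover have "measure M {\<omega>' \<in> space M. 0 < fst (R \<omega>' s)} = q s" if "s \<in> {0..T}" for s using that by (simp add: q_def)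
  ultimately have sol: "AE \<omega> in M. solves_equations (N\<mu> \<omega>) (Nlam \<omega>) (N2\<mu> \<omega>) (N2lam \<omega>) T q x y (R \<omega>)"
    using solves_equations_profile_cong[of "\<lambda>s. measure M {\<omega>' \<in> space M. 0 < fst (R \<omega>' s)}" q] by simp
  have RF: "AE \<omega> in M. R \<omega> = F q \<omega>"
    using AE_solves_iff_flow[OF q] sol AE_space
  proof eventually_elim
    case (elim \<omega>)
    have "R \<omega> \<in> cadlag_paths T" using measurable_space[OF Rm elim(3)] by (simp add: space_skorohod_borel)
    then show ?case using elim by blast
  qed
  have "occ q s = q s" for s
  proof (cases "s \<in> {0..T}")
    case True
    have "{\<omega> \<in> space M. 0 < fst (R \<omega> s)} \<in> sets M" "{\<omega> \<in> space M. 0 < fst (F q \<omega> s)} \<in> sets M"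
      using measurable_sets[OF measurable_compose[OF Rm evaluation_measurable[OF T True]], of "{v. 0 < fst v}"]
        measurable_sets[OF F_evaluation_measurable[OF q True], of "{v. 0 < fst v}"]
      by (simp_all add: vimage_def Int_def conj_commute)
    then have "measure M {\<omega> \<in> space M. 0 < fst (R \<omega> s)} = measure M {\<omega> \<in> space M. 0 < fst (F q \<omega> s)}"
      by (intro A.finite_measure_eq_AE) (use RF in \<open>auto elim!: eventually_mono\<close>)
    then show ?thesis using occupation_eq[OF q True] True by (simp add: q_def)
  next
    case False
    then show ?thesis using occupation_outside[OF False] unfolding q_def by (simp only: if_False)
  qed
  then have "occ q = q" by blast
  then have "q = p" using fixed_point_unique[OF q _ p] by blast
  then show ?thesis using RF by simp
qed

lemma solution_laws_eq:
  assumes p: "profile p" "occ p = p"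
  shows "solution_laws M N\<mu> Nlam N2\<mu> N2lam T x y = {distr M (skorohod_borel T) (F p)}"
proof -
  have "distr M (skorohod_borel T) R = distr M (skorohod_borel T) (F p)" if R: "solution R" for R
  proof (rule distr_cong_AE)
    show "AE \<omega> in M. R \<omega> = F p \<omega>" by (rule solution_is_fixed_point_flow[OF p R])
    show "R \<in> measurable M (skorohod_borel T)" using R by (simp add: solution_iff_solves)
    show "F p \<in> measurable M (skorohod_borel T)" by (rule F_measurable[OF p(1)])
  qed simp_all
  then show ?thesis using fixed_point_solution[OF p] unfolding solution_laws_def by blast
qed

text \<open>The flow is a measurable function of the record of the noise, so its law is an image of the law of the
  record.\<close>

lemma law_of_cylinder:
  assumes p: "profile p" and J: "finite J" "J \<subseteq> {0..T}"
  shows "measure (distr M (skorohod_borel T) (F p)) {f \<in> cadlag_paths T. \<forall>t\<in>J. f t \<in> A t} =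
    measure law {c \<in> space pattern_space. \<forall>t\<in>J. flow p T x y c t \<in> A t}"
proof -
  have S: "{f \<in> cadlag_paths T. \<forall>t\<in>J. f t \<in> A t} \<in> sets (skorohod_borel T)"
    unfolding space_skorohod_borel[symmetric]
  proof (intro sets.sets_Collect_finite_All J(1))
    fix t assume "t \<in> J"
    then have "t \<in> {0..T}" using J(2) by blast
    from measurable_sets[OF evaluation_measurable[OF T this], of "A t"]
    show "{f \<in> space (skorohod_borel T). f t \<in> A t} \<in> sets (skorohod_borel T)"
      by (simp add: vimage_def Int_def conj_commute)
  qed
  have S': "{c \<in> space pattern_space. \<forall>t\<in>J. flow p T x y c t \<in> A t} \<in> sets pattern_space"
  proof (intro sets.sets_Collect_finite_All J(1))
    fix t assume "t \<in> J"
    then have "(\<lambda>c. flow p T x y c t) \<in> measurable pattern_space (count_space UNIV)"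
      using J(2) p T by (intro flow_measurable) (auto simp: profile_def)
    from measurable_sets[OF this, of "A t"]
    show "{c \<in> space pattern_space. flow p T x y c t \<in> A t} \<in> sets pattern_space"
      by (simp add: vimage_def Int_def conj_commute)
  qed
  have "F p -` {f \<in> cadlag_paths T. \<forall>t\<in>J. f t \<in> A t} \<inter> space M =
    noise_pattern -` {c \<in> space pattern_space. \<forall>t\<in>J. flow p T x y c t \<in> A t} \<inter> space M"
    using F_cadlag[OF p] measurable_space[OF noise_pattern_measurable] by auto
  then show ?thesis
    using measure_distr[OF F_measurable[OF p] S] measure_distr[OF noise_pattern_measurable S'] by simp
qed

end

theorem theorem1:
  fixes lam \<mu> T :: real and x y :: nat
    and M :: "'a measure"
    and N\<mu> Nlam :: "'a \<Rightarrow> real measure" and N2\<mu> N2lam :: "'a \<Rightarrow> (real \<times> real) measure"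
    and M' :: "'b measure"
    and N\<mu>' Nlam' :: "'b \<Rightarrow> real measure" and N2\<mu>' N2lam' :: "'b \<Rightarrow> (real \<times> real) measure"
  assumes "lam > 0" and "\<mu> > 0" and "T > 0"
    and "driving_noise M \<mu> lam N\<mu> Nlam N2\<mu> N2lam"
    and "driving_noise M' \<mu> lam N\<mu>' Nlam' N2\<mu>' N2lam'"
  shows "(\<exists>R. mckean_vlasov_solution M N\<mu> Nlam N2\<mu> N2lam T x y R \<and>
             (\<forall>R'. mckean_vlasov_solution M N\<mu> Nlam N2\<mu> N2lam T x y R' \<longrightarrow>
                   (AE \<omega> in M. R' \<omega> = R \<omega>))) \<and>
         (\<exists>\<pi>. solution_laws M N\<mu> Nlam N2\<mu> N2lam T x y = {\<pi>} \<and>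
              solution_laws M' N\<mu>' Nlam' N2\<mu>' N2lam' T x y = {\<pi>})"
proof -
  interpret X: driven_noise M \<mu> lam N\<mu> Nlam N2\<mu> N2lam T x y
    by unfold_locales (use assms in auto)
  interpret Y: driven_noise M' \<mu> lam N\<mu>' Nlam' N2\<mu>' N2lam' T x y
    by unfold_locales (use assms in auto)
  have law: "X.law = Y.law"
    by (rule noise_pattern_law_unique[OF X.noise_axioms Y.noise_axioms])
  obtain p where p: "profile p" "X.occ p = p" using X.fixed_point_exists by blast
  have p': "Y.occ p = p" using p(2) law by simp
  have same: "distr M (skorohod_borel T) (X.F p) = distr M' (skorohod_borel T) (Y.F p)"
  proof (rule skorohod_law_eqI[OF assms(3)])
    show "prob_space (distr M (skorohod_borel T) (X.F p))"
      by (rule X.A.prob_space_distr[OF X.F_measurable[OF p(1)]])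
    show "prob_space (distr M' (skorohod_borel T) (Y.F p))"
      by (rule Y.A.prob_space_distr[OF Y.F_measurable[OF p(1)]])
    show "measure (distr M (skorohod_borel T) (X.F p)) {f \<in> cadlag_paths T. \<forall>t\<in>J. f t \<in> A t} =
      measure (distr M' (skorohod_borel T) (Y.F p)) {f \<in> cadlag_paths T. \<forall>t\<in>J. f t \<in> A t}"
      if "finite J" "J \<subseteq> {0..T}" for J A
      unfolding X.law_of_cylinder[OF p(1) that] Y.law_of_cylinder[OF p(1) that] law ..
  qed simp_all
  show ?thesis
  proof (intro conjI exI allI impI)
    show "mckean_vlasov_solution M N\<mu> Nlam N2\<mu> N2lam T x y (X.F p)" by (rule X.fixed_point_solution[OF p])
    show "AE \<omega> in M. R' \<omega> = X.F p \<omega>" if "mckean_vlasov_solution M N\<mu> Nlam N2\<mu> N2lam T x y R'" for R'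
      by (rule X.solution_is_fixed_point_flow[OF p that])
    show "solution_laws M N\<mu> Nlam N2\<mu> N2lam T x y = {distr M (skorohod_borel T) (X.F p)}"
      by (rule X.solution_laws_eq[OF p])
    show "solution_laws M' N\<mu>' Nlam' N2\<mu>' N2lam' T x y = {distr M (skorohod_borel T) (X.F p)}"
      unfolding same by (rule Y.solution_laws_eq[OF p(1) p'])
  qed
qed

end
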